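(* Let $\Omega:=\,]0,+\infty[\times\mathbb{R}^2$. Then there is a vector field $b:\,]0,1[\times\Omega\to\mathbb{R}^3$ such that i) $b\in L^\infty(]0,1[\times\Omega;\mathbb{R}^3)$; ii) $\mathrm{div}\, b\equiv 0$; iii) for every open and bounded set $\Omega_*$ such that its closure satisfies $\bar\Omega_*\subseteq\Omega$, we have $b\in L^1([0,1[;BV(\Omega_*;\mathbb{R}^3))$; iv) $\mathrm{Tr}\, b\equiv 1$ on $]0,1[\times\partial\Omega$; v) the initial-boundary value problem $$\begin{cases}\partial_t u+\mathrm{div}(bu)=0&\text{in }]0,1[\times\Omega\\ u=0&\text{at }t=0\end{cases}$$ admits infinitely many different (distributional) solutions $u\in L^\infty(]0,1[\times\Omega)$.
   Context: Here $\mathrm{div}$ and $\nabla$ denote the (distributional) divergence and the gradient with respect to the space variable $x\in\Omega$ only; $\mathcal{H}^2$ is two-dimensional Hausdorff measure, and $L^\infty(]0,1[\times\partial\Omega)$ is taken with respect to $\mathcal{L}^1\otimes\mathcal{H}^2$. Normal trace of $b$ (with respect to the outward normal), for $b$ bounded with $\mathrm{div}\,b\equiv0$: $\mathrm{Tr}\, b\in L^\infty(]0,1[\times\partial\Omega)$ is the unique function such that for all $\varphi\in C^\infty_c([0,1[\times\mathbb{R}^3)$ $$\int_0^1\!\!\int_{\partial\Omega}\mathrm{Tr}\,b\;\varphi\,d\mathcal{H}^{2}dt-\int_\Omega\varphi(0,x)\,dx=\int_0^1\!\!\int_\Omega(\partial_t\varphi+b\cdot\nabla\varphi)\,dxdt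 .$$ Traces of $bu$: if $u\in L^\infty(]0,1[\times\Omega)$ satisfies $$\int_0^1\!\!\int_\Omega u(\partial_t\eta+b\cdot\nabla\eta)\,dxdt=0\quad\forall\,\eta\in C^\infty_c(]0,1[\times\Omega),\qquad( * )$$ then there are uniquely determined functions $\mathrm{Tr}(bu)\in L^\infty(]0,1[\times\partial\Omega)$ and $u_0\in L^\infty(\Omega)$ such that for all $\varphi\in C^\infty_c([0,1[\times\mathbb{R}^3)$ $$\int_0^1\!\!\int_{\partial\Omega}\mathrm{Tr}(bu)\,\varphi\,d\mathcal{H}^{2}dt-\int_\Omega\varphi(0,\cdot)u_0\,dx=\int_0^1\!\!\int_\Omega u(\partial_t\varphi+b\cdot\nabla\varphi)\,dxdt .$$ Boundary data are prescribed only on $\Gamma^-:=\{\mathrm{Tr}\,b<0\}\subseteq\,]0,1[\times\partial\Omega$. When $\mathrm{Tr}\,b\equiv1$, $\Gamma^-$ is empty (up to negligible sets), so no boundary condition is imposed: a distributional solution of the problem in v) is a $u\in L^\infty(]0,1[\times\Omega)$ satisfying $( * )$ and $u_0\equiv0$. *)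

theory Defs
  imports "HOL-Analysis.Analysis"
begin

subsection \<open>Differentiable functions and test functions\<close>

definition dir_deriv ::
  "'a::euclidean_space \<Rightarrow> ('a \<Rightarrow> 'b::real_normed_vector) \<Rightarrow> 'a \<Rightarrow> 'b" where
  "dir_deriv e f z = frechet_derivative f (at z) e"

primrec Ck :: "nat \<Rightarrow> ('a::euclidean_space \<Rightarrow> 'b::real_normed_vector) \<Rightarrow> bool" where
  "Ck 0 f \<longleftrightarrow> continuous_on UNIV f"
| "Ck (Suc n) f \<longleftrightarrow> (\<forall>x. f differentiable (at x)) \<and> (\<forall>e\<in>Basis. Ck n (dir_deriv e f))"

definition supp :: "('a::topological_space \<Rightarrow> 'b::zero) \<Rightarrow> 'a set" where
  "supp f = closure {x. f x \<noteq> 0}"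

text \<open>Elements of \<open>C\<^sup>k\<^sub>c(U)\<close> and \<open>C\<^sup>\<infinity>\<^sub>c(U)\<close>, for \<open>U\<close> open, are represented by their
  extensions by zero to the whole space.\<close>

definition Ck_c :: "nat \<Rightarrow> 'a::euclidean_space set \<Rightarrow> ('a \<Rightarrow> 'b::real_normed_vector) set" where
  "Ck_c k U = {f. Ck k f \<and> compact (supp f) \<and> supp f \<subseteq> U}"

definition Cinf_c :: "'a::euclidean_space set \<Rightarrow> ('a \<Rightarrow> 'b::real_normed_vector) set" where
  "Cinf_c U = (\<Inter>k. Ck_c k U)"

text \<open>A point of space-time is a pair \<open>(t, x)\<close>.\<close>

type_synonym spacetime = "real \<times> (real^3)"

definition dt :: "(spacetime \<Rightarrow> real) \<Rightarrow> spacetime \<Rightarrow> real" where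
  "dt \<phi> = dir_deriv (1, 0) \<phi>"

definition grad_x :: "(spacetime \<Rightarrow> real) \<Rightarrow> spacetime \<Rightarrow> real^3" where
  "grad_x \<phi> z = (\<chi> j. dir_deriv (0, axis j 1) \<phi> z)"

text \<open>Elements of \<open>C\<^sup>\<infinity>\<^sub>c([0,1[ \<times> \<real>\<^sup>3)\<close> are the restrictions to \<open>t \<ge> 0\<close> of the elements of
  \<open>C\<^sup>\<infinity>\<^sub>c(]-\<infinity>,1[ \<times> \<real>\<^sup>3)\<close>. Only their values and derivatives at \<open>t \<ge> 0\<close> are used below.\<close>

definition trace_test :: "(spacetime \<Rightarrow> real) set" where
  "trace_test = Cinf_c ({..<1} \<times> UNIV)"


subsection \<open>Hausdorff measure\<close>

text \<open>The normalisation \<open>\<omega>\<^sub>k 2\<^sup>-\<^sup>k (diam C)\<^sup>k\<close> is the one for which \<open>\<H>\<^sup>k\<close> agrees with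
  \<open>k\<close>-dimensional Lebesgue measure on \<open>k\<close>-dimensional planes. The requirement \<open>bounded\<close> is
  there because \<open>diameter\<close> is unspecified on unbounded sets.\<close>

definition hausdorff_pre :: "nat \<Rightarrow> real \<Rightarrow> 'a::metric_space set \<Rightarrow> ennreal" where
  "hausdorff_pre k \<delta> A =
     (INF C \<in> {C :: nat \<Rightarrow> 'a set. A \<subseteq> (\<Union>i. C i) \<and> (\<forall>i. bounded (C i) \<and> diameter (C i) \<le> \<delta>)}.
        \<Sum>i. if C i = {} then 0 else ennreal (unit_ball_vol (real k) * (diameter (C i) / 2) ^ k))"

definition hausdorff_outer :: "nat \<Rightarrow> 'a::metric_space set \<Rightarrow> ennreal" where
  "hausdorff_outer k A = (SUP \<delta>\<in>{0<..}. hausdorff_pre k \<delta> A)"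

text \<open>By Caratheodory's criterion, the metric outer measure \<open>hausdorff_outer k\<close> is countably
  additive on the Borel sets, so \<open>measure_of\<close> does produce the measure with these values.\<close>

definition hausdorff_measure :: "nat \<Rightarrow> 'a::metric_space measure" where
  "hausdorff_measure k = measure_of UNIV (sets borel) (hausdorff_outer k)"


subsection \<open>Function spaces\<close>

text \<open>We work with Borel representatives; every class of Lebesgue measurable functions modulo
  equality almost everywhere contains one.\<close>

abbreviation lborel_on :: "'a::euclidean_space set \<Rightarrow> 'a measure" where
  "lborel_on S \<equiv> restrict_space lborel S"

definition Linfty :: "'a measure \<Rightarrow> ('a \<Rightarrow> 'b::{real_normed_vector, second_countable_topology}) set" where
  "Linfty M = {f \<in> borel_measurable M. \<exists>C. AE z in M. norm (f z) \<le> C}"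

definition ae_eq :: "'a measure \<Rightarrow> (('a \<Rightarrow> 'b) \<times> ('a \<Rightarrow> 'b)) set" where
  "ae_eq M = {(f, g). AE z in M. f z = g z}"

definition interior_measure :: "(real^3) set \<Rightarrow> spacetime measure" where
  "interior_measure \<Omega> = lborel_on ({0<..<1} \<times> \<Omega>)"

definition boundary_measure :: "(real^3) set \<Rightarrow> spacetime measure" where
  "boundary_measure \<Omega> =
     lborel_on {0<..<1} \<Otimes>\<^sub>M restrict_space (hausdorff_measure 2) (frontier \<Omega>)"

text \<open>Total variation \<open>|Df|(U)\<close> of \<open>f \<in> L\<^sup>1(U; \<real>\<^sup>m)\<close>; the norm of the matrix \<open>\<Phi> x\<close> is the
  Frobenius norm.\<close>

definition variation :: "(real^'n) set \<Rightarrow> (real^'n \<Rightarrow> real^'m) \<Rightarrow> ennreal" where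
  "variation U f =
     (SUP \<Phi> \<in> {\<Phi> :: real^'n \<Rightarrow> real^'n^'m. \<Phi> \<in> Ck_c 1 U \<and> (\<forall>x. norm (\<Phi> x) \<le> 1)}.
        ennreal (LINT x|lborel_on U.
          (\<Sum>i\<in>UNIV. f x $ i * (\<Sum>j\<in>UNIV. dir_deriv (axis j 1) (\<lambda>y. \<Phi> y $ i $ j) x))))"

definition BV :: "(real^'n) set \<Rightarrow> (real^'n \<Rightarrow> real^'m) set" where
  "BV U = {f. integrable (lborel_on U) f \<and> variation U f < \<infinity>}"

definition BV_norm :: "(real^'n) set \<Rightarrow> (real^'n \<Rightarrow> real^'m) \<Rightarrow> ennreal" where
  "BV_norm U f = (\<integral>\<^sup>+x. ennreal (norm (f x)) \<partial>lborel_on U) + variation U f"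

text \<open>\<open>L\<^sup>1([0,1[; BV(U; \<real>\<^sup>3))\<close>: \<open>b(t,\<cdot>) \<in> BV(U)\<close> for almost every \<open>t\<close> and the function
  \<open>t \<mapsto> \<parallel>b(t,\<cdot>)\<parallel>\<close> is measurable with finite integral. The Lebesgue completion makes the values
  at the exceptional times irrelevant.\<close>

definition L1_BV :: "(real^3) set \<Rightarrow> (spacetime \<Rightarrow> real^3) set" where
  "L1_BV U = {b.
     (AE t in lebesgue_on {0<..<1}. (\<lambda>x. b (t, x)) \<in> BV U) \<and>
     (\<lambda>t. BV_norm U (\<lambda>x. b (t, x))) \<in> borel_measurable (lebesgue_on {0<..<1}) \<and>
     (\<integral>\<^sup>+t. BV_norm U (\<lambda>x. b (t, x)) \<partial>lebesgue_on {0<..<1}) < \<infinity>}"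


subsection \<open>Divergence, traces and distributional solutions\<close>

definition div_free :: "(real^3) set \<Rightarrow> (spacetime \<Rightarrow> real^3) \<Rightarrow> bool" where
  "div_free \<Omega> b \<longleftrightarrow>
     (\<forall>\<eta> \<in> Cinf_c ({0<..<1} \<times> \<Omega>). (LINT z|interior_measure \<Omega>. b z \<bullet> grad_x \<eta> z) = 0)"

definition is_normal_trace ::
  "(real^3) set \<Rightarrow> (spacetime \<Rightarrow> real^3) \<Rightarrow> (spacetime \<Rightarrow> real) \<Rightarrow> bool" where
  "is_normal_trace \<Omega> b g \<longleftrightarrow>
     g \<in> Linfty (boundary_measure \<Omega>) \<and>
     (\<forall>\<phi> \<in> trace_test.
        (LINT z|boundary_measure \<Omega>. g z * \<phi> z) - (LINT x|lborel_on \<Omega>. \<phi> (0, x))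
        = (LINT z|interior_measure \<Omega>. dt \<phi> z + b z \<bullet> grad_x \<phi> z))"

definition solves_interior ::
  "(real^3) set \<Rightarrow> (spacetime \<Rightarrow> real^3) \<Rightarrow> (spacetime \<Rightarrow> real) \<Rightarrow> bool" where
  "solves_interior \<Omega> b u \<longleftrightarrow>
     (\<forall>\<eta> \<in> Cinf_c ({0<..<1} \<times> \<Omega>).
        (LINT z|interior_measure \<Omega>. u z * (dt \<eta> z + b z \<bullet> grad_x \<eta> z)) = 0)"

text \<open>\<open>g\<close> and \<open>u0\<close> represent \<open>Tr(bu)\<close> and the initial trace of \<open>u\<close>.\<close>

definition are_traces ::
  "(real^3) set \<Rightarrow> (spacetime \<Rightarrow> real^3) \<Rightarrow> (spacetime \<Rightarrow> real) \<Rightarrow>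
   (spacetime \<Rightarrow> real) \<Rightarrow> (real^3 \<Rightarrow> real) \<Rightarrow> bool" where
  "are_traces \<Omega> b u g u0 \<longleftrightarrow>
     g \<in> Linfty (boundary_measure \<Omega>) \<and> u0 \<in> Linfty (lborel_on \<Omega>) \<and>
     (\<forall>\<phi> \<in> trace_test.
        (LINT z|boundary_measure \<Omega>. g z * \<phi> z) - (LINT x|lborel_on \<Omega>. \<phi> (0, x) * u0 x)
        = (LINT z|interior_measure \<Omega>. u z * (dt \<phi> z + b z \<bullet> grad_x \<phi> z)))"

text \<open>Bounded distributional solutions with zero initial datum and no boundary condition, as is
  appropriate when \<open>Tr b \<equiv> 1\<close>, so that \<open>\<Gamma>\<^sup>- = {Tr b < 0}\<close> is negligible.\<close>

definition zero_datum_solutions ::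
  "(real^3) set \<Rightarrow> (spacetime \<Rightarrow> real^3) \<Rightarrow> (spacetime \<Rightarrow> real) set" where
  "zero_datum_solutions \<Omega> b =
     {u \<in> Linfty (interior_measure \<Omega>). solves_interior \<Omega> b u \<and>
        (\<exists>g u0. are_traces \<Omega> b u g u0 \<and> (AE x in lborel_on \<Omega>. u0 x = 0))}"

end

theory Submission
  imports Defs
begin

text \<open>Write \<open>x = (s, y, z)\<close> with \<open>s\<close> the distance to the boundary. In the dyadic layer
  \<open>2\<^sup>m \<le> s < 2\<^sup>m\<^sup>+\<^sup>1\<close> a piecewise constant shear in the \<open>(y, z)\<close> plane, read along \<open>s\<close>, turns a
  chessboard of cells of size about \<open>2\<^sup>m\<close> into a finer one, as in Depauw's example. The resulting
  \<open>\<plusminus>1\<close>-valued pattern is transported by \<open>(1, vely, velz)\<close> and converges weakly to \<open>0\<close> as \<open>s\<close> tends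
  to \<open>0\<close>. The field \<open>b = ((1 + c) pattern - c) (1, vely, velz)\<close> is therefore divergence free, is
  piecewise constant with finitely many pieces on bounded sets away from the boundary, and has
  outward flux \<open>c\<close> per unit Lebesgue area of the boundary, that is normal trace \<open>1\<close> with respect to
  \<open>\<H>\<^sup>2\<close>, because only the weak limit of the pattern is seen there. Yet
  on \<open>{pattern = 1}\<close> it equals \<open>(1, vely, velz)\<close> and carries mass from the boundary into the
  domain: \<open>a\<close> times the indicator of \<open>{pattern = 1, s < t}\<close> is a solution with zero initial datum
  for every \<open>a\<close>.

  The number \<open>c\<close> is the ratio between \<open>\<H>\<^sup>2\<close> and Lebesgue measure on the boundary plane. Its
  existence follows from translation invariance, so the isodiametric inequality, which would give
  \<open>c = 1\<close>, is not needed: the field is simply built with flux \<open>c\<close>.\<close>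

subsection \<open>Metric outer measures\<close>

text \<open>The thickness \<open>2^m\<close> of a layer is also the half-period of the wave
  \<open>sqw m\<close> that is sheared in it. A shear of speed 0 or 1 can therefore flip the sign of
  this wave over one layer, and flipping it exactly where \<open>sqw (m + 1)\<close> and
  \<open>sqw (m - 1)\<close> differ trades the coarse factor \<open>sqw (m + 1)\<close> of the
  pattern for the fine factor \<open>sqw (m - 1)\<close>. The roles of y and z alternate with the
  parity of m. This self-similarity keeps the speeds bounded by 1 although infinitely many
  refinements accumulate at the boundary. The pattern is constant along the characteristics of
  \<open>(1, vely, velz)\<close>, so every function of it is a conserved density. Two such densities
  are used: the indicator of \<open>pattern = 1\<close> for the solutions, and an affine one for the
  field. The affine one is forced by two demands: the value 1 on \<open>pattern = 1\<close>, so that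
  a particle there is at height s exactly s units of time after its entry, and the weak limit
  \<open>- c\<close> at the boundary.\<close>

lemma metric_outer_measure_shells:
  fixes f :: "'a::metric_space set \<Rightarrow> ennreal" and D :: "nat \<Rightarrow> 'a set"
  assumes mono: "\<And>A B. A \<subseteq> B \<Longrightarrow> f A \<le> f B" and emp: "f {} = 0"
    and sep: "\<And>A B d. 0 < d \<Longrightarrow> (\<And>x y. x \<in> A \<Longrightarrow> y \<in> B \<Longrightarrow> d \<le> dist x y) \<Longrightarrow> f A + f B \<le> f (A \<union> B)"
    and D: "\<And>n x y. x \<in> D n \<Longrightarrow> y \<in> (\<Union>k\<in>{k. n + 2 \<le> k}. D k) \<Longrightarrow> d n \<le> dist x y" "\<And>n. 0 < d n"
    and X: "\<And>n. D n \<subseteq> X"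
  shows "(\<Sum>n<N. f (D n)) \<le> 2 * f X"
proof -
  \<comment> \<open>Shells whose indices have the same parity are mutually separated, so
    \<open>sep\<close> adds them up without loss. The even and the odd shells then cost one
    \<open>f X\<close> each.\<close>
  have *: "(\<Sum>i<m. f (D (2*i + r))) \<le> f (\<Union>i<m. D (2*i + r))" for m r :: nat
  proof (induction m)
    case 0 then show ?case by (simp add: emp)
  next
    case (Suc m)
    let ?U = "\<Union>i<m. D (2*i + r)"
    have "(\<Sum>i<Suc m. f (D (2*i + r))) \<le> f ?U + f (D (2*m+r))"
      using Suc by (simp add: add_mono)
    also have "\<dots> \<le> f (?U \<union> D (2*m+r))"
    proof (cases "m = 0")
      case True then show ?thesis by (simp add: emp)
    next
      case False
      let ?d = "Min ((\<lambda>i. d (2*i+r)) ` {..<m})"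
      show ?thesis
      proof (rule sep[of ?d])
        show "0 < ?d" using False D(2) by (subst Min_gr_iff) auto
      next
        fix x y assume "x \<in> ?U" "y \<in> D (2*m+r)"
        then obtain i where i: "i < m" "x \<in> D (2*i+r)" by auto
        have "?d \<le> d (2*i+r)" using i by (intro Min_le) auto
        also have "\<dots> \<le> dist x y"
          using i \<open>y \<in> D (2*m+r)\<close> by (intro D(1)[of x _ y]) (auto intro!: exI[of _ "2*m+r"])
        finally show "?d \<le> dist x y" .
      qed
    qed
    also have "?U \<union> D (2*m+r) = (\<Union>i<Suc m. D (2*i+r))" by (auto simp: less_Suc_eq)
    finally show ?case .
  qed
  have "(\<Sum>n<N. f (D n)) \<le> (\<Sum>n<2*N. f (D n))" by (intro sum_mono2) auto
  also have "\<dots> = (\<Sum>i<N. f (D (2*i+0))) + (\<Sum>i<N. f (D (2*i+1)))"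
    by (induction N) (auto simp: algebra_simps)
  also have "\<dots> \<le> f X + f X"
    by (intro add_mono order_trans[OF *] mono) (use X in auto)
  finally show ?thesis by (simp add: mult_2)
qed

text \<open>Caratheodory's criterion: it suffices that a closed \<open>F\<close> splits every set
  \<open>A\<close> additively. The part of \<open>A\<close> at distance at least
  \<open>1 / (n + 1)\<close> from \<open>F\<close> is separated from \<open>A \<inter> F\<close>,
  and the rest of \<open>A - F\<close> is covered by the shells \<open>D k\<close> with
  \<open>k \<ge> n\<close>, whose measures form the tail of a convergent series.\<close>

lemma metric_outer_measure_borel:
  fixes f :: "'a::metric_space set \<Rightarrow> ennreal"
  assumes om: "outer_measure_space UNIV f"
    and sep: "\<And>A B d. 0 < d \<Longrightarrow> (\<And>x y. x \<in> A \<Longrightarrow> y \<in> B \<Longrightarrow> d \<le> dist x y) \<Longrightarrow> f A + f B \<le> f (A \<union> B)"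
  shows "measure_space UNIV (sets borel) f"
proof -
  have emp: "f {} = 0" and mono: "\<And>A B. A \<subseteq> B \<Longrightarrow> f A \<le> f B"
    and csub: "countably_subadditive UNIV f"
    using om unfolding outer_measure_space_def positive_def increasing_def by auto
  have sub2: "f (A \<union> B) \<le> f A + f B" for A B
  proof -
    have "subadditive UNIV f"
      using ring_of_sets.countably_subadditive_subadditive[of UNIV UNIV f] csub emp
      by (metis Pow_UNIV algebra.axioms(1) positive_def ring_of_sets_Pow)
    then have *: "f (A \<union> (B - A)) \<le> f A + f (B - A)" unfolding subadditive_def by blast
    have "f (A \<union> B) = f (A \<union> (B - A))" by simp
    also note *
    also have "f (B - A) \<le> f B" by (rule mono) auto
    finally show ?thesis by (simp add: add_mono)
  qed
  interpret P: sigma_algebra UNIV "UNIV :: 'a set set" by (metis Pow_UNIV sigma_algebra_Pow)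
  let ?L = "lambda_system UNIV UNIV f"
  have ms: "measure_space UNIV ?L f" using P.caratheodory_lemma[OF om] .
  have closedL: "F \<in> ?L" if "closed F" for F
  proof -
    have "f (A \<inter> F) + f (A - F) \<le> f A" for A
    proof (cases "F = {} \<or> f A = \<infinity>")
      case True then show ?thesis by (auto simp: emp)
    next
      case False
      then have F: "F \<noteq> {}" and fin: "f A < \<infinity>" by (auto simp: less_top)
      define R where "R n = {x \<in> A - F. 1 / real (Suc n) \<le> infdist x F}" for n
      define D where "D n = R (Suc n) - R n" for n
      have R_Suc: "R n \<subseteq> R (Suc n)" for n
        unfolding R_def by (auto elim!: order_trans[rotated] intro!: divide_left_mono)
      have R_mono: "n \<le> m \<Longrightarrow> R n \<subseteq> R m" for n m
        by (rule lift_Suc_mono_le[of R]) (use R_Suc in auto)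
      \<comment> \<open>Points of \<open>D n\<close> have distance at least
        \<open>1 / (n + 2)\<close> to \<open>F\<close>, points of \<open>D k\<close> with
        \<open>k \<ge> n + 2\<close> less than \<open>1 / (n + 3)\<close>. Adjacent shells may
        touch, hence the offset 2.\<close>
      define d where "d n = 1 / real (n+2) - 1 / real (n+3)" for n
      have dpos: "0 < d n" for n unfolding d_def by (simp add: divide_strict_left_mono)
      have sh: "(\<Sum>n<N. f (D n)) \<le> 2 * f A" for N
      proof (rule metric_outer_measure_shells[OF mono emp sep _ dpos])
        fix n x y assume x: "x \<in> D n" and "y \<in> (\<Union>k\<in>{k. n + 2 \<le> k}. D k)"
        then obtain k where k: "n + 2 \<le> k" "y \<in> D k" by auto
        have "infdist x F \<ge> 1 / real (n+2)" using x by (auto simp: D_def R_def)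
        moreover have "infdist y F < 1 / real (n+3)"
        proof -
          have "infdist y F < 1 / real (Suc k)" using k by (auto simp: D_def R_def)
          also have "\<dots> \<le> 1 / real (n+3)" using k by (auto simp: field_simps)
          finally show ?thesis .
        qed
        moreover have "infdist x F \<le> infdist y F + dist x y" by (rule infdist_triangle)
        ultimately show "d n \<le> dist x y" unfolding d_def by linarith
      qed (auto simp: D_def R_def)
      have summ: "(\<Sum>n. f (D n)) < \<infinity>"
      proof -
        have "(\<Sum>n. f (D n)) \<le> 2 * f A" by (rule suminf_le_const) (use sh in auto)
        also have "\<dots> < \<infinity>" using fin by (simp add: ennreal_mult_less_top)
        finally show ?thesis .
      qed
      \<comment> \<open>Closedness of \<open>F\<close> gives each point of \<open>A - F\<close> a
        positive distance to \<open>F\<close>, so it lies in some \<open>R m\<close>; if it is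
        missing from \<open>R n\<close>, it enters through a later shell.\<close>
      have cover: "A - F \<subseteq> R n \<union> (\<Union>k. D (k + n))" for n
      proof
        fix x assume x: "x \<in> A - F"
        then have "0 < infdist x F"
          using \<open>closed F\<close> F by (metis DiffD2 in_closed_iff_infdist_zero infdist_nonneg order_le_less)
        then obtain m where "1 / real (Suc m) < infdist x F"
          by (metis nat_approx_posE inverse_eq_divide)
        then have m: "x \<in> R m" using x by (auto simp: R_def)
        show "x \<in> R n \<union> (\<Union>k. D (k + n))"
        proof (rule ccontr)
          assume c: "\<not> ?thesis"
          have "x \<notin> R (k + n)" for k
            by (induction k) (use c in \<open>auto simp: D_def\<close>)
          moreover have "x \<in> R (m + n)" using m R_mono[of m "m + n"] by auto
          ultimately show False by blast
        qed
      qed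
      have est: "f (A \<inter> F) + f (A - F) \<le> f A + (\<Sum>k. f (D (k + n)))" for n
      proof -
        have "f (A - F) \<le> f (R n) + f (\<Union>k. D (k + n))"
          using order_trans[OF mono[OF cover] sub2] .
        also have "f (\<Union>k. D (k + n)) \<le> (\<Sum>k. f (D (k + n)))"
        proof -
          have "f (\<Union>k. disjointed (\<lambda>k. D (k+n)) k) \<le> (\<Sum>k. f (disjointed (\<lambda>k. D (k+n)) k))"
            using csub disjoint_family_disjointed[of "\<lambda>k. D (k+n)"]
            unfolding countably_subadditive_def by blast
          also have "\<dots> \<le> (\<Sum>k. f (D (k + n)))"
            by (intro suminf_le mono) (auto simp: disjointed_def)
          finally show ?thesis by (simp add: UN_disjointed_eq)
        qed
        finally have "f (A \<inter> F) + f (A - F) \<le> (f (A \<inter> F) + f (R n)) + (\<Sum>k. f (D (k + n)))"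
          by (simp add: add.assoc add_mono)
        also have "f (A \<inter> F) + f (R n) \<le> f (A \<inter> F \<union> R n)"
        proof (rule sep[of "1 / real (Suc n)"])
          fix x y assume x: "x \<in> A \<inter> F" and y: "y \<in> R n"
          have "infdist y F \<le> infdist x F + dist y x" by (rule infdist_triangle)
          moreover have "infdist x F = 0" using x by simp
          ultimately show "1 / real (Suc n) \<le> dist x y" using y by (simp add: R_def dist_commute)
        qed simp
        also have "\<dots> \<le> f A" by (rule mono) (auto simp: R_def)
        finally show ?thesis by (simp add: add_mono)
      qed
      have "(\<lambda>n. \<Sum>k. f (D (k + n))) \<longlonglongrightarrow> 0"
      proof -
        define g where "g n = enn2real (f (D n))" for n
        have fD: "f (D n) = ennreal (g n)" for n
        proof -
          have "f (D n) \<le> f A" by (rule mono) (auto simp: D_def R_def)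
          then show ?thesis using fin by (simp add: g_def ennreal_enn2real_if)
        qed
        have g0: "0 \<le> g n" for n by (simp add: g_def)
        have sg: "summable g"
          using summ g0 by (intro summable_suminf_not_top) (auto simp: fD)
        have "(\<Sum>k. f (D (k + n))) = ennreal (\<Sum>k. g (k + n))" for n
          unfolding fD using sg g0 by (intro suminf_ennreal2) (auto simp: summable_iff_shift)
        moreover have "(\<lambda>n. \<Sum>k. g (k + n)) \<longlonglongrightarrow> 0"
          using suminf_exist_split2[OF sg] .
        ultimately show ?thesis by (simp flip: ennreal_0)
      qed
      then have "(\<lambda>n. f A + (\<Sum>k. f (D (k + n)))) \<longlonglongrightarrow> f A + 0"
        by (intro tendsto_add tendsto_const)
      then show ?thesis using est by (intro LIMSEQ_le_const) auto
    qed
    moreover have "f A \<le> f (A \<inter> F) + f (A - F)" for A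
      using sub2[of "A \<inter> F" "A - F"] by (simp add: Int_Diff_Un)
    ultimately show ?thesis
      unfolding P.lambda_system_eq by (auto intro!: antisym)
  qed
  interpret L: sigma_algebra UNIV ?L using ms by (simp add: measure_space_def)
  have "sets borel \<subseteq> ?L"
    unfolding borel_eq_closed
    by (subst sets_measure_of) (auto intro!: L.sigma_sets_subset closedL)
  then show ?thesis
    using ms sets.sigma_algebra_axioms[of borel]
    by (auto simp: measure_space_def positive_def countably_additive_def)
qed

subsection \<open>Hausdorff measure on a plane\<close>

definition hausdorff_weight :: "nat \<Rightarrow> 'a::metric_space set \<Rightarrow> ennreal" where
  "hausdorff_weight k C = (if C = {} then 0 else ennreal (unit_ball_vol (real k) * (diameter C / 2) ^ k))"

lemma hausdorff_pre_le:
  assumes "A \<subseteq> (\<Union>i. C i)" "\<And>i. bounded (C i)" "\<And>i. diameter (C i) \<le> \<delta>"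
  shows "hausdorff_pre k \<delta> A \<le> (\<Sum>i. hausdorff_weight k (C i))"
  unfolding hausdorff_pre_def hausdorff_weight_def by (rule INF_lower2[of C]) (use assms in auto)

lemma hausdorff_pre_ge:
  assumes "\<And>C. A \<subseteq> (\<Union>i. C i) \<Longrightarrow> (\<And>i. bounded (C i)) \<Longrightarrow> (\<And>i. diameter (C i) \<le> \<delta>) \<Longrightarrow>
     B \<le> (\<Sum>i. hausdorff_weight k (C i))"
  shows "B \<le> hausdorff_pre k \<delta> A"
  unfolding hausdorff_pre_def
  by (rule INF_greatest) (use assms in \<open>auto simp: hausdorff_weight_def\<close>)

lemma hausdorff_pre_less:
  assumes "hausdorff_pre k \<delta> A < B"
  obtains C where "A \<subseteq> (\<Union>i. C i)" "\<And>i. bounded (C i)" "\<And>i. diameter (C i) \<le> \<delta>"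
    "(\<Sum>i. hausdorff_weight k (C i)) < B"
  using assms unfolding hausdorff_pre_def INF_less_iff
  by (auto simp: hausdorff_weight_def)

lemma hausdorff_pre_mono: "A \<subseteq> B \<Longrightarrow> hausdorff_pre k \<delta> A \<le> hausdorff_pre k \<delta> B"
  by (intro hausdorff_pre_ge hausdorff_pre_le) auto

lemma hausdorff_pre_antimono: "\<delta> \<le> \<delta>' \<Longrightarrow> hausdorff_pre k \<delta>' A \<le> hausdorff_pre k \<delta> A"
  by (intro hausdorff_pre_ge hausdorff_pre_le) (auto intro: order_trans)

lemma hausdorff_pre_empty: "0 \<le> \<delta> \<Longrightarrow> hausdorff_pre k \<delta> {} = 0"
  using hausdorff_pre_le[of "{}" "\<lambda>_. {}" \<delta> k] by (simp add: hausdorff_weight_def)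

text \<open>Coverings of the \<open>A i\<close> that are optimal up to \<open>e / 2^(i+1)\<close>
  are merged into a single sequence through \<open>prod_decode\<close>; the errors sum to
  \<open>e\<close>. The infinite case is split off because near-optimality is a strict
  inequality.\<close>

lemma hausdorff_pre_UN_le:
  assumes "0 \<le> \<delta>"
  shows "hausdorff_pre k \<delta> (\<Union>i. A i) \<le> (\<Sum>i. hausdorff_pre k \<delta> (A i))"
proof (cases "(\<Sum>i. hausdorff_pre k \<delta> (A i)) = \<infinity>")
  case False
  then have fin: "hausdorff_pre k \<delta> (A i) < \<infinity>" for i
    using ennreal_suminf_lessD[of "\<lambda>i. hausdorff_pre k \<delta> (A i)" \<infinity>] by (simp add: less_top)
  show ?thesis
  proof (rule ennreal_le_epsilon)
    fix e :: real assume e: "0 < e"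
    define w where "w i = e * (1/2) ^ Suc i" for i :: nat
    have "\<exists>C. A i \<subseteq> (\<Union>j. C j) \<and> (\<forall>j. bounded (C j) \<and> diameter (C j) \<le> \<delta>) \<and>
        (\<Sum>j. hausdorff_weight k (C j)) < hausdorff_pre k \<delta> (A i) + ennreal (w i)" for i
    proof -
      have "hausdorff_pre k \<delta> (A i) < hausdorff_pre k \<delta> (A i) + ennreal (w i)"
        using fin[of i] e by (simp add: w_def ennreal_add_left_cancel_less)
      then show ?thesis by (rule hausdorff_pre_less) blast
    qed
    then obtain C where C: "\<And>i. A i \<subseteq> (\<Union>j. C i j)" "\<And>i j. bounded (C i j)" "\<And>i j. diameter (C i j) \<le> \<delta>"
        "\<And>i. (\<Sum>j. hausdorff_weight k (C i j)) < hausdorff_pre k \<delta> (A i) + ennreal (w i)"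
      by metis
    let ?C = "\<lambda>n. case_prod C (prod_decode n)"
    have "hausdorff_pre k \<delta> (\<Union>i. A i) \<le> (\<Sum>n. hausdorff_weight k (?C n))"
    proof (rule hausdorff_pre_le)
      show "(\<Union>i. A i) \<subseteq> (\<Union>n. ?C n)"
      proof
        fix x assume "x \<in> (\<Union>i. A i)"
        then obtain i j where "x \<in> C i j" using C(1) by blast
        then show "x \<in> (\<Union>n. ?C n)" by (auto intro!: exI[of _ "prod_encode (i, j)"])
      qed
    qed (auto simp: C split: prod.split)
    also have "\<dots> = (\<Sum>i. \<Sum>j. hausdorff_weight k (C i j))"
      using suminf_ennreal_2dimen[of "\<lambda>i. \<Sum>j. hausdorff_weight k (C i j)" "\<lambda>(i,j). hausdorff_weight k (C i j)"]
      by (simp add: comp_def case_prod_beta)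
    also have "\<dots> \<le> (\<Sum>i. hausdorff_pre k \<delta> (A i) + ennreal (w i))"
      by (intro suminf_le less_imp_le C) auto
    also have "\<dots> = (\<Sum>i. hausdorff_pre k \<delta> (A i)) + (\<Sum>i. ennreal (w i))"
      by (rule suminf_add[symmetric]) auto
    also have "(\<Sum>i. ennreal (w i)) = ennreal e"
    proof -
      have "(\<lambda>i. e * (1/2) ^ Suc i) sums (e * 1)" by (intro sums_mult power_half_series)
      then show ?thesis using e by (intro suminf_ennreal_eq) (auto simp: w_def)
    qed
    finally show "hausdorff_pre k \<delta> (\<Union>i. A i) \<le> (\<Sum>i. hausdorff_pre k \<delta> (A i)) + ennreal e" .
  qed
qed simp

text \<open>Along the scales \<open>1 / (n + 1)\<close> the supremum runs over an increasing
  sequence, and such suprema commute with addition, as \<open>hausdorff_outer_separated\<close>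
  uses.\<close>

lemma hausdorff_outer_eq_SUP:
  "hausdorff_outer k A = (SUP n. hausdorff_pre k (1 / real (Suc n)) A)"
  unfolding hausdorff_outer_def
proof (rule antisym)
  show "(SUP \<delta>\<in>{0<..}. hausdorff_pre k \<delta> A) \<le> (SUP n. hausdorff_pre k (1 / real (Suc n)) A)"
  proof (rule SUP_least)
    fix \<delta> :: real assume "\<delta> \<in> {0<..}"
    then obtain n where "1 / real (Suc n) < \<delta>"
      by (metis greaterThan_iff nat_approx_posE inverse_eq_divide)
    then show "hausdorff_pre k \<delta> A \<le> (SUP n. hausdorff_pre k (1 / real (Suc n)) A)"
      by (intro SUP_upper2[of n] hausdorff_pre_antimono) auto
  qed
  show "(SUP n. hausdorff_pre k (1 / real (Suc n)) A) \<le> (SUP \<delta>\<in>{0<..}. hausdorff_pre k \<delta> A)"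
    by (intro SUP_least SUP_upper) auto
qed

lemma hausdorff_outer_mono: "A \<subseteq> B \<Longrightarrow> hausdorff_outer k A \<le> hausdorff_outer k B"
  unfolding hausdorff_outer_def by (intro SUP_mono') (simp add: hausdorff_pre_mono)

lemma hausdorff_outer_measure_space: "outer_measure_space UNIV (hausdorff_outer k)"
proof -
  have "hausdorff_outer k {} = 0"
    by (simp add: hausdorff_outer_eq_SUP hausdorff_pre_empty)
  moreover have "hausdorff_outer k (\<Union>i. A i) \<le> (\<Sum>i. hausdorff_outer k (A i))" for A :: "nat \<Rightarrow> 'a set"
    unfolding hausdorff_outer_def
  proof (rule SUP_least)
    fix \<delta> :: real assume \<delta>: "\<delta> \<in> {0<..}"
    then have "hausdorff_pre k \<delta> (\<Union>i. A i) \<le> (\<Sum>i. hausdorff_pre k \<delta> (A i))"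
      by (intro hausdorff_pre_UN_le) auto
    also have "\<dots> \<le> (\<Sum>i. SUP \<delta>\<in>{0<..}. hausdorff_pre k \<delta> (A i))"
      by (intro suminf_le SUP_upper \<delta>) auto
    finally show "hausdorff_pre k \<delta> (\<Union>i. A i) \<le> (\<Sum>i. SUP \<delta>\<in>{0<..}. hausdorff_pre k \<delta> (A i))" .
  qed
  ultimately show ?thesis
    by (auto simp: outer_measure_space_def positive_def increasing_def countably_subadditive_def
        intro: hausdorff_outer_mono)
qed

text \<open>Once \<open>\<delta> < d\<close>, no set of diameter at most \<open>\<delta>\<close>
  meets both \<open>A\<close> and \<open>B\<close>. A covering of the union thus splits into
  coverings of the two sets in which no set is counted twice.\<close>

lemma hausdorff_outer_separated:
  assumes d: "0 < d" "\<And>x y. x \<in> A \<Longrightarrow> y \<in> B \<Longrightarrow> d \<le> dist x y"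
  shows "hausdorff_outer k A + hausdorff_outer k B \<le> hausdorff_outer k (A \<union> B)"
proof -
  have *: "hausdorff_pre k \<delta> A + hausdorff_pre k \<delta> B \<le> hausdorff_pre k \<delta> (A \<union> B)" if \<delta>: "0 < \<delta>" "\<delta> < d" for \<delta>
  proof (rule hausdorff_pre_ge)
    fix C assume C: "A \<union> B \<subseteq> (\<Union>i. C i)" "\<And>i::nat. bounded (C i)" "\<And>i. diameter (C i) \<le> \<delta>"
    define E where "E X i = (if C i \<inter> X = {} then {} else C i)" for X i
    have E: "hausdorff_pre k \<delta> X \<le> (\<Sum>i. hausdorff_weight k (E X i))" if "X \<subseteq> A \<union> B" for X
      by (rule hausdorff_pre_le) (use C that \<delta> in \<open>auto simp: E_def, blast\<close>)
    have disj: "C i \<inter> A = {} \<or> C i \<inter> B = {}" for i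
    proof (rule ccontr)
      assume "\<not> ?thesis"
      then obtain x y where xy: "x \<in> C i" "x \<in> A" "y \<in> C i" "y \<in> B" by auto
      then show False
        using d(2)[of x y] diameter_bounded_bound[OF C(2)[of i], of x y] C(3)[of i] \<delta> by auto
    qed
    have "hausdorff_pre k \<delta> A + hausdorff_pre k \<delta> B
        \<le> (\<Sum>i. hausdorff_weight k (E A i)) + (\<Sum>i. hausdorff_weight k (E B i))"
      by (intro add_mono E) auto
    also have "\<dots> = (\<Sum>i. hausdorff_weight k (E A i) + hausdorff_weight k (E B i))"
      by (rule suminf_add) auto
    also have "\<dots> \<le> (\<Sum>i. hausdorff_weight k (C i))"
    proof (rule suminf_le)
      show "hausdorff_weight k (E A i) + hausdorff_weight k (E B i) \<le> hausdorff_weight k (C i)" for i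
        using disj[of i] by (auto simp: E_def hausdorff_weight_def)
    qed auto
    finally show "hausdorff_pre k \<delta> A + hausdorff_pre k \<delta> B \<le> (\<Sum>i. hausdorff_weight k (C i))" .
  qed
  have inc: "incseq (\<lambda>n. hausdorff_pre k (1 / real (Suc n)) X)" for X :: "'a set"
    by (intro incseq_SucI hausdorff_pre_antimono) (auto intro!: divide_left_mono)
  have "hausdorff_outer k A + hausdorff_outer k B =
      (SUP n. hausdorff_pre k (1 / real (Suc n)) A + hausdorff_pre k (1 / real (Suc n)) B)"
    unfolding hausdorff_outer_eq_SUP by (intro ennreal_SUP_add[symmetric] inc)
  also have "\<dots> \<le> hausdorff_outer k (A \<union> B)"
  proof (rule SUP_least)
    fix n
    let ?\<delta> = "min (1 / real (Suc n)) (d/2)"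
    have "hausdorff_pre k (1 / real (Suc n)) A + hausdorff_pre k (1 / real (Suc n)) B
        \<le> hausdorff_pre k ?\<delta> A + hausdorff_pre k ?\<delta> B"
      by (intro add_mono hausdorff_pre_antimono) auto
    also have "\<dots> \<le> hausdorff_pre k ?\<delta> (A \<union> B)" using d(1) by (intro *) auto
    also have "\<dots> \<le> hausdorff_outer k (A \<union> B)"
      unfolding hausdorff_outer_def using d(1) by (intro SUP_upper) auto
    finally show "hausdorff_pre k (1 / real (Suc n)) A + hausdorff_pre k (1 / real (Suc n)) B \<le> \<dots>" .
  qed
  finally show ?thesis .
qed

lemma
  shows space_hausdorff_measure [simp]: "space (hausdorff_measure k :: 'a::metric_space measure) = UNIV"
    and sets_hausdorff_measure [simp, measurable_cong]:
      "sets (hausdorff_measure k :: 'a::metric_space measure) = sets borel"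
    and emeasure_hausdorff_measure:
      "A \<in> sets borel \<Longrightarrow> emeasure (hausdorff_measure k) (A :: 'a set) = hausdorff_outer k A"
proof -
  have ms: "measure_space UNIV (sets borel) (hausdorff_outer k :: 'a set \<Rightarrow> ennreal)"
    by (intro metric_outer_measure_borel hausdorff_outer_measure_space hausdorff_outer_separated)
  show s: "sets (hausdorff_measure k :: 'a measure) = sets borel"
    unfolding hausdorff_measure_def using sets.sigma_sets_eq[of "borel :: 'a measure"]
    by (simp add: sets_measure_of)
  show "space (hausdorff_measure k :: 'a measure) = UNIV"
    unfolding hausdorff_measure_def by (simp add: space_measure_of)
  show "emeasure (hausdorff_measure k) A = hausdorff_outer k A" if "A \<in> sets borel" for A :: "'a set"
    by (rule emeasure_measure_of[OF hausdorff_measure_def])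
      (use ms that s in \<open>auto simp: measure_space_def\<close>)
qed

text \<open>Coverings are pushed forward by \<open>f\<close>, which does not enlarge diameters. Used
  in both directions this yields invariance under isometries, including isometries between different
  ambient spaces.\<close>

lemma hausdorff_outer_image_le:
  fixes f :: "'a::metric_space \<Rightarrow> 'b::metric_space"
  assumes lip: "\<And>x y. dist (f x) (f y) \<le> dist x y"
  shows "hausdorff_outer k (f ` A) \<le> hausdorff_outer k A"
proof -
  have "hausdorff_pre k \<delta> (f ` A) \<le> hausdorff_pre k \<delta> A" if "0 < \<delta>" for \<delta>
  proof (rule hausdorff_pre_ge)
    fix C assume C: "A \<subseteq> (\<Union>i. C i)" "\<And>i::nat. bounded (C i)" "\<And>i. diameter (C i) \<le> \<delta>"
    have diam: "diameter (f ` C i) \<le> diameter (C i)" if "C i \<noteq> {}" for i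
    proof -
      have "dist x y \<le> diameter (C i)" if "x \<in> f ` C i" "y \<in> f ` C i" for x y
        using that diameter_bounded_bound[OF C(2)] lip by (metis imageE order_trans)
      then show ?thesis
        using \<open>C i \<noteq> {}\<close> unfolding diameter_def[of "f ` C i"]
        by (auto intro!: cSUP_least)
    qed
    have "hausdorff_pre k \<delta> (f ` A) \<le> (\<Sum>i. hausdorff_weight k (f ` C i))"
    proof (rule hausdorff_pre_le)
      show "bounded (f ` C i)" for i
      proof -
        obtain a e where "\<And>y. y \<in> C i \<Longrightarrow> dist a y \<le> e" using C(2)[of i] by (auto simp: bounded_def)
        then show ?thesis
          using lip by (auto simp: bounded_def intro!: exI[of _ "f a"] exI[of _ e] intro: order_trans)
      qed
      show "diameter (f ` C i) \<le> \<delta>" for i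
        using diam[of i] C(3)[of i] \<open>0 < \<delta>\<close> by (cases "C i = {}") auto
    qed (use C(1) in blast)
    also have "\<dots> \<le> (\<Sum>i. hausdorff_weight k (C i))"
    proof (rule suminf_le)
      fix i show "hausdorff_weight k (f ` C i) \<le> hausdorff_weight k (C i)"
      proof (cases "C i = {}")
        case False
        have "bounded (f ` C i)"
          using C(2)[of i] lip by (auto simp: bounded_def) (meson order_trans)
        then have "0 \<le> diameter (f ` C i)" by (rule diameter_ge_0)
        with False show ?thesis
          by (auto simp: hausdorff_weight_def intro!: ennreal_leI mult_left_mono power_mono diam)
      qed (simp add: hausdorff_weight_def)
    qed auto
    finally show "hausdorff_pre k \<delta> (f ` A) \<le> (\<Sum>i. hausdorff_weight k (C i))" .
  qed
  then show ?thesis unfolding hausdorff_outer_def by (intro SUP_mono) auto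
qed

text \<open>Both sides are the double integral of
  \<open>indicator A x * indicator B (x + y)\<close>. Integrating over \<open>y\<close> first gives
  the left side. Exchanging the order, moving the translation onto \<open>A\<close> by the
  invariance of \<open>\<nu>\<close>, and exchanging back gives the right side, by the reflection
  invariance of Lebesgue measure.\<close>

lemma translation_invariant_measure_unique:
  fixes \<nu> :: "'a::euclidean_space measure"
  assumes [measurable_cong, simp]: "sets \<nu> = sets borel" and "sigma_finite_measure \<nu>"
    and inv: "\<And>a. distr \<nu> borel ((+) a) = \<nu>"
    and A[measurable]: "A \<in> sets borel" and B[measurable]: "B \<in> sets borel"
  shows "emeasure \<nu> A * emeasure lborel B = emeasure \<nu> B * emeasure lborel A"
proof -
  interpret \<nu>: sigma_finite_measure \<nu> by fact
  interpret P: pair_sigma_finite lborel \<nu> ..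
  have trans: "(\<integral>\<^sup>+y. g y \<partial>lborel) = (\<integral>\<^sup>+y. g (x + y) \<partial>lborel)"
    if [measurable]: "g \<in> borel_measurable borel" for g :: "'a \<Rightarrow> ennreal" and x
  proof -
    have "(\<integral>\<^sup>+y. g y \<partial>lborel) = (\<integral>\<^sup>+y. g y \<partial>distr lborel borel ((+) x))"
      by (simp add: lborel_distr_plus)
    also have "\<dots> = (\<integral>\<^sup>+y. g (x + y) \<partial>lborel)" by (simp add: nn_integral_distr)
    finally show ?thesis .
  qed
  have refl: "(\<integral>\<^sup>+y. g y \<partial>lborel) = (\<integral>\<^sup>+y. g (x - y) \<partial>lborel)"
    if [measurable]: "g \<in> borel_measurable borel" for g :: "'a \<Rightarrow> ennreal" and x
    by (subst lborel_affine[of "-1" x]) (simp_all add: density_1 nn_integral_distr)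
  have invn: "(\<integral>\<^sup>+x. g x \<partial>\<nu>) = (\<integral>\<^sup>+x. g (y + x) \<partial>\<nu>)"
    if [measurable]: "g \<in> borel_measurable borel" for g :: "'a \<Rightarrow> ennreal" and y
  proof -
    have "(\<integral>\<^sup>+x. g x \<partial>\<nu>) = (\<integral>\<^sup>+x. g x \<partial>distr \<nu> borel ((+) y))" by (simp add: inv)
    also have "\<dots> = (\<integral>\<^sup>+x. g (y + x) \<partial>\<nu>)" by (simp add: nn_integral_distr)
    finally show ?thesis .
  qed
  have "emeasure \<nu> A * emeasure lborel B = (\<integral>\<^sup>+x. indicator A x * (\<integral>\<^sup>+y. indicator B y \<partial>lborel) \<partial>\<nu>)"
    by (subst nn_integral_multc) auto
  also have "\<dots> = (\<integral>\<^sup>+x. indicator A x * (\<integral>\<^sup>+y. indicator B (x + y) \<partial>lborel) \<partial>\<nu>)"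
    by (intro nn_integral_cong) (simp add: trans[symmetric])
  also have "\<dots> = (\<integral>\<^sup>+x. (\<integral>\<^sup>+y. indicator A x * indicator B (x + y) \<partial>lborel) \<partial>\<nu>)"
    by (simp add: nn_integral_cmult)
  also have "\<dots> = (\<integral>\<^sup>+y. (\<integral>\<^sup>+x. indicator A x * indicator B (x + y) \<partial>\<nu>) \<partial>lborel)"
    by (rule P.Fubini') measurable
  also have "\<dots> = (\<integral>\<^sup>+y. (\<integral>\<^sup>+x. indicator A (x - y) * indicator B x \<partial>\<nu>) \<partial>lborel)"
  proof (rule nn_integral_cong)
    fix y show "(\<integral>\<^sup>+x. indicator A x * indicator B (x + y) \<partial>\<nu>) = (\<integral>\<^sup>+x. indicator A (x - y) * indicator B x \<partial>\<nu>)"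
      using invn[of "\<lambda>x. indicator A (x - y) * indicator B x" y] by (simp add: add.commute)
  qed
  also have "\<dots> = (\<integral>\<^sup>+x. (\<integral>\<^sup>+y. indicator A (x - y) * indicator B x \<partial>lborel) \<partial>\<nu>)"
    by (rule P.Fubini'[symmetric]) measurable
  also have "\<dots> = (\<integral>\<^sup>+x. indicator B x * (\<integral>\<^sup>+y. indicator A (x - y) \<partial>lborel) \<partial>\<nu>)"
    by (simp add: nn_integral_cmult mult.commute)
  also have "\<dots> = (\<integral>\<^sup>+x. indicator B x * (\<integral>\<^sup>+y. indicator A y \<partial>lborel) \<partial>\<nu>)"
    by (intro nn_integral_cong) (simp add: refl[symmetric])
  also have "\<dots> = emeasure \<nu> B * emeasure lborel A"
    by (subst nn_integral_multc) auto
  finally show ?thesis .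
qed

section \<open>Comparison of planar Hausdorff measure with Lebesgue measure\<close>

abbreviation unit_square :: "(real \<times> real) set" where
  "unit_square \<equiv> {0..1} \<times> {0..1}"

text \<open>The square is cut into \<open>N * N\<close> squares of side \<open>1 / N\<close>. Their
  diameter is at most \<open>2 / N\<close> by the l1 norm, so each weighs at most
  \<open>pi / N^2\<close>. The purpose is to make the ratio \<open>c\<close> finite.\<close>

lemma hausdorff_outer_unit_square_le: "hausdorff_outer 2 unit_square \<le> ennreal pi"
  unfolding hausdorff_outer_def
proof (rule SUP_least)
  fix \<delta> :: real assume "\<delta> \<in> {0<..}"
  then obtain n where n: "1 / real (Suc n) < \<delta> / 2"
    by (metis greaterThan_iff half_gt_zero nat_approx_posE inverse_eq_divide)
  define N where "N = Suc n"
  have N: "0 < N" "2 / real N \<le> \<delta>" using n by (auto simp: N_def field_simps)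
  define I where "I i = {real i / real N..(real i + 1) / real N}" for i
  \<comment> \<open>The index \<open>m\<close> encodes the grid position
    \<open>(m div N, m mod N)\<close>; beyond \<open>N * N\<close> the sets are empty and weigh
    0.\<close>
  define C where "C m = (if m < N * N then I (m div N) \<times> I (m mod N) else {})" for m
  have bdI: "bounded (I i)" for i by (simp add: I_def)
  have diam: "diameter (C m) \<le> 2 / real N" for m
  proof (rule diameter_le)
    fix x y assume "x \<in> C m" "y \<in> C m"
    then have "x \<in> I (m div N) \<times> I (m mod N)" "y \<in> I (m div N) \<times> I (m mod N)"
      by (auto simp: C_def split: if_splits)
    then have "\<bar>fst x - fst y\<bar> \<le> 1 / real N" "\<bar>snd x - snd y\<bar> \<le> 1 / real N"
      by (auto simp: I_def add_divide_distrib abs_le_iff)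
    moreover have "norm (x - y) \<le> \<bar>fst x - fst y\<bar> + \<bar>snd x - snd y\<bar>"
      using norm_Pair_le[of "fst x - fst y" "snd x - snd y"] by (metis fst_diff prod.collapse real_norm_def snd_diff)
    ultimately show "norm (x - y) \<le> 2 / real N" by (simp add: field_simps)
  qed simp
  have cover1: "\<exists>i<N. t \<in> I i" if "t \<in> {0..1}" for t :: real
  proof (cases "t = 1")
    case True then show ?thesis using N by (intro exI[of _ "N - 1"]) (auto simp: I_def field_simps of_nat_diff)
  next
    case False
    let ?i = "nat \<lfloor>t * N\<rfloor>"
    have "real ?i \<le> t * N" "t * N < real ?i + 1" using that by (auto simp: of_nat_nat)
    moreover have "?i < N"
    proof -
      have "t * N < N" using that False N by simp
      with \<open>real ?i \<le> t * N\<close> show ?thesis by linarith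
    qed
    ultimately show ?thesis using N by (intro exI[of _ ?i]) (auto simp: I_def field_simps)
  qed
  have "hausdorff_pre 2 \<delta> unit_square \<le> (\<Sum>m. hausdorff_weight 2 (C m))"
  proof (rule hausdorff_pre_le)
    show "unit_square \<subseteq> (\<Union>m. C m)"
    proof
      fix w assume "w \<in> unit_square"
      then obtain i j where ij: "i < N" "fst w \<in> I i" "j < N" "snd w \<in> I j"
        using cover1 by (metis mem_Times_iff)
      have "i * N + j < N * N"
      proof -
        have "i * N + j < Suc i * N" using ij by simp
        also have "\<dots> \<le> N * N" using ij by (intro mult_le_mono1) simp
        finally show ?thesis .
      qed
      then have "w \<in> C (i * N + j)" using ij by (simp add: C_def mem_Times_iff)
      then show "w \<in> (\<Union>m. C m)" by blast
    qed
    show "bounded (C m)" for m by (auto simp: C_def bdI intro: bounded_Times)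
    show "diameter (C m) \<le> \<delta>" for m using diam[of m] N by simp
  qed
  also have "\<dots> = (\<Sum>m<N*N. hausdorff_weight 2 (C m))"
    by (rule suminf_finite) (auto simp: C_def hausdorff_weight_def)
  also have "\<dots> \<le> (\<Sum>m<N*N. ennreal (pi * (1 / real N)\<^sup>2))"
  proof (rule sum_mono)
    fix m
    have "bounded (C m)" by (auto simp: C_def bdI intro: bounded_Times)
    then have "0 \<le> diameter (C m)" by (rule diameter_ge_0)
    then have "(diameter (C m) / 2)\<^sup>2 \<le> (1 / real N)\<^sup>2" using diam[of m] by (intro power_mono) auto
    then show "hausdorff_weight 2 (C m) \<le> ennreal (pi * (1 / real N)\<^sup>2)"
      by (auto simp: hausdorff_weight_def unit_ball_vol_2 intro!: ennreal_leI mult_left_mono)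
  qed
  also have "\<dots> = ennreal pi"
    using N by (simp add: ennreal_of_nat_eq_real_of_nat ennreal_mult[symmetric] power2_eq_square)
  finally show "hausdorff_pre 2 \<delta> unit_square \<le> ennreal pi" .
qed

text \<open>A set of diameter \<open>d\<close> lies in a square of side \<open>2 d\<close> centred
  at one of its points. The area \<open>4 d^2\<close> is at most 8 times the weight
  \<open>pi (d / 2)^2\<close> because \<open>pi \<ge> 2\<close>. The purpose is to make the ratio
  \<open>c\<close> positive.\<close>

lemma lborel_le_hausdorff_outer:
  fixes A :: "(real \<times> real) set"
  assumes [measurable]: "A \<in> sets borel"
  shows "emeasure lborel A \<le> 8 * hausdorff_outer 2 A"
proof -
  have "emeasure lborel A / 8 \<le> hausdorff_pre 2 1 A"
  proof (rule hausdorff_pre_ge)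
    fix C assume C: "A \<subseteq> (\<Union>i. C i)" "\<And>i::nat. bounded (C i)" "\<And>i. diameter (C i) \<le> 1"
    define p where "p i = (SOME w. w \<in> C i)" for i
    define d where "d i = diameter (C i)" for i
    have d0: "0 \<le> d i" for i by (simp add: d_def C(2) diameter_ge_0)
    define B where "B i = (if C i = {} then {} else
      {fst (p i) - d i..fst (p i) + d i} \<times> {snd (p i) - d i..snd (p i) + d i})" for i
    have [measurable]: "B i \<in> sets borel" for i
      unfolding B_def borel_prod[symmetric] by simp
    have CB: "C i \<subseteq> B i" for i
    proof
      fix x assume x: "x \<in> C i"
      then have "p i \<in> C i" unfolding p_def by (rule someI)
      with x have "dist (p i) x \<le> d i" unfolding d_def by (intro diameter_bounded_bound C)
      then have "dist (fst (p i)) (fst x) \<le> d i" "dist (snd (p i)) (snd x) \<le> d i"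
        by (meson dist_fst_le dist_snd_le order_trans)+
      then show "x \<in> B i" using x by (auto simp: B_def mem_Times_iff dist_real_def)
    qed
    have emB: "emeasure lborel (B i) \<le> 8 * hausdorff_weight 2 (C i)" for i
    proof (cases "C i = {}")
      case False
      have "emeasure lborel (B i) = ennreal (2 * d i) * ennreal (2 * d i)"
        unfolding lborel_prod[symmetric] using False d0[of i]
        by (subst B_def, simp, subst lborel.emeasure_pair_measure_Times) auto
      also have "\<dots> = ennreal (4 * (d i)\<^sup>2)" using d0[of i]
        by (simp add: ennreal_mult[symmetric] power2_eq_square)
      also have "\<dots> \<le> ennreal (8 * (pi * (d i / 2)\<^sup>2))"
      proof (rule ennreal_leI)
        have "2 * (d i)\<^sup>2 \<le> pi * (d i)\<^sup>2" using pi_ge_two by (intro mult_right_mono) auto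
        then show "4 * (d i)\<^sup>2 \<le> 8 * (pi * (d i / 2)\<^sup>2)" by (simp add: power2_eq_square)
      qed
      also have "\<dots> = 8 * hausdorff_weight 2 (C i)"
        using False by (subst ennreal_mult) (auto simp: hausdorff_weight_def unit_ball_vol_2 d_def)
      finally show ?thesis .
    qed (simp add: B_def)
    have "emeasure lborel A \<le> emeasure lborel (\<Union>i. B i)"
      using C(1) CB by (intro emeasure_mono) (blast, measurable)
    also have "\<dots> \<le> (\<Sum>i. emeasure lborel (B i))"
      by (rule emeasure_subadditive_countably) auto
    also have "\<dots> \<le> (\<Sum>i. 8 * hausdorff_weight 2 (C i))"
      by (intro suminf_le emB) auto
    also have "\<dots> = 8 * (\<Sum>i. hausdorff_weight 2 (C i))" by simp
    finally show "emeasure lborel A / 8 \<le> (\<Sum>i. hausdorff_weight 2 (C i))"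
      by (intro divide_le_posI_ennreal) auto
  qed
  also have "\<dots> \<le> hausdorff_outer 2 A" unfolding hausdorff_outer_def by (intro SUP_upper) auto
  finally have "8 * (emeasure lborel A / 8) \<le> 8 * hausdorff_outer 2 A" by (intro mult_left_mono) auto
  then show ?thesis by (simp add: ennreal_times_divide mult.commute[of 8] ennreal_mult_divide_eq)
qed

text \<open>Isometry invariance contains translation invariance, and integer translates of the unit
  square give sigma-finiteness. Uniqueness then leaves a factor \<open>c\<close>, the Hausdorff
  measure of the unit square.\<close>

lemma hausdorff_measure_plane:
  obtains c :: real where "0 < c"
    "(hausdorff_measure 2 :: (real \<times> real) measure) = density lborel (\<lambda>_. ennreal c)"
proof -
  let ?H = "hausdorff_measure 2 :: (real \<times> real) measure"
  have sq[measurable]: "unit_square \<in> sets borel" unfolding borel_prod[symmetric] by simp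
  have tr_sets: "(+) a ` A \<in> sets borel" if "A \<in> sets borel" for a :: "real \<times> real" and A
  proof -
    have "(+) a ` A = (\<lambda>x. x - a) -` A \<inter> space borel" by (auto intro!: image_eqI[of _ _ "_ - a"])
    also have "\<dots> \<in> sets borel" using that by (intro measurable_sets) auto
    finally show ?thesis .
  qed
  have outer_tr: "hausdorff_outer 2 ((+) a ` A) = hausdorff_outer 2 A" for a :: "real \<times> real" and A
  proof (rule antisym)
    show "hausdorff_outer 2 ((+) a ` A) \<le> hausdorff_outer 2 A"
      by (rule hausdorff_outer_image_le) simp
    have "hausdorff_outer 2 ((+) (-a) ` (+) a ` A) \<le> hausdorff_outer 2 ((+) a ` A)"
      by (rule hausdorff_outer_image_le) (simp add: dist_norm)
    then show "hausdorff_outer 2 A \<le> hausdorff_outer 2 ((+) a ` A)" by (simp add: image_image)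
  qed
  have sf: "sigma_finite_measure ?H"
  proof
    let ?A = "(\<lambda>(i::int, j::int). (+) (real_of_int i, real_of_int j) ` unit_square) ` UNIV"
    have "\<Union>?A = UNIV"
    proof -
      have "w \<in> \<Union>?A" for w :: "real \<times> real"
        by (rule UnionI[of "(+) (of_int \<lfloor>fst w\<rfloor>, of_int \<lfloor>snd w\<rfloor>) ` unit_square"])
          (auto intro!: image_eqI[of w _ "(frac (fst w), frac (snd w))"]
            simp: frac_def prod_eq_iff less_imp_le[OF frac_lt_1, unfolded frac_def])
      then show ?thesis by blast
    qed
    moreover have "emeasure ?H a \<noteq> \<infinity>" if "a \<in> ?A" for a
      using that hausdorff_outer_unit_square_le
      by (auto simp: emeasure_hausdorff_measure tr_sets outer_tr top_unique)
    ultimately show "\<exists>A. countable A \<and> A \<subseteq> sets ?H \<and> \<Union> A = space ?H \<and> (\<forall>a\<in>A. emeasure ?H a \<noteq> \<infinity>)"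
      by (intro exI[of _ ?A]) (auto intro!: tr_sets)
  qed
  have inv: "distr ?H borel ((+) a) = ?H" for a
  proof (rule measure_eqI)
    fix A assume "A \<in> sets (distr ?H borel ((+) a))"
    then have A[measurable]: "A \<in> sets borel" by simp
    have "emeasure (distr ?H borel ((+) a)) A = emeasure ?H ((+) a -` A)"
      by (subst emeasure_distr) auto
    also have "(+) a -` A = (+) (-a) ` A" by (auto intro!: image_eqI[of _ _ "a + _"])
    finally show "emeasure (distr ?H borel ((+) a)) A = emeasure ?H A"
      using A tr_sets[OF A, of "-a"] outer_tr[of "-a" A] by (simp add: emeasure_hausdorff_measure)
  qed simp
  have l1: "emeasure lborel unit_square = 1"
    unfolding lborel_prod[symmetric] by (subst lborel.emeasure_pair_measure_Times) auto
  define c where "c = enn2real (emeasure ?H unit_square)"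
  have c: "emeasure ?H unit_square = ennreal c"
    using hausdorff_outer_unit_square_le
    by (auto simp: c_def emeasure_hausdorff_measure ennreal_enn2real_if top_unique)
  have "0 < c"
  proof -
    have "1 \<le> 8 * ennreal c"
      using lborel_le_hausdorff_outer[OF sq] c by (simp add: l1 emeasure_hausdorff_measure)
    moreover have "0 \<le> c" by (simp add: c_def)
    ultimately show ?thesis by (cases "c = 0") auto
  qed
  moreover have "?H = density lborel (\<lambda>_. ennreal c)"
  proof (rule measure_eqI)
    fix A assume "A \<in> sets ?H"
    then have [measurable]: "A \<in> sets borel" by simp
    have "emeasure ?H A * emeasure lborel unit_square = emeasure ?H unit_square * emeasure lborel A"
      by (rule translation_invariant_measure_unique) (use sf inv in auto)
    then show "emeasure ?H A = emeasure (density lborel (\<lambda>_. ennreal c)) A"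
      by (simp add: l1 c emeasure_density_const)
  qed simp
  ultimately show ?thesis by (rule that)
qed

subsection \<open>Coordinates\<close>

text \<open>Nested pairs carry the product structure on which Fubini, shears and slices act.
  \<open>v3\<close> passes to the space of the statement, linearly, isometrically and preserving
  Lebesgue measure.\<close>

definition v3 :: "real \<times> real \<times> real \<Rightarrow> real^3" where
  "v3 w = vector [fst w, fst (snd w), snd (snd w)]"

lemma v3_nth [simp]: "v3 w $ 1 = fst w" "v3 w $ 2 = fst (snd w)" "v3 w $ 3 = snd (snd w)"
  by (simp_all add: v3_def)

lemma v3_collapse [simp]: "v3 (x $ 1, x $ 2, x $ 3) = x"
  by (simp add: vec_eq_iff forall_3)

lemma v3_collapse_plane: "x $ 1 = 0 \<Longrightarrow> v3 (0, x $ 2, x $ 3) = x"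
  using v3_collapse[of x] by simp

lemma v3_conv_axis:
  "v3 w = fst w *\<^sub>R axis 1 1 + fst (snd w) *\<^sub>R axis 2 1 + snd (snd w) *\<^sub>R axis 3 1"
  by (simp add: vec_eq_iff forall_3 axis_def)

lemma bounded_linear_v3: "bounded_linear v3"
  unfolding linear_conv_bounded_linear[symmetric]
  by (intro linearI) (auto simp: vec_eq_iff forall_3)

lemma has_derivative_v3 [derivative_intros]:
  assumes "(f has_derivative f') F"
  shows "((\<lambda>x. v3 (f x)) has_derivative (\<lambda>h. v3 (f' h))) F"
  using bounded_linear.has_derivative[OF bounded_linear_v3 assms] .

lemma continuous_on_v3 [continuous_intros]:
  "continuous_on S f \<Longrightarrow> continuous_on S (\<lambda>x. v3 (f x))"
  unfolding v3_conv_axis by (intro continuous_intros)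

lemma borel_measurable_v3 [measurable]: "v3 \<in> borel_measurable borel"
  by (intro borel_measurable_continuous_onI continuous_intros)

lemma Basis_real3: "(Basis :: (real^3) set) = {axis 1 1, axis 2 1, axis 3 1}"
  by (auto simp: Basis_vec_def UNIV_3)

lemma prod_Basis_real3: "(\<Prod>b\<in>Basis. f b) = f (axis 1 1 :: real^3) * f (axis 2 1) * f (axis 3 1)"
  unfolding Basis_real3 by (simp add: axis_eq_axis mult.assoc)

lemma emeasure_lborel_Times:
  fixes A :: "'a::euclidean_space set" and B :: "'b::euclidean_space set"
  assumes "A \<in> sets borel" "B \<in> sets borel"
  shows "emeasure lborel (A \<times> B) = emeasure lborel A * emeasure lborel B"
  unfolding lborel_prod[symmetric] by (rule lborel.emeasure_pair_measure_Times) (use assms in auto)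

lemma distr_lborel_v3: "distr lborel borel v3 = lborel"
proof (rule lborel_eqI[symmetric])
  fix l u :: "real^3" assume "\<And>b. b \<in> Basis \<Longrightarrow> l \<bullet> b \<le> u \<bullet> b"
  then have le: "l $ i \<le> u $ i" for i
    using \<open>\<And>b. b \<in> Basis \<Longrightarrow> l \<bullet> b \<le> u \<bullet> b\<close>[of "axis i 1"] by (simp add: inner_axis)
  have "v3 -` box l u = {l$1<..<u$1} \<times> {l$2<..<u$2} \<times> {l$3<..<u$3}"
    by (auto simp: mem_box_cart forall_3)
  then have "emeasure (distr lborel borel v3) (box l u)
      = emeasure lborel ({l$1<..<u$1} \<times> {l$2<..<u$2} \<times> {l$3<..<u$3})"
    by (subst emeasure_distr) auto
  also have "\<dots> = ennreal (u$1 - l$1) * (ennreal (u$2 - l$2) * ennreal (u$3 - l$3))"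
    using le[of 1] le[of 2] le[of 3] by (simp add: emeasure_lborel_Times borel_Times)
  also have "\<dots> = (\<Prod>b\<in>Basis. (u - l) \<bullet> b)"
    using le by (simp add: prod_Basis_real3 inner_axis ennreal_mult' mult.assoc)
  finally show "emeasure (distr lborel borel v3) (box l u) = (\<Prod>b\<in>Basis. (u - l) \<bullet> b)" .
qed simp

lemma integral_lborel_v3:
  fixes f :: "real^3 \<Rightarrow> real"
  shows "f \<in> borel_measurable borel \<Longrightarrow> (LINT x|lborel. f x) = (LINT w|lborel. f (v3 w))"
  by (subst distr_lborel_v3[symmetric]) (simp add: integral_distr)

lemma integrable_bounded_support:
  fixes f :: "'a::euclidean_space \<Rightarrow> real"
  assumes [measurable]: "f \<in> borel_measurable borel"
    and "bounded S" "\<And>x. x \<notin> S \<Longrightarrow> f x = 0" "\<And>x. \<bar>f x\<bar> \<le> B"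
  shows "integrable lborel f"
proof -
  obtain a b where S: "S \<subseteq> cbox a b" using \<open>bounded S\<close> by (meson bounded_subset_cbox_symmetric)
  show ?thesis
    by (rule integrableI_bounded_set[where A="cbox a b" and B=B])
      (use assms S in \<open>auto simp: emeasure_lborel_cbox_eq\<close>)
qed

subsection \<open>The boundary measure\<close>

definition Omega :: "(real^3) set" where "Omega = {x. 0 < x $ 1}"

lemma frontier_Omega: "frontier Omega = {x. x $ 1 = 0}"
proof -
  have "frontier {x::real^3. axis 1 1 \<bullet> x > 0} = {x. axis 1 1 \<bullet> x = 0}"
    by (rule frontier_halfspace_gt) simp
  then show ?thesis by (simp add: Omega_def inner_axis' )
qed

text \<open>Coverings in \<open>real^3\<close> may leave the plane, so the two outer measures differ
  by definition. They agree because the embedding of the plane and the projection onto the last two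
  coordinates are both 1-Lipschitz.\<close>

lemma restrict_hausdorff_frontier:
  "restrict_space (hausdorff_measure 2) (frontier Omega) =
     distr (hausdorff_measure 2) (restrict_space borel (frontier Omega)) (\<lambda>w. v3 (0, w))"
  (is "?R = ?D")
proof (rule measure_eqI)
  show "sets ?R = sets ?D" by (simp add: sets_restrict_space)
  fix A assume "A \<in> sets ?R"
  moreover have [measurable]: "frontier Omega \<in> sets borel" by (simp add: borel_closed)
  ultimately have A[measurable]: "A \<in> sets borel" and AF: "A \<subseteq> frontier Omega"
    by (auto simp: sets_restrict_space_iff)
  let ?e = "\<lambda>w. v3 (0, w)"
  have m: "?e \<in> hausdorff_measure 2 \<rightarrow>\<^sub>M restrict_space borel (frontier Omega)"
    by (rule measurable_restrict_space2) (auto simp: frontier_Omega)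
  have 1: "A = ?e ` (?e -` A)"
  proof
    show "A \<subseteq> ?e ` (?e -` A)"
    proof
      fix x assume "x \<in> A"
      then have "v3 (0, x $ 2, x $ 3) = x" using AF by (intro v3_collapse_plane) (auto simp: frontier_Omega)
      then show "x \<in> ?e ` (?e -` A)" using \<open>x \<in> A\<close> by (intro image_eqI[of _ _ "(x $ 2, x $ 3)"]) auto
    qed
  qed auto
  have 2: "?e -` A = (\<lambda>x. (x $ 2, x $ 3)) ` A"
  proof
    show "?e -` A \<subseteq> (\<lambda>x. (x $ 2, x $ 3)) ` A"
    proof
      fix w assume "w \<in> ?e -` A"
      then show "w \<in> (\<lambda>x. (x $ 2, x $ 3)) ` A" by (intro image_eqI[of _ _ "?e w"]) auto
    qed
    show "(\<lambda>x. (x $ 2, x $ 3)) ` A \<subseteq> ?e -` A"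
    proof
      fix w assume "w \<in> (\<lambda>x. (x $ 2, x $ 3)) ` A"
      then obtain x where x: "x \<in> A" "w = (x $ 2, x $ 3)" by auto
      then have "v3 (0, x $ 2, x $ 3) = x" using AF by (intro v3_collapse_plane) (auto simp: frontier_Omega)
      with x show "w \<in> ?e -` A" by simp
    qed
  qed
  have n3: "norm x = sqrt ((x$1)\<^sup>2 + ((x$2)\<^sup>2 + (x$3)\<^sup>2))" for x :: "real^3"
    by (simp add: norm_vec_def L2_set_def sum_3 add.assoc)
  have "hausdorff_outer 2 (?e -` A) = hausdorff_outer 2 A"
  proof (rule antisym)
    show "hausdorff_outer 2 (?e -` A) \<le> hausdorff_outer 2 A"
      by (subst 2, rule hausdorff_outer_image_le) (auto simp: dist_norm n3 norm_Pair)
    show "hausdorff_outer 2 A \<le> hausdorff_outer 2 (?e -` A)"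
      by (subst (1) 1, rule hausdorff_outer_image_le) (auto simp: dist_norm n3 norm_Pair)
  qed
  moreover have "?e -` A \<in> sets borel"
    using measurable_sets[of ?e borel borel A] by simp
  ultimately have "emeasure (hausdorff_measure 2) A = emeasure (hausdorff_measure 2) (?e -` A)"
    by (simp add: emeasure_hausdorff_measure)
  then show "emeasure ?R A = emeasure ?D A"
    using AF m by (subst emeasure_restrict_space) (auto simp: emeasure_distr sets_restrict_space_iff)
qed


text \<open>The boundary measure is the product of time with the density \<open>c\<close> on the
  plane, pushed forward by the embedding. The constant is obtained before the function, so one
  \<open>c\<close> serves all test functions and the field can be built from it.\<close>

lemma boundary_integral:
  obtains c :: real where "0 < c"
    "\<And>f B S. f \<in> borel_measurable borel \<Longrightarrow> bounded S \<Longrightarrow> (\<And>z. z \<notin> S \<Longrightarrow> f z = 0) \<Longrightarrow>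
       (\<And>z. \<bar>f z :: real\<bar> \<le> B) \<Longrightarrow> (LINT z|boundary_measure Omega. f z) =
       c * (LINT t|lborel. indicator {0<..<1} t * (LINT w|lborel. f (t, v3 (0, w))))"
proof -
  obtain c :: real where c: "0 < c" and H: "(hausdorff_measure 2 :: (real \<times> real) measure) = density lborel (\<lambda>_. ennreal c)"
    by (rule hausdorff_measure_plane)
  let ?H = "hausdorff_measure 2 :: (real \<times> real) measure"
  let ?F = "frontier Omega" let ?I = "lborel_on {0<..<1::real}" let ?e = "\<lambda>w. v3 (0, w)"
  let ?R = "restrict_space borel ?F"
  have [measurable]: "?F \<in> sets borel" by (simp add: borel_closed)
  have m: "?e \<in> ?H \<rightarrow>\<^sub>M ?R"
    by (rule measurable_restrict_space2) (auto simp: frontier_Omega)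
  interpret I: sigma_finite_measure ?I
    by (rule sigma_finite_measure_restrict_space) (auto simp: lborel.sigma_finite_measure_axioms)
  interpret P: pair_sigma_finite ?I "lborel :: (real \<times> real) measure" ..
  interpret H: sigma_finite_measure ?H
    unfolding H by (rule iffD2[OF sigma_finite_measure.sigma_finite_iff_density_finite[OF sigma_finite_lborel]]) auto
  \<comment> \<open>\<open>pair_measure_distr\<close> asks for sigma-finiteness of the
    pushed-forward factor; a countable cover of the plane by sets of finite measure is carried along
    by the embedding.\<close>
  have sfD: "sigma_finite_measure (distr ?H ?R ?e)"
  proof
    obtain A where A: "countable A" "A \<subseteq> sets ?H" "\<Union>A = space ?H" "\<forall>a\<in>A. emeasure ?H a \<noteq> \<infinity>"
      using H.sigma_finite_countable by auto
    define E where "E a = {x \<in> ?F. (x $ 2, x $ 3) \<in> a}" for a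
    have Es: "E a \<in> sets ?R" if "a \<in> A" for a
    proof -
      have "(\<lambda>x::real^3. (x $ 2, x $ 3)) -` a \<inter> space borel \<in> sets borel"
        using A(2) that by (intro measurable_sets[of _ borel borel]) auto
      moreover have "E a = ?F \<inter> ((\<lambda>x::real^3. (x $ 2, x $ 3)) -` a \<inter> space borel)"
        by (auto simp: E_def)
      ultimately show ?thesis by (auto simp: sets_restrict_space)
    qed
    moreover have "emeasure (distr ?H ?R ?e) (E a) = emeasure ?H a" if "a \<in> A" for a
    proof -
      have "?e -` E a = a" by (auto simp: E_def frontier_Omega)
      then show ?thesis using Es[OF that] m by (simp add: emeasure_distr)
    qed
    moreover have "\<Union>(E ` A) = ?F"
      using A(3) by (auto simp: E_def)
    ultimately show "\<exists>A. countable A \<and> A \<subseteq> sets (distr ?H ?R ?e) \<and>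
        \<Union> A = space (distr ?H ?R ?e) \<and> (\<forall>a\<in>A. emeasure (distr ?H ?R ?e) a \<noteq> \<infinity>)"
      using A(1,4) by (intro exI[of _ "E ` A"]) (auto simp: space_restrict_space)
  qed
  have "boundary_measure Omega = distr ?I ?I (\<lambda>t. t) \<Otimes>\<^sub>M distr ?H ?R ?e"
    unfolding boundary_measure_def restrict_hausdorff_frontier by (simp add: distr_id)
  also have "\<dots> = distr (?I \<Otimes>\<^sub>M ?H) (?I \<Otimes>\<^sub>M ?R) (\<lambda>(t, w). (t, ?e w))"
    by (rule pair_measure_distr[OF _ m sfD]) auto
  also have "?I \<Otimes>\<^sub>M ?H = density (?I \<Otimes>\<^sub>M lborel) (\<lambda>_. ennreal c)"
  proof -
    have "density ?I (\<lambda>_. 1) \<Otimes>\<^sub>M density lborel (\<lambda>_. ennreal c) =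
        density (?I \<Otimes>\<^sub>M (lborel :: (real \<times> real) measure)) (\<lambda>(x, y). 1 * ennreal c)"
      by (rule pair_measure_density)
        (use H.sigma_finite_measure_axioms H lborel.sigma_finite_measure_axioms in auto)
    then show ?thesis by (simp add: H density_1 case_prod_beta')
  qed
  finally have bm: "boundary_measure Omega =
     distr (density (?I \<Otimes>\<^sub>M lborel) (\<lambda>_. ennreal c)) (?I \<Otimes>\<^sub>M ?R) (\<lambda>(t, w). (t, ?e w))" .
  have "(LINT z|boundary_measure Omega. f z) =
       c * (LINT t|lborel. indicator {0<..<1} t * (LINT w|lborel. f (t, v3 (0, w))))"
    if f[measurable]: "f \<in> borel_measurable borel" and S: "bounded S" "\<And>z. z \<notin> S \<Longrightarrow> f z = 0"
      and B: "\<And>z. \<bar>f z :: real\<bar> \<le> B" for f S B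
  proof -
    have idI: "(\<lambda>t. t) \<in> ?I \<rightarrow>\<^sub>M borel" by (rule measurable_restrict_space1) auto
    have idR: "(\<lambda>t. t) \<in> ?R \<rightarrow>\<^sub>M borel" by (rule measurable_restrict_space1) auto
    have pI: "fst \<in> ?I \<Otimes>\<^sub>M N \<rightarrow>\<^sub>M borel" for N :: "'x measure"
      using measurable_compose[OF measurable_fst idI] .
    have pR: "snd \<in> ?I \<Otimes>\<^sub>M ?R \<rightarrow>\<^sub>M borel"
      using measurable_compose[OF measurable_snd idR] .
    have fR[measurable]: "f \<in> borel_measurable (?I \<Otimes>\<^sub>M ?R)"
    proof -
      have "(\<lambda>z. (fst z, snd z)) \<in> ?I \<Otimes>\<^sub>M ?R \<rightarrow>\<^sub>M borel \<Otimes>\<^sub>M borel"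
        using measurable_Pair[OF pI pR] .
      then have "(\<lambda>z. z) \<in> ?I \<Otimes>\<^sub>M ?R \<rightarrow>\<^sub>M borel" by (simp add: borel_prod)
      from measurable_compose[OF this f] show ?thesis .
    qed
    have sndI: "snd \<in> ?I \<Otimes>\<^sub>M lborel \<rightarrow>\<^sub>M (borel :: (real \<times> real) measure)"
      using measurable_snd[of ?I lborel] by (simp add: measurable_lborel1 cong: measurable_cong_sets)
    have m': "?e \<in> borel \<rightarrow>\<^sub>M ?R"
      by (rule measurable_restrict_space2) (auto simp: frontier_Omega)
    have eR[measurable]: "(\<lambda>(t, w). (t, ?e w)) \<in> ?I \<Otimes>\<^sub>M lborel \<rightarrow>\<^sub>M ?I \<Otimes>\<^sub>M ?R"
      using measurable_Pair[OF measurable_fst measurable_compose[OF sndI m']]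
      by (simp add: case_prod_beta')
    define g where "g = (\<lambda>(t, w). f (t, ?e w))"
    have gm[measurable]: "g \<in> borel_measurable (?I \<Otimes>\<^sub>M lborel)"
    proof -
      have "g = (\<lambda>x. f ((\<lambda>(t, w). (t, ?e w)) x))" by (auto simp: g_def fun_eq_iff)
      with measurable_compose[OF eR fR] show ?thesis by (simp only:)
    qed
    have gi: "integrable (?I \<Otimes>\<^sub>M lborel) g"
    proof -
      obtain M where M: "\<And>z. z \<in> S \<Longrightarrow> norm z \<le> M" using S(1) by (auto simp: bounded_iff)
      define Q :: "(real \<times> real) set" where "Q = {-M..M} \<times> {-M..M}"
      have Qm[measurable]: "Q \<in> sets borel" unfolding Q_def borel_prod[symmetric] by simp
      have finI: "emeasure ?I {0<..<1} < \<infinity>" by (subst emeasure_restrict_space) auto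
      have finQ: "emeasure lborel Q < \<infinity>"
        unfolding Q_def by (intro emeasure_bounded_finite bounded_Times) auto
      have sI: "{0<..<1} \<in> sets ?I" by (auto simp: sets_restrict_space)
      show ?thesis
      proof (rule integrableI_bounded_set[where A="{0<..<1} \<times> Q" and B=B])
        show "{0<..<1} \<times> Q \<in> sets (?I \<Otimes>\<^sub>M lborel)" using sI Qm by (intro pair_measureI) auto
        show "emeasure (?I \<Otimes>\<^sub>M lborel) ({0<..<1} \<times> Q) < \<infinity>"
          using sI Qm finI finQ by (subst lborel.emeasure_pair_measure_Times) (auto simp: ennreal_mult_less_top)
        show "AE x in ?I \<Otimes>\<^sub>M lborel. x \<in> {0<..<1} \<times> Q \<longrightarrow> norm (g x) \<le> B"
          using B by (auto simp: g_def)
        show "AE x in ?I \<Otimes>\<^sub>M lborel. x \<notin> {0<..<1} \<times> Q \<longrightarrow> g x = 0"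
        proof (rule AE_I2, intro impI)
          fix x assume "x \<in> space (?I \<Otimes>\<^sub>M lborel)" "x \<notin> {0<..<1} \<times> Q"
          then have nQ: "snd x \<notin> Q" by (auto simp: space_pair_measure space_restrict_space)
          have "(fst x, ?e (snd x)) \<notin> S"
          proof
            assume "(fst x, ?e (snd x)) \<in> S"
            then have "norm (?e (snd x)) \<le> M"
              using M norm_snd_le order_trans by (metis snd_conv)
            then have "\<bar>?e (snd x) $ i\<bar> \<le> M" for i using component_le_norm_cart order_trans by blast
            from this[of 2] this[of 3] nQ show False by (auto simp: Q_def mem_Times_iff abs_le_iff)
          qed
          then show "g x = 0" using S(2) by (simp add: g_def case_prod_beta')
        qed
      qed (rule gm)
    qed
    have "(LINT z|boundary_measure Omega. f z) = (LINT z|density (?I \<Otimes>\<^sub>M lborel) (\<lambda>_. ennreal c). g z)"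
    proof -
      have eR': "(\<lambda>(t, w). (t, ?e w)) \<in> density (?I \<Otimes>\<^sub>M lborel) (\<lambda>_. ennreal c) \<rightarrow>\<^sub>M ?I \<Otimes>\<^sub>M ?R"
        using eR by (simp only: measurable_density_eq1)
      have "g = (\<lambda>x. f ((\<lambda>(t, w). (t, ?e w)) x))" by (auto simp: g_def fun_eq_iff)
      then show ?thesis unfolding bm by (simp only: integral_distr[OF eR' fR])
    qed
    also have "\<dots> = c * (LINT z|(?I \<Otimes>\<^sub>M lborel). g z)"
      using c by (subst integral_density) auto
    also have "(LINT z|(?I \<Otimes>\<^sub>M lborel). g z) = (LINT t|?I. LINT w|lborel. g (t, w))"
      using P.integral_fst'[OF gi] by simp
    also have "\<dots> = (LINT t|lborel. indicator {0<..<1} t * (LINT w|lborel. f (t, v3 (0, w))))"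
      by (subst integral_restrict_space) (auto simp: g_def)
    finally show ?thesis .
  qed
  with c show ?thesis by (rule that)
qed

section \<open>Measurability of components\<close>

lemma borel_measurable_fst_borel [measurable (raw)]:
  fixes f :: "_ \<Rightarrow> 'b::second_countable_topology \<times> 'c::second_countable_topology"
  shows "f \<in> M \<rightarrow>\<^sub>M borel \<Longrightarrow> (\<lambda>x. fst (f x)) \<in> M \<rightarrow>\<^sub>M borel"
  unfolding borel_prod[symmetric] by (rule measurable_fst')

lemma borel_measurable_snd_borel [measurable (raw)]:
  fixes f :: "_ \<Rightarrow> 'b::second_countable_topology \<times> 'c::second_countable_topology"
  shows "f \<in> M \<rightarrow>\<^sub>M borel \<Longrightarrow> (\<lambda>x. snd (f x)) \<in> M \<rightarrow>\<^sub>M borel"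
  unfolding borel_prod[symmetric] by (rule measurable_snd')

lemma borel_measurable_nth [measurable (raw)]:
  fixes f :: "'a \<Rightarrow> real^'n"
  assumes "f \<in> borel_measurable M" shows "(\<lambda>x. f x $ i) \<in> borel_measurable M"
  by (rule measurable_compose[OF assms borel_measurable_continuous_onI]) (intro continuous_intros)

subsection \<open>Square waves\<close>

text \<open>The Rademacher functions on all dyadic scales, with half-period \<open>2 powi m\<close>.
  Negative \<open>m\<close> are allowed since the pattern refines without end towards the
  boundary.\<close>

definition sqw :: "int \<Rightarrow> real \<Rightarrow> real" where
  "sqw m v = (if even \<lfloor>v / 2 powi m\<rfloor> then 1 else -1)"

lemma sqw_cases: "sqw m v = 1 \<or> sqw m v = -1"
  by (simp add: sqw_def)

lemma abs_sqw [simp]: "\<bar>sqw m v\<bar> = 1"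
  by (simp add: sqw_def)

lemma sqw_add_half_period: "sqw m (v + 2 powi m) = - sqw m v"
proof -
  have "(v + 2 powi m) / 2 powi m = v / 2 powi m + of_int 1" by (simp add: field_simps)
  then have "\<lfloor>(v + 2 powi m) / 2 powi m\<rfloor> = \<lfloor>v / 2 powi m\<rfloor> + 1" by (simp only: floor_add_int)
  then show ?thesis by (simp add: sqw_def)
qed

lemma sqw_diff_half_period: "sqw m (v - 2 powi m) = - sqw m v"
  using sqw_add_half_period[of m "v - 2 powi m"] by simp

lemma sqw_diff_period: "sqw m (v - 2 powi (m+1)) = sqw m v"
proof -
  have "v - 2 powi (m+1) = v - 2 powi m - 2 powi m" by (simp add: power_int_add)
  then show ?thesis by (simp only: sqw_diff_half_period)
qed

lemma borel_measurable_sqw [measurable]: "sqw m \<in> borel_measurable borel"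
  unfolding sqw_def by measurable

section \<open>Dyadic layers and the displacement by the shear\<close>

definition lev :: "real \<Rightarrow> int" where "lev s = \<lfloor>log 2 s\<rfloor>"

lemma lev_unique: "0 < s \<Longrightarrow> lev s = m \<longleftrightarrow> 2 powi m \<le> s \<and> s < 2 powi (m + 1)"
  unfolding lev_def
  by (subst floor_log_eq_powr_iff)
    (auto simp flip: powr_real_of_int')

lemma lev_eq: "2 powi m \<le> s \<Longrightarrow> s < 2 powi (m + 1) \<Longrightarrow> lev s = m"
  by (subst lev_unique) (auto intro: less_le_trans[of _ "2 powi m"])

lemma borel_measurable_lev [measurable]: "lev \<in> borel \<rightarrow>\<^sub>M count_space UNIV"
  unfolding lev_def by measurable

text \<open>The speed of the shear in layer \<open>m\<close>, read at the transverse coordinate that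
  this layer leaves fixed. It is 1 precisely where the sign of \<open>sqw m\<close> has to change on
  the way down.\<close>

definition shift :: "int \<Rightarrow> real \<Rightarrow> real" where
  "shift m v = (if sqw (m + 1) v = sqw (m - 1) v then 0 else 1)"

lemma abs_shift_le [simp]: "\<bar>shift m v\<bar> \<le> 1"
  by (simp add: shift_def)

lemma borel_measurable_shift [measurable]: "shift m \<in> borel_measurable borel"
  unfolding shift_def by measurable

text \<open>At the lower end of the layer the displacement is 0 or one half-period of
  \<open>sqw m\<close>. The sign it produces is \<open>sqw (m + 1) P * sqw (m - 1) P\<close>, which
  cancels the coarse factor and leaves the fine one.\<close>

lemma shift_bottom: "sqw (m + 1) P * sqw m (Q - 2 powi m * shift m P) = sqw (m - 1) P * sqw m Q"
  using sqw_cases[of "m+1" P] sqw_cases[of "m-1" P] by (auto simp: shift_def sqw_diff_half_period)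

text \<open>At the upper end the displacement is 0 or a full period of \<open>sqw m\<close>, hence
  invisible.\<close>

lemma shift_top: "sqw m (Q - 2 powi (m + 1) * shift m P) = sqw m Q"
  by (auto simp: shift_def sqw_diff_period)

subsection \<open>Compactly supported continuously differentiable functions\<close>

text \<open>The partial derivatives are arguments, so that after a swap of coordinates or a
  restriction to a slanted slice they are given by explicit formulas.\<close>

definition C1c ::
  "(real \<times> real \<times> real \<Rightarrow> real) \<Rightarrow> (real \<times> real \<times> real \<Rightarrow> real) \<Rightarrow> (real \<times> real \<times> real \<Rightarrow> real) \<Rightarrow>
   (real \<times> real \<times> real \<Rightarrow> real) \<Rightarrow> bool" where
  "C1c f fs fy fz \<longleftrightarrow>
     continuous_on UNIV f \<and> continuous_on UNIV fs \<and> continuous_on UNIV fy \<and> continuous_on UNIV fz \<and>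
     (\<forall>w. (f has_derivative (\<lambda>h. fst h * fs w + fst (snd h) * fy w + snd (snd h) * fz w)) (at w)) \<and>
     (\<exists>M. \<forall>w. M < norm w \<longrightarrow> f w = 0 \<and> fs w = 0 \<and> fy w = 0 \<and> fz w = 0)"

lemma continuous_bounded_of_support:
  fixes g :: "'a::euclidean_space \<Rightarrow> real"
  assumes "continuous_on UNIV g" "\<And>w. M < norm w \<Longrightarrow> g w = 0"
  obtains B where "0 \<le> B" "\<And>w. \<bar>g w\<bar> \<le> B"
proof -
  have "compact (g ` cball 0 M)"
    by (intro compact_continuous_image continuous_on_subset[OF assms(1)]) auto
  then obtain B where B: "0 < B" "\<And>x. x \<in> g ` cball 0 M \<Longrightarrow> norm x \<le> B"
    using bounded_pos by (metis compact_imp_bounded)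
  have "\<bar>g w\<bar> \<le> B" for w
    using B assms(2)[of w] by (cases "norm w \<le> M") auto
  with B(1) show ?thesis by (intro that[of B]) auto
qed

lemma C1c_bounds:
  assumes "C1c f fs fy fz"
  obtains M B where "0 \<le> M" "0 \<le> B"
    "\<And>w. M < norm w \<Longrightarrow> f w = 0 \<and> fs w = 0 \<and> fy w = 0 \<and> fz w = 0"
    "\<And>w. \<bar>f w\<bar> \<le> B \<and> \<bar>fs w\<bar> \<le> B \<and> \<bar>fy w\<bar> \<le> B \<and> \<bar>fz w\<bar> \<le> B"
proof -
  obtain M where M: "\<And>w. M < norm w \<Longrightarrow> f w = 0 \<and> fs w = 0 \<and> fy w = 0 \<and> fz w = 0"
    using assms by (auto simp: C1c_def)
  have "\<exists>B\<ge>0. \<forall>w. \<bar>g w\<bar> \<le> B" if "g \<in> {f, fs, fy, fz}" for g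
  proof -
    have "continuous_on UNIV g" using that assms by (auto simp: C1c_def)
    moreover have "g w = 0" if "M < norm w" for w using \<open>g \<in> _\<close> M[OF that] by auto
    ultimately show ?thesis by (metis continuous_bounded_of_support)
  qed
  then have "\<exists>B\<ge>0. \<forall>w. \<bar>f w\<bar> \<le> B" "\<exists>B\<ge>0. \<forall>w. \<bar>fs w\<bar> \<le> B" "\<exists>B\<ge>0. \<forall>w. \<bar>fy w\<bar> \<le> B" "\<exists>B\<ge>0. \<forall>w. \<bar>fz w\<bar> \<le> B"
    by simp_all
  then obtain B1 B2 B3 B4 where B: "0 \<le> B1" "0 \<le> B2" "0 \<le> B3" "0 \<le> B4"
      "\<And>w. \<bar>f w\<bar> \<le> B1" "\<And>w. \<bar>fs w\<bar> \<le> B2" "\<And>w. \<bar>fy w\<bar> \<le> B3" "\<And>w. \<bar>fz w\<bar> \<le> B4" by blast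
  show ?thesis
  proof (rule that[of "max 0 M" "B1 + B2 + B3 + B4"])
    fix w show "\<bar>f w\<bar> \<le> B1+B2+B3+B4 \<and> \<bar>fs w\<bar> \<le> B1+B2+B3+B4 \<and> \<bar>fy w\<bar> \<le> B1+B2+B3+B4 \<and> \<bar>fz w\<bar> \<le> B1+B2+B3+B4"
      using B(1-4) B(5-8)[of w] by linarith
  qed (use B(1-4) M in auto)
qed

lemma C1c_measurable:
  assumes "C1c f fs fy fz"
  shows "f \<in> borel_measurable borel" "fs \<in> borel_measurable borel"
    "fy \<in> borel_measurable borel" "fz \<in> borel_measurable borel"
  using assms by (auto simp: C1c_def intro: borel_measurable_continuous_onI)

text \<open>An odd layer is an even layer with y and z exchanged; this map reduces the first case to
  the second.\<close>

definition swap3 :: "real \<times> real \<times> real \<Rightarrow> real \<times> real \<times> real" where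
  "swap3 w = (fst w, snd (snd w), fst (snd w))"

lemma norm_swap3 [simp]: "norm (swap3 w) = norm w"
  by (simp add: swap3_def norm_prod_def add.commute)

lemma continuous_on_swap3: "continuous_on UNIV swap3"
  unfolding swap3_def by (intro continuous_intros)

lemma borel_measurable_swap3 [measurable]: "swap3 \<in> borel_measurable borel"
  by (intro borel_measurable_continuous_onI continuous_on_swap3)

lemma C1c_swap3:
  assumes "C1c f fs fy fz"
  shows "C1c (f \<circ> swap3) (fs \<circ> swap3) (fz \<circ> swap3) (fy \<circ> swap3)"
  unfolding C1c_def
proof (intro conjI allI)
  show "\<exists>M. \<forall>w. M < norm w \<longrightarrow> (f \<circ> swap3) w = 0 \<and> (fs \<circ> swap3) w = 0 \<and> (fz \<circ> swap3) w = 0 \<and> (fy \<circ> swap3) w = 0"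
  proof -
    obtain M where "\<And>w. M < norm w \<Longrightarrow> f w = 0 \<and> fs w = 0 \<and> fy w = 0 \<and> fz w = 0"
      using assms unfolding C1c_def by blast
    then show ?thesis by (intro exI[of _ M]) simp
  qed
  have sw: "(swap3 has_derivative swap3) (at w)" for w
    unfolding swap3_def[abs_def] by (auto intro!: derivative_eq_intros)
  fix w
  have "(f has_derivative (\<lambda>h. fst h * fs (swap3 w) + fst (snd h) * fy (swap3 w) + snd (snd h) * fz (swap3 w))) (at (swap3 w))"
    using assms unfolding C1c_def by blast
  from diff_chain_at[OF sw this]
  show "(f \<circ> swap3 has_derivative (\<lambda>h. fst h * (fs \<circ> swap3) w + fst (snd h) * (fz \<circ> swap3) w + snd (snd h) * (fy \<circ> swap3) w)) (at w)"
    by (simp add: comp_def swap3_def add.assoc add.commute add.left_commute)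
next
  have comp: "continuous_on UNIV (g \<circ> swap3)" if "continuous_on UNIV g" for g :: "_ \<Rightarrow> real"
    by (rule continuous_on_compose[OF continuous_on_swap3 continuous_on_subset[OF that]]) auto
  show "continuous_on UNIV (f \<circ> swap3)" "continuous_on UNIV (fs \<circ> swap3)"
    "continuous_on UNIV (fz \<circ> swap3)" "continuous_on UNIV (fy \<circ> swap3)"
    by (rule comp; use assms in \<open>unfold C1c_def, blast\<close>)+
qed

lemma distr_lborel_swap3: "distr lborel borel swap3 = lborel"
proof (rule lborel_eqI[symmetric])
  fix l u :: "real \<times> real \<times> real" assume le: "\<And>b. b \<in> Basis \<Longrightarrow> l \<bullet> b \<le> u \<bullet> b"
  obtain l1 l2 l3 u1 u2 u3 where lu: "l = (l1, l2, l3)" "u = (u1, u2, u3)" by (metis prod_cases3)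
  have le': "l1 \<le> u1" "l2 \<le> u2" "l3 \<le> u3"
    using le[of "(1,0,0)"] le[of "(0,1,0)"] le[of "(0,0,1)"] by (auto simp: lu Basis_prod_def zero_prod_def)
  have "swap3 -` box l u = {l1<..<u1} \<times> {l3<..<u3} \<times> {l2<..<u2}"
    by (auto simp: swap3_def lu mem_box Basis_prod_def)
  then have "emeasure (distr lborel borel swap3) (box l u) = emeasure lborel ({l1<..<u1} \<times> {l3<..<u3} \<times> {l2<..<u2})"
    by (subst emeasure_distr) auto
  also have "\<dots> = ennreal (u1 - l1) * (ennreal (u3 - l3) * ennreal (u2 - l2))"
    using le' by (simp add: emeasure_lborel_Times borel_Times)
  also have "\<dots> = (\<Prod>b\<in>Basis. (u - l) \<bullet> b)"
  proof -
    have B: "(Basis :: (real \<times> real \<times> real) set) = {(1,0,0), (0,1,0), (0,0,1)}"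
      by (auto simp: Basis_prod_def zero_prod_def)
    show ?thesis unfolding B using le' by (simp add: lu ennreal_mult' mult.assoc mult.commute)
  qed
  finally show "emeasure (distr lborel borel swap3) (box l u) = (\<Prod>b\<in>Basis. (u - l) \<bullet> b)" .
qed simp

lemma integral_swap3:
  fixes f :: "real \<times> real \<times> real \<Rightarrow> real"
  assumes [measurable]: "f \<in> borel_measurable borel"
  shows "(LINT w|lborel. f (swap3 w)) = (LINT w|lborel. f w)"
  by (subst (2) distr_lborel_swap3[symmetric]) (simp add: integral_distr)

subsection \<open>Transport by a shear\<close>

text \<open>Cavalieri's principle: each vertical slice is merely translated. The profile
  \<open>k\<close> is only Borel, as the piecewise constant speeds require, so no Jacobian is
  available.\<close>

lemma distr_lborel_shear:
  fixes k :: "real \<Rightarrow> real"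
  assumes [measurable]: "k \<in> borel_measurable borel"
  shows "distr lborel borel (\<lambda>w. (fst w, snd w + k (fst w))) = (lborel :: (real \<times> real) measure)"
proof (rule measure_eqI)
  fix A assume "A \<in> sets (distr lborel borel (\<lambda>w. (fst w, snd w + k (fst w))))"
  then have A[measurable]: "A \<in> sets borel" by simp
  let ?T = "\<lambda>w::real \<times> real. (fst w, snd w + k (fst w))"
  have T[measurable]: "?T \<in> borel_measurable borel" by (simp add: borel_prod[symmetric])
  have TA: "?T -` A \<in> sets (lborel \<Otimes>\<^sub>M lborel)" "A \<in> sets (lborel \<Otimes>\<^sub>M lborel)"
    using measurable_sets[OF T A] A unfolding lborel_prod by auto
  have "emeasure (distr lborel borel ?T) A = emeasure (lborel \<Otimes>\<^sub>M lborel) (?T -` A)"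
    by (subst emeasure_distr) (auto simp: lborel_prod)
  also have "\<dots> = (\<integral>\<^sup>+x. emeasure lborel (Pair x -` ?T -` A) \<partial>lborel)"
    by (rule lborel.emeasure_pair_measure_alt[OF TA(1)])
  also have "\<dots> = (\<integral>\<^sup>+x. emeasure lborel (Pair x -` A) \<partial>lborel)"
  proof (rule nn_integral_cong)
    fix x
    have Ax: "Pair x -` A \<in> sets borel"
      using sets_Pair1[OF TA(2), of x] by simp
    have "emeasure lborel (Pair x -` A) = emeasure (distr lborel borel ((+) (k x))) (Pair x -` A)"
      by (simp add: lborel_distr_plus)
    also have "\<dots> = emeasure lborel ((+) (k x) -` Pair x -` A)" using Ax by (subst emeasure_distr) auto
    also have "(+) (k x) -` Pair x -` A = Pair x -` ?T -` A" by (auto simp: add.commute)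
    finally show "emeasure lborel (Pair x -` ?T -` A) = emeasure lborel (Pair x -` A)" ..
  qed
  also have "\<dots> = emeasure (lborel \<Otimes>\<^sub>M lborel) A"
    by (rule lborel.emeasure_pair_measure_alt[OF TA(2), symmetric])
  finally show "emeasure (distr lborel borel ?T) A = emeasure lborel A" by (simp add: lborel_prod)
qed simp

lemma integral_shear:
  fixes k :: "real \<Rightarrow> real" and h :: "real \<times> real \<Rightarrow> real"
  assumes [measurable]: "k \<in> borel_measurable borel" "h \<in> borel_measurable borel"
  shows "(LINT w|lborel. h (fst w, snd w + k (fst w))) = (LINT w|lborel. h w)"
proof -
  have [measurable]: "(\<lambda>w::real \<times> real. (fst w, snd w + k (fst w))) \<in> borel_measurable borel"
    by (simp add: borel_prod[symmetric])
  show ?thesis by (subst (2) distr_lborel_shear[OF assms(1), symmetric]) (simp add: integral_distr)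
qed

text \<open>The substitution \<open>Q \<mapsto> Q + s * p P\<close> straightens the characteristics,
  along which \<open>P\<close> is constant. The transported factor becomes \<open>G v\<close>,
  independent of \<open>s\<close>, and the other factor becomes the derivative of \<open>f\<close>
  along the characteristic. The fundamental theorem is then applied in \<open>s\<close> alone, which
  asks for smoothness of \<open>f\<close> but only measurability of \<open>G\<close> and
  \<open>p\<close>.\<close>

lemma layer_integral:
  assumes C: "C1c f fs fP fQ" and G[measurable]: "G \<in> borel_measurable borel" and GK: "\<And>v. \<bar>G v\<bar> \<le> 1"
    and p[measurable]: "p \<in> borel_measurable borel" and p1: "\<And>v. \<bar>p v\<bar> \<le> 1" and "\<alpha> \<le> \<beta>"
  shows "(LINT w|lborel. indicator {\<alpha>..<\<beta>} (fst w) *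
        (G (fst (snd w), snd (snd w) - fst w * p (fst (snd w))) * (fs w + p (fst (snd w)) * fQ w))) =
      (LINT v|lborel. G (fst v, snd v - \<beta> * p (fst v)) * f (\<beta>, v)) -
      (LINT v|lborel. G (fst v, snd v - \<alpha> * p (fst v)) * f (\<alpha>, v))"
proof -
  note [measurable] = C1c_measurable[OF C]
  obtain M B where M: "0 \<le> M" "0 \<le> B"
    "\<And>w. M < norm w \<Longrightarrow> f w = 0 \<and> fs w = 0 \<and> fP w = 0 \<and> fQ w = 0"
    "\<And>w. \<bar>f w\<bar> \<le> B \<and> \<bar>fs w\<bar> \<le> B \<and> \<bar>fP w\<bar> \<le> B \<and> \<bar>fQ w\<bar> \<le> B"
    using C1c_bounds[OF C] by blast
  define F where "F w = indicator {\<alpha>..<\<beta>} (fst w) *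
        (G (fst (snd w), snd (snd w) - fst w * p (fst (snd w))) * (fs w + p (fst (snd w)) * fQ w))" for w
  define D where "D s v = fs (s, fst v, snd v + s * p (fst v)) + p (fst v) * fQ (s, fst v, snd v + s * p (fst v))" for s v
  define H where "H w = indicator {\<alpha>..<\<beta>} (fst w) * (G (snd w) * D (fst w) (snd w))" for w
  have Dm[measurable]: "(\<lambda>w. D (fst w) (snd w)) \<in> borel_measurable borel"
    unfolding D_def by measurable
  have Fm[measurable]: "F \<in> borel_measurable borel" unfolding F_def by measurable
  have Hm[measurable]: "H \<in> borel_measurable borel" unfolding H_def by measurable
  have pB: "\<bar>fs w + p x * fQ w\<bar> \<le> 2 * B" for w x
  proof -
    have "\<bar>p x * fQ w\<bar> \<le> 1 * B" unfolding abs_mult using M(4)[of w] p1[of x] by (intro mult_mono) auto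
    then show ?thesis using M(4)[of w] by linarith
  qed
  have GB: "\<bar>i * (G v * d)\<bar> \<le> 2 * B" if "\<bar>d\<bar> \<le> 2 * B" "\<bar>i\<bar> \<le> 1" for i v d
  proof -
    have "\<bar>i\<bar> * (\<bar>G v\<bar> * \<bar>d\<bar>) \<le> 1 * (1 * (2 * B))"
      using that GK[of v] M(2) by (intro mult_mono) auto
    then show ?thesis by (simp add: abs_mult)
  qed
  have iF: "integrable (lborel \<Otimes>\<^sub>M lborel) F"
    unfolding lborel_prod
  proof (rule integrable_bounded_support)
    show "bounded (cball 0 M :: (real \<times> real \<times> real) set)" by simp
    show "F w = 0" if "w \<notin> cball 0 M" for w using that M(3)[of w] by (auto simp: F_def)
    show "\<bar>F w\<bar> \<le> 2 * B" for w unfolding F_def by (rule GB[OF pB]) (auto simp: indicator_def)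
  qed simp
  have iH: "integrable (lborel \<Otimes>\<^sub>M lborel) H"
    unfolding lborel_prod
  proof (rule integrable_bounded_support)
    \<comment> \<open>On the support \<open>s\<close> is at most \<open>M\<close> in modulus, so
      undoing the shear moves \<open>Q\<close> by at most another \<open>M\<close>.\<close>
    let ?S = "cball (0::real) M \<times> cball (0::real) M \<times> cball (0::real) (M + M)"
    show "bounded ?S" by (intro bounded_Times) auto
    show "H w = 0" if "w \<notin> ?S" for w
    proof -
      obtain s P Q where w: "w = (s, P, Q)" by (metis prod_cases3)
      have "M < norm (s, P, Q + s * p P)"
      proof (rule ccontr)
        assume "\<not> ?thesis"
        then have n: "norm (s, P, Q + s * p P) \<le> M" by simp
        then have "\<bar>s\<bar> \<le> M" using norm_fst_le[of s "(P, Q + s * p P)"] by simp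
        have n2: "norm (P, Q + s * p P) \<le> M" using n norm_snd_le[of "(P, Q + s * p P)" s] by linarith
        then have "\<bar>P\<bar> \<le> M" using norm_fst_le[of P "Q + s * p P"] by simp
        have "\<bar>Q + s * p P\<bar> \<le> M" using n2 norm_snd_le[of "Q + s * p P" P] by simp
        moreover have "\<bar>s * p P\<bar> \<le> M * 1" unfolding abs_mult using \<open>\<bar>s\<bar> \<le> M\<close> p1[of P] M(1) by (intro mult_mono) auto
        ultimately have "\<bar>Q\<bar> \<le> M + M" by linarith
        with \<open>\<bar>s\<bar> \<le> M\<close> \<open>\<bar>P\<bar> \<le> M\<close> that w show False by (auto simp: mem_Times_iff)
      qed
      then show ?thesis using M(3) by (simp add: H_def D_def w)
    qed
    show "\<bar>H w\<bar> \<le> 2 * B" for w unfolding H_def D_def by (rule GB[OF pB]) (auto simp: indicator_def)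
  qed simp
  have "(LINT w|lborel. F w) = (LINT s|lborel. LINT v|lborel. F (s, v))"
    using lborel_pair.integral_fst'[OF iF] by (simp add: lborel_prod)
  also have "\<dots> = (LINT s|lborel. LINT v|lborel. H (s, v))"
  proof (rule Bochner_Integration.integral_cong[OF refl])
    fix s
    have "(LINT v|lborel. F (s, v)) = (LINT v|lborel. F (s, fst v, snd v + s * p (fst v)))"
      using integral_shear[of "\<lambda>x. s * p x" "\<lambda>v. F (s, v)"] by simp
    also have "(\<lambda>v. F (s, fst v, snd v + s * p (fst v))) = (\<lambda>v. H (s, v))"
      by (auto simp: F_def H_def D_def fun_eq_iff)
    finally show "(LINT v|lborel. F (s, v)) = (LINT v|lborel. H (s, v))" .
  qed
  also have "\<dots> = (LINT v|lborel. LINT s|lborel. H (s, v))"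
    by (rule lborel_pair.Fubini_integral[symmetric]) (use iH in simp)
  also have "\<dots> = (LINT v|lborel. G v * f (\<beta>, fst v, snd v + \<beta> * p (fst v)) - G v * f (\<alpha>, fst v, snd v + \<alpha> * p (fst v)))"
  proof (rule Bochner_Integration.integral_cong[OF refl])
    fix v
    let ?g = "\<lambda>s. f (s, fst v, snd v + s * p (fst v))"
    have der: "(?g has_real_derivative D s v) (at s)" for s
    proof -
      have 1: "((\<lambda>s. (s, fst v, snd v + s * p (fst v))) has_derivative (\<lambda>h. (h, 0, h * p (fst v)))) (at s)"
        by (auto intro!: derivative_eq_intros)
      have "(f has_derivative (\<lambda>h. fst h * fs w + fst (snd h) * fP w + snd (snd h) * fQ w)) (at w)" for w
        using C unfolding C1c_def by blast
      from diff_chain_at[OF 1 this, unfolded comp_def]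
      show ?thesis unfolding has_field_derivative_def
        by (rule has_derivative_eq_rhs) (simp add: fun_eq_iff D_def algebra_simps)
    qed
    have cont: "continuous_on UNIV (\<lambda>s. D s v)"
    proof -
      have "continuous_on UNIV fs" "continuous_on UNIV fQ" using C by (auto simp: C1c_def)
      then show ?thesis unfolding D_def
        by (auto intro!: continuous_intros continuous_on_compose2[of UNIV fs] continuous_on_compose2[of UNIV fQ])
    qed
    have "(LINT s|lborel. H (s, v)) = (LINT s|lborel. G v * (D s v * indicator {\<alpha>..\<beta>} s))"
    proof (rule integral_cong_AE)
      show "AE s in lborel. H (s, v) = G v * (D s v * indicator {\<alpha>..\<beta>} s)"
        using AE_lborel_singleton[of \<beta>] by eventually_elim (auto simp: H_def indicator_def)
      show "(\<lambda>s. G v * (D s v * indicator {\<alpha>..\<beta>} s)) \<in> borel_measurable lborel"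
        using borel_measurable_continuous_onI[OF cont] by measurable
    qed simp
    also have "\<dots> = G v * (LINT s|lborel. D s v * indicator {\<alpha>..\<beta>} s)" by simp
    also have "(LINT s|lborel. D s v * indicator {\<alpha>..\<beta>} s) = ?g \<beta> - ?g \<alpha>"
      by (rule integral_FTC_Icc_real) (use der cont \<open>\<alpha> \<le> \<beta>\<close> in \<open>auto intro: continuous_on_interior[of UNIV]\<close>)
    finally show "(LINT s|lborel. H (s, v)) = G v * ?g \<beta> - G v * ?g \<alpha>" by (simp add: algebra_simps)
  qed
  also have "\<dots> = (LINT v|lborel. G v * f (\<beta>, fst v, snd v + \<beta> * p (fst v))) - (LINT v|lborel. G v * f (\<alpha>, fst v, snd v + \<alpha> * p (fst v)))"
  proof (rule Bochner_Integration.integral_diff)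
    have "integrable lborel (\<lambda>v. G v * f (r, fst v, snd v + r * p (fst v)))" for r
    proof (rule integrable_bounded_support)
      let ?S = "cball (0::real) M \<times> cball (0::real) (M + \<bar>r\<bar>)"
      show "bounded ?S" by (intro bounded_Times) auto
      show "G v * f (r, fst v, snd v + r * p (fst v)) = 0" if "v \<notin> ?S" for v
      proof -
        have "M < norm (r, fst v, snd v + r * p (fst v))"
        proof (rule ccontr)
          let ?n = "(fst v, snd v + r * p (fst v))"
          assume "\<not> ?thesis"
          then have n2: "norm ?n \<le> M" using norm_snd_le[of ?n r] by simp
          then have "\<bar>fst v\<bar> \<le> M" "\<bar>snd v + r * p (fst v)\<bar> \<le> M"
            using norm_fst_le[of "fst v" "snd v + r * p (fst v)"] norm_snd_le[of "snd v + r * p (fst v)" "fst v"] by simp_all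
          moreover have "\<bar>r * p (fst v)\<bar> \<le> \<bar>r\<bar> * 1" unfolding abs_mult using p1 by (intro mult_mono) auto
          ultimately show False using that by (auto simp: mem_Times_iff)
        qed
        then show ?thesis using M(3) by simp
      qed
      show "\<bar>G v * f (r, fst v, snd v + r * p (fst v))\<bar> \<le> 1 * B" for v
        unfolding abs_mult using GK M by (intro mult_mono) auto
    qed measurable
    then show "integrable lborel (\<lambda>v. G v * f (\<beta>, fst v, snd v + \<beta> * p (fst v)))"
      "integrable lborel (\<lambda>v. G v * f (\<alpha>, fst v, snd v + \<alpha> * p (fst v)))" by auto
  qed
  finally have F: "(LINT w|lborel. F w) = (LINT v|lborel. G v * f (\<beta>, fst v, snd v + \<beta> * p (fst v))) -
      (LINT v|lborel. G v * f (\<alpha>, fst v, snd v + \<alpha> * p (fst v)))" .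
  have unshear: "(LINT v|lborel. G v * f (r, fst v, snd v + r * p (fst v))) =
      (LINT v|lborel. G (fst v, snd v - r * p (fst v)) * f (r, v))" for r
    using integral_shear[of "\<lambda>x. r * p x" "\<lambda>v. G (fst v, snd v - r * p (fst v)) * f (r, v)"] by simp
  show ?thesis using F unfolding unshear F_def .
qed

subsection \<open>The transported pattern\<close>

definition vely :: "real \<times> real \<times> real \<Rightarrow> real" where
  "vely w = (if even (lev (fst w)) then 0 else shift (lev (fst w)) (snd (snd w)))"

definition velz :: "real \<times> real \<times> real \<Rightarrow> real" where
  "velz w = (if even (lev (fst w)) then shift (lev (fst w)) (fst (snd w)) else 0)"

text \<open>The displacement is \<open>s * shift\<close>, counted from height 0 and not from the
  bottom of the layer. Within a layer the value is constant along the characteristics of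
  \<open>(1, vely, velz)\<close>, and at the two ends the displacement is a half-period or a full
  period, where \<open>shift_bottom\<close> and \<open>shift_top\<close> apply.\<close>

definition pattern :: "real \<times> real \<times> real \<Rightarrow> real" where
  "pattern w = (if even (lev (fst w))
     then sqw (lev (fst w) + 1) (fst (snd w)) *
       sqw (lev (fst w)) (snd (snd w) - fst w * shift (lev (fst w)) (fst (snd w)))
     else sqw (lev (fst w) + 1) (snd (snd w)) *
       sqw (lev (fst w)) (fst (snd w) - fst w * shift (lev (fst w)) (snd (snd w))))"

text \<open>The value of the pattern at height \<open>2 powi n\<close>, where two layers meet.\<close>

definition interface :: "int \<Rightarrow> real \<times> real \<Rightarrow> real" where
  "interface n v = (if even n then sqw (n - 1) (fst v) * sqw n (snd v)
     else sqw n (fst v) * sqw (n - 1) (snd v))"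

lemma borel_measurable_interface [measurable]: "interface n \<in> borel_measurable borel"
  unfolding interface_def by measurable

lemma abs_interface [simp]: "\<bar>interface n v\<bar> = 1"
  by (simp add: interface_def abs_mult)

lemma borel_measurable_lev_dependent:
  fixes F :: "int \<Rightarrow> real \<times> real \<times> real \<Rightarrow> real"
  assumes [measurable]: "\<And>m. F m \<in> borel_measurable borel"
  shows "(\<lambda>w. F (lev (fst w)) w) \<in> borel_measurable borel"
  by (rule measurable_compose_countable[of F borel borel "\<lambda>w. lev (fst w)"]) measurable

lemma borel_measurable_vely [measurable]: "vely \<in> borel_measurable borel"
  unfolding vely_def[abs_def]
  by (rule borel_measurable_lev_dependent[of "\<lambda>m w. if even m then 0 else shift m (snd (snd w))"]) measurable

lemma borel_measurable_velz [measurable]: "velz \<in> borel_measurable borel"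
  unfolding velz_def[abs_def]
  by (rule borel_measurable_lev_dependent[of "\<lambda>m w. if even m then shift m (fst (snd w)) else 0"]) measurable

lemma borel_measurable_pattern [measurable]: "pattern \<in> borel_measurable borel"
  unfolding pattern_def[abs_def]
  by (rule borel_measurable_lev_dependent[of "\<lambda>m w. if even m
      then sqw (m + 1) (fst (snd w)) * sqw m (snd (snd w) - fst w * shift m (fst (snd w)))
      else sqw (m + 1) (snd (snd w)) * sqw m (fst (snd w) - fst w * shift m (snd (snd w)))"]) measurable

lemma pattern_cases: "pattern w = 1 \<or> pattern w = -1"
  using sqw_cases by (auto simp: pattern_def sqw_def)

lemma abs_vel_le [simp]: "\<bar>vely w\<bar> \<le> 1" "\<bar>velz w\<bar> \<le> 1"
  by (simp_all add: vely_def velz_def)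

text \<open>\<open>X\<close> is the transported function, \<open>G\<close> its profile in
  straightened coordinates and \<open>S\<close> its values on the interfaces. This generality covers
  the pattern and the constant 1 at once. Odd layers are reduced to \<open>layer_integral\<close> by
  exchanging y and z in the test function and in the integral.\<close>

lemma layer_balance:
  fixes X :: "real \<times> real \<times> real \<Rightarrow> real" and S :: "int \<Rightarrow> real \<times> real \<Rightarrow> real"
  assumes C: "C1c f fs fy fz" and [measurable]: "G \<in> borel_measurable borel" and G1: "\<And>v. \<bar>G v\<bar> \<le> 1"
    and X[measurable]: "X \<in> borel_measurable borel"
    and S[measurable]: "S m \<in> borel_measurable borel" "S (m + 1) \<in> borel_measurable borel"
    and even: "even m \<Longrightarrow> (\<forall>s y z. lev s = m \<longrightarrow> X (s, y, z) = G (y, z - s * shift m y)) \<and>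
      (\<forall>y z. S (m + 1) (y, z) = G (y, z - 2 powi (m + 1) * shift m y) \<and> S m (y, z) = G (y, z - 2 powi m * shift m y))"
    and odd: "odd m \<Longrightarrow> (\<forall>s y z. lev s = m \<longrightarrow> X (s, y, z) = G (z, y - s * shift m z)) \<and>
      (\<forall>y z. S (m + 1) (y, z) = G (z, y - 2 powi (m + 1) * shift m z) \<and> S m (y, z) = G (z, y - 2 powi m * shift m z))"
  shows "(LINT w|lborel. indicator {2 powi m..<2 powi (m + 1)} (fst w) *
       (X w * (fs w + vely w * fy w + velz w * fz w))) =
     (LINT v|lborel. S (m + 1) v * f (2 powi (m + 1), v)) - (LINT v|lborel. S m v * f (2 powi m, v))"
proof -
  note [measurable] = C1c_measurable[OF C]
  have le: "(2::real) powi m \<le> 2 powi (m + 1)" by (intro power_int_increasing) auto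
  have sh: "\<And>v. \<bar>shift m v\<bar> \<le> 1" by simp
  show ?thesis
  proof (cases "even m")
    case True
    have "(LINT w|lborel. indicator {2 powi m..<2 powi (m + 1)} (fst w) *
        (X w * (fs w + vely w * fy w + velz w * fz w))) =
      (LINT w|lborel. indicator {2 powi m..<2 powi (m + 1)} (fst w) *
        (G (fst (snd w), snd (snd w) - fst w * shift m (fst (snd w))) * (fs w + shift m (fst (snd w)) * fz w)))"
    proof (rule Bochner_Integration.integral_cong[OF refl])
      fix w :: "real \<times> real \<times> real"
      obtain s y z where w: "w = (s, y, z)" by (metis prod_cases3)
      show "indicator {2 powi m..<2 powi (m + 1)} (fst w) * (X w * (fs w + vely w * fy w + velz w * fz w)) =
          indicator {2 powi m..<2 powi (m + 1)} (fst w) *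
        (G (fst (snd w), snd (snd w) - fst w * shift m (fst (snd w))) * (fs w + shift m (fst (snd w)) * fz w))"
      proof (cases "s \<in> {2 powi m..<2 powi (m + 1)}")
        case s: True
        then have "lev s = m" by (intro lev_eq) auto
        then show ?thesis using even[OF True] True by (simp add: w vely_def velz_def)
      qed (simp add: w)
    qed
    also have "\<dots> = (LINT v|lborel. G (fst v, snd v - 2 powi (m + 1) * shift m (fst v)) * f (2 powi (m + 1), v)) -
      (LINT v|lborel. G (fst v, snd v - 2 powi m * shift m (fst v)) * f (2 powi m, v))"
      by (rule layer_integral[OF C _ G1 _ sh le]) measurable
    also have "\<dots> = (LINT v|lborel. S (m + 1) v * f (2 powi (m + 1), v)) - (LINT v|lborel. S m v * f (2 powi m, v))"
    proof -
      have "S (m + 1) v = G (fst v, snd v - 2 powi (m + 1) * shift m (fst v))"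
        "S m v = G (fst v, snd v - 2 powi m * shift m (fst v))" for v
        using even[OF True] by (cases v, simp)+
      then show ?thesis by (simp only:)
    qed
    finally show ?thesis .
  next
    case False
    let ?g = "f \<circ> swap3" let ?gs = "fs \<circ> swap3" let ?gy = "fz \<circ> swap3" let ?gz = "fy \<circ> swap3"
    have C': "C1c ?g ?gs ?gy ?gz" by (rule C1c_swap3[OF C])
    let ?F = "\<lambda>w. indicator {2 powi m..<2 powi (m + 1)} (fst w) * (X w * (fs w + vely w * fy w + velz w * fz w))"
    have "(LINT w|lborel. ?F w) = (LINT w|lborel. ?F (swap3 w))"
      by (rule integral_swap3[symmetric]) measurable
    also have "\<dots> = (LINT w|lborel. indicator {2 powi m..<2 powi (m + 1)} (fst w) *
        (G (fst (snd w), snd (snd w) - fst w * shift m (fst (snd w))) * (?gs w + shift m (fst (snd w)) * ?gz w)))"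
    proof (rule Bochner_Integration.integral_cong[OF refl])
      fix w :: "real \<times> real \<times> real"
      obtain s y z where w: "w = (s, y, z)" by (metis prod_cases3)
      show "?F (swap3 w) =
          indicator {2 powi m..<2 powi (m + 1)} (fst w) *
        (G (fst (snd w), snd (snd w) - fst w * shift m (fst (snd w))) * (?gs w + shift m (fst (snd w)) * ?gz w))"
      proof (cases "s \<in> {2 powi m..<2 powi (m + 1)}")
        case s: True
        then have "lev s = m" by (intro lev_eq) auto
        then show ?thesis using odd[OF False] False by (simp add: w vely_def velz_def swap3_def)
      qed (simp add: w swap3_def)
    qed
    also have "\<dots> = (LINT v|lborel. G (fst v, snd v - 2 powi (m + 1) * shift m (fst v)) * ?g (2 powi (m + 1), v)) -
      (LINT v|lborel. G (fst v, snd v - 2 powi m * shift m (fst v)) * ?g (2 powi m, v))"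
      by (rule layer_integral[OF C' _ G1 _ sh le]) measurable
    also have "(LINT v|lborel. G (fst v, snd v - 2 powi (m + 1) * shift m (fst v)) * ?g (2 powi (m + 1), v)) =
        (LINT v|lborel. S (m + 1) v * f (2 powi (m + 1), v))"
    proof -
      have "(LINT v|lborel. S (m + 1) v * f (2 powi (m + 1), v)) =
          (LINT v|lborel. S (m + 1) (snd v, fst v) * f (2 powi (m + 1), snd v, fst v))"
        using lborel_pair.integral_product_swap[of "\<lambda>v. S (m + 1) v * f (2 powi (m + 1), v)"]
        by (simp add: lborel_prod case_prod_beta')
      then show ?thesis using odd[OF False] by (simp add: swap3_def)
    qed
    also have "(LINT v|lborel. G (fst v, snd v - 2 powi m * shift m (fst v)) * ?g (2 powi m, v)) =
        (LINT v|lborel. S m v * f (2 powi m, v))"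
    proof -
      have "(LINT v|lborel. S m v * f (2 powi m, v)) =
          (LINT v|lborel. S m (snd v, fst v) * f (2 powi m, snd v, fst v))"
        using lborel_pair.integral_product_swap[of "\<lambda>v. S m v * f (2 powi m, v)"]
        by (simp add: lborel_prod case_prod_beta')
      then show ?thesis using odd[OF False] by (simp add: swap3_def)
    qed
    finally show ?thesis .
  qed
qed

text \<open>\<open>shift_top\<close> and \<open>shift_bottom\<close> identify the values at the two
  ends with \<open>interface\<close>. A layer and the one below it thus see the same function on
  their common interface, which lets the balances telescope.\<close>

lemma pattern_layer_balance:
  assumes C: "C1c f fs fy fz"
  shows "(LINT w|lborel. indicator {2 powi m..<2 powi (m + 1)} (fst w) *
       (pattern w * (fs w + vely w * fy w + velz w * fz w))) =
     (LINT v|lborel. interface (m + 1) v * f (2 powi (m + 1), v)) - (LINT v|lborel. interface m v * f (2 powi m, v))"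
  by (rule layer_balance[OF C, where G="\<lambda>v. sqw (m + 1) (fst v) * sqw m (snd v)"])
    (auto simp: abs_mult pattern_def interface_def shift_top shift_bottom mult.commute[of "sqw m _" "sqw (m-1) _"] mult.commute[of "sqw m _" "sqw (m+1) _"])

lemma unit_layer_balance:
  assumes C: "C1c f fs fy fz"
  shows "(LINT w|lborel. indicator {2 powi m..<2 powi (m + 1)} (fst w) *
       (1 * (fs w + vely w * fy w + velz w * fz w))) =
     (LINT v|lborel. 1 * f (2 powi (m + 1), v)) - (LINT v|lborel. 1 * f (2 powi m, v))"
  by (rule layer_balance[OF C, where G="\<lambda>v. 1" and X="\<lambda>_. 1" and S="\<lambda>_ _. 1"]) auto

lemma abs_pattern [simp]: "\<bar>pattern w\<bar> = 1"
  using pattern_cases[of w] by auto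

text \<open>The layer balances telescope between height \<open>2 powi (- int k)\<close> and a height
  \<open>2 ^ N\<close> above the support of \<open>f\<close>, where the upper term vanishes.
  Dominated convergence in \<open>k\<close> leaves minus the limit of the lower slices. That limit
  is a hypothesis because it comes from oscillation for the pattern and from continuity for the
  constant 1.\<close>

lemma transport_balance:
  fixes X :: "real \<times> real \<times> real \<Rightarrow> real" and S :: "int \<Rightarrow> real \<times> real \<Rightarrow> real"
  assumes C: "C1c f fs fy fz"
    and X[measurable]: "X \<in> borel_measurable borel" and X1: "\<And>w. \<bar>X w\<bar> \<le> 1"
    and layer: "\<And>m. (LINT w|lborel. indicator {2 powi m..<2 powi (m + 1)} (fst w) *
         (X w * (fs w + vely w * fy w + velz w * fz w))) =
       (LINT v|lborel. S (m + 1) v * f (2 powi (m + 1), v)) - (LINT v|lborel. S m v * f (2 powi m, v))"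
    and lim: "(\<lambda>k. LINT v|lborel. S (- int k) v * f (2 powi (- int k), v)) \<longlonglongrightarrow> l"
  shows "(LINT w|lborel. indicator {0<..} (fst w) * (X w * (fs w + vely w * fy w + velz w * fz w))) = - l"
proof -
  note [measurable] = C1c_measurable[OF C]
  obtain M B where M: "0 \<le> M" "0 \<le> B"
    "\<And>w. M < norm w \<Longrightarrow> f w = 0 \<and> fs w = 0 \<and> fy w = 0 \<and> fz w = 0"
    "\<And>w. \<bar>f w\<bar> \<le> B \<and> \<bar>fs w\<bar> \<le> B \<and> \<bar>fy w\<bar> \<le> B \<and> \<bar>fz w\<bar> \<le> B"
    using C1c_bounds[OF C] by blast
  define L where "L w = X w * (fs w + vely w * fy w + velz w * fz w)" for w
  have Lm[measurable]: "L \<in> borel_measurable borel" unfolding L_def by measurable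
  have L0: "L w = 0" if "M < norm w" for w using M(3)[OF that] by (simp add: L_def)
  have LB: "\<bar>L w\<bar> \<le> 3 * B" for w
  proof -
    have "\<bar>vely w * fy w\<bar> \<le> 1 * B" "\<bar>velz w * fz w\<bar> \<le> 1 * B"
      unfolding abs_mult using M(2) M(4)[of w] by (intro mult_mono; simp)+
    then have "\<bar>fs w + vely w * fy w + velz w * fz w\<bar> \<le> 3 * B" using M(4)[of w] by linarith
    then have "\<bar>X w\<bar> * \<bar>fs w + vely w * fy w + velz w * fz w\<bar> \<le> 1 * (3 * B)"
      using X1 M(2) by (intro mult_mono) auto
    then show ?thesis by (simp add: L_def abs_mult)
  qed
  have int: "integrable lborel (\<lambda>w. indicator A (fst w) * L w)" if [measurable]: "A \<in> sets borel" for A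
    by (rule integrable_bounded_support[of _ "cball 0 M" "3 * B"])
      (use L0 LB M(2) in \<open>auto simp: indicator_def\<close>)
  let ?J = "\<lambda>m. LINT v|lborel. S m v * f (2 powi m, v)"
  have tele: "(LINT w|lborel. indicator {2 powi m..<2 powi (m + int j)} (fst w) * L w) = ?J (m + int j) - ?J m" for m j
  proof (induction j)
    case (Suc j)
    have le: "(2::real) powi m \<le> 2 powi (m + int j)" "(2::real) powi (m + int j) \<le> 2 powi (m + int j + 1)"
      by (intro power_int_increasing; simp)+
    have e: "m + int (Suc j) = m + int j + 1" by simp
    have "(LINT w|lborel. indicator {2 powi m..<2 powi (m + int (Suc j))} (fst w) * L w) =
      (LINT w|lborel. indicator {2 powi m..<2 powi (m + int j)} (fst w) * L w +
         indicator {2 powi (m + int j)..<2 powi (m + int j + 1)} (fst w) * L w)"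
      unfolding e using le by (intro Bochner_Integration.integral_cong refl) (auto simp: indicator_def)
    also have "\<dots> = (LINT w|lborel. indicator {2 powi m..<2 powi (m + int j)} (fst w) * L w) +
       (LINT w|lborel. indicator {2 powi (m + int j)..<2 powi (m + int j + 1)} (fst w) * L w)"
      by (intro Bochner_Integration.integral_add int) auto
    also have "\<dots> = ?J (m + int (Suc j)) - ?J m"
      unfolding e using Suc layer[of "m + int j"] by (simp add: L_def)
    finally show ?case .
  qed simp
  obtain N :: nat where N: "M < 2 ^ N" using real_arch_pow[of 2 M] by auto
  have top: "?J (int N) = 0"
  proof -
    have "f (2 powi int N, v) = 0" for v
    proof -
      have "M < norm (2 powi int N :: real, v)"
        using N norm_fst_le[of "2 powi int N :: real" v] by simp
      then show ?thesis using M(3) by simp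
    qed
    then show ?thesis by simp
  qed
  have eq: "(LINT w|lborel. indicator {2 powi (- int k)..<2 ^ N} (fst w) * L w) = - ?J (- int k)" for k
    using tele[of "- int k" "k + N"] top by simp
  have "(\<lambda>k. LINT w|lborel. indicator {2 powi (- int k)..<2 ^ N} (fst w) * L w)
      \<longlonglongrightarrow> (LINT w|lborel. indicator {0<..<2 ^ N} (fst w) * L w)"
  proof (rule integral_dominated_convergence[where w="\<lambda>w. indicator UNIV (fst w) * \<bar>L w\<bar>"])
    show "integrable lborel (\<lambda>w. indicator UNIV (fst w) * \<bar>L w\<bar>)"
      using integrable_abs[OF int[of UNIV]] by simp
    show "AE w in lborel. (\<lambda>k. indicator {2 powi (- int k)..<2 ^ N} (fst w) * L w) \<longlonglongrightarrow> indicator {0<..<2 ^ N} (fst w) * L w"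
    proof (rule AE_I2)
      fix w :: "real \<times> real \<times> real"
      have "\<forall>\<^sub>F k in sequentially. indicator {2 powi (- int k)..<2 ^ N} (fst w) * L w = indicator {0<..<2 ^ N} (fst w) * L w"
      proof (cases "0 < fst w")
        case True
        have "(\<lambda>k. (1/2::real) ^ k) \<longlonglongrightarrow> 0" by (intro LIMSEQ_realpow_zero) auto
        then have "\<forall>\<^sub>F k in sequentially. (1/2::real) ^ k < fst w" using True by (rule order_tendstoD)
        then show ?thesis
          by eventually_elim (use True in \<open>auto simp: indicator_def power_int_minus power_one_over inverse_eq_divide\<close>)
      next
        case False
        have "0 < (2::real) powi (- int k)" for k by simp
        then have "\<not> 2 powi (- int k) \<le> fst w" for k using False by (meson le_less_trans not_le order_less_le_trans)
        then show ?thesis using False by (auto simp: indicator_def)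
      qed
      then show "(\<lambda>k. indicator {2 powi (- int k)..<2 ^ N} (fst w) * L w) \<longlonglongrightarrow> indicator {0<..<2 ^ N} (fst w) * L w"
        by (rule tendsto_eventually)
    qed
  qed (auto simp: indicator_def)
  then have "(\<lambda>k. - ?J (- int k)) \<longlonglongrightarrow> (LINT w|lborel. indicator {0<..<2 ^ N} (fst w) * L w)"
    unfolding eq .
  then have "(LINT w|lborel. indicator {0<..<2 ^ N} (fst w) * L w) = - l"
    using tendsto_minus[OF lim] LIMSEQ_unique by blast
  moreover have "indicator {0<..<2 ^ N} (fst w) * L w = indicator {0<..} (fst w) * L w" for w
  proof (cases "2 ^ N \<le> fst w")
    case True
    then have "M < norm w" using N norm_fst_le[of "fst w" "snd w"] by simp
    then show ?thesis by (simp add: L0)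
  qed (auto simp: indicator_def)
  ultimately have "(LINT w|lborel. indicator {0<..} (fst w) * L w) = - l" by (simp only:)
  then show ?thesis by (simp only: L_def)
qed

lemma C1c_isCont: "C1c f fs fy fz \<Longrightarrow> isCont f w"
  unfolding C1c_def using continuous_on_eq_continuous_at open_UNIV by blast

text \<open>The offsets \<open>a\<close> and \<open>b\<close> provide for the half-period shift of
  the test function in \<open>interface_tendsto_0\<close>.\<close>

lemma slice_integrable:
  assumes C: "C1c f fs fy fz" and [measurable]: "S \<in> borel_measurable borel" and S1: "\<And>v. \<bar>S v\<bar> \<le> 1"
  shows "integrable lborel (\<lambda>v. S v * f (r, fst v + a, snd v + b))"
proof -
  note [measurable] = C1c_measurable[OF C]
  obtain M B where M: "0 \<le> M" "0 \<le> B" "\<And>w. M < norm w \<Longrightarrow> f w = 0" "\<And>w. \<bar>f w\<bar> \<le> B"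
    using C1c_bounds[OF C] by metis
  show ?thesis
  proof (rule integrable_bounded_support)
    show "bounded (cball (-(a, b)) M)" by simp
    show "S v * f (r, fst v + a, snd v + b) = 0" if "v \<notin> cball (-(a, b)) M" for v
    proof -
      have "M < norm (fst v + a, snd v + b)"
      proof -
        have "- (a, b) - v = - (fst v + a, snd v + b)" by (simp add: prod_eq_iff)
        then show ?thesis using that by (simp only: mem_cball dist_norm norm_minus_cancel not_le)
      qed
      then have "M < norm (r, fst v + a, snd v + b)" using norm_snd_le[of "(fst v + a, snd v + b)" r] by simp
      then show ?thesis using M(3) by simp
    qed
    show "\<bar>S v * f (r, fst v + a, snd v + b)\<bar> \<le> 1 * B" for v
      unfolding abs_mult using S1 M by (intro mult_mono) auto
  qed measurable
qed

text \<open>Shifting by half a period flips the sign of the interface pattern, so its integral against \<open>f\<close>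
  is at most half the variation of \<open>f\<close> over that shift.\<close>

lemma interface_tendsto_0:
  assumes C: "C1c f fs fy fz"
  shows "(\<lambda>k. LINT v|lborel. interface (- int k) v * f (2 powi (- int k), v)) \<longlonglongrightarrow> 0"
proof -
  note [measurable] = C1c_measurable[OF C]
  obtain M B where M: "0 \<le> M" "0 \<le> B" "\<And>w. M < norm w \<Longrightarrow> f w = 0" "\<And>w. \<bar>f w\<bar> \<le> B"
    using C1c_bounds[OF C] by metis
  \<comment> \<open>The half-period of the z-factor of \<open>interface (- int k)\<close>, which is
    \<open>sqw (- int k)\<close> for even \<open>k\<close> and \<open>sqw (- int k - 1)\<close> for
    odd \<open>k\<close>.\<close>
  define d where "d k = (if even k then (2::real) powi (- int k) else 2 powi (- int k - 1))" for k :: nat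
  have flip: "interface (- int k) (y, z + d k) = - interface (- int k) (y, z)" for k y z
    by (simp add: interface_def d_def sqw_add_half_period)
  have d1: "0 \<le> d k \<and> d k \<le> 2 powi (- int k)" for k
    using power_int_increasing[of "- int k - 1" "- int k" "2::real"] by (simp add: d_def)
  have p0: "(\<lambda>k. (2::real) powi (- int k)) \<longlonglongrightarrow> 0"
    using LIMSEQ_realpow_zero[of "1/2::real"] by (simp add: power_int_minus power_one_over inverse_eq_divide)
  have p1: "(2::real) powi (- int k) \<le> 1" for k
    using power_int_increasing[of "- int k" 0 "2::real"] by simp
  have d0: "d \<longlonglongrightarrow> 0"
    by (rule tendsto_sandwich[OF _ _ tendsto_const p0]) (use d1 in auto)
  define g where "g k v = f (2 powi (- int k), v) - f (2 powi (- int k), fst v, snd v + d k)" for k v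
  have gm[measurable]: "g k \<in> borel_measurable borel" for k unfolding g_def by measurable
  have twice: "2 * (LINT v|lborel. interface (- int k) v * f (2 powi (- int k), v)) =
      (LINT v|lborel. interface (- int k) v * g k v)" for k
  proof -
    let ?S = "interface (- int k)" let ?r = "2 powi (- int k) :: real"
    have "(LINT v|lborel. ?S v * f (?r, v)) = (LINT v|lborel. ?S (fst v, snd v + d k) * f (?r, fst v, snd v + d k))"
      using integral_shear[of "\<lambda>_. d k" "\<lambda>v. ?S v * f (?r, v)"] by simp
    also have "\<dots> = - (LINT v|lborel. ?S v * f (?r, fst v, snd v + d k))"
      by (simp add: flip)
    finally have "2 * (LINT v|lborel. ?S v * f (?r, v)) =
        (LINT v|lborel. ?S v * f (?r, v)) - (LINT v|lborel. ?S v * f (?r, fst v, snd v + d k))" by simp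
    also have "\<dots> = (LINT v|lborel. ?S v * f (?r, v) - ?S v * f (?r, fst v, snd v + d k))"
      using slice_integrable[OF C, of ?S ?r 0 0] slice_integrable[OF C, of ?S ?r 0 "d k"]
      by (intro Bochner_Integration.integral_diff[symmetric]) auto
    finally show ?thesis by (simp add: g_def algebra_simps)
  qed
  have "(\<lambda>k. LINT v|lborel. interface (- int k) v * g k v) \<longlonglongrightarrow> (LINT v::real \<times> real|lborel. (0::real))"
  proof (rule integral_dominated_convergence[where w="\<lambda>v. 2 * B * indicator (cball (0::real) M \<times> cball (0::real) (M + 1)) v"])
    \<comment> \<open>Since \<open>d k\<close> is at most 1, the shifted slice leaves the radius
      \<open>M\<close> in the second coordinate by at most 1.\<close>
    let ?Q = "cball (0::real) M \<times> cball (0::real) (M + 1)"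
    show "integrable lborel (\<lambda>v. 2 * B * indicator ?Q v)"
      by (rule integrable_bounded_support[of _ ?Q "2 * B"])
        (use M(2) in \<open>auto simp: indicator_def borel_prod[symmetric] intro!: bounded_Times\<close>)
    have small: "\<bar>g k v\<bar> \<le> 2 * B * indicator ?Q v" for k v
    proof (cases "v \<in> ?Q")
      case True
      then show ?thesis using M(4)[of "(2 powi (- int k), v)"] M(4)[of "(2 powi (- int k), fst v, snd v + d k)"]
        by (simp add: g_def)
    next
      case False
      have "M < norm v \<and> M < norm (fst v, snd v + d k)"
      proof -
        have "M < \<bar>fst v\<bar> \<or> M + 1 < \<bar>snd v\<bar>" using False by (auto simp: mem_Times_iff)
        moreover have "\<bar>fst v\<bar> \<le> norm v" "\<bar>snd v\<bar> \<le> norm v"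
          using norm_fst_le[of "fst v" "snd v"] norm_snd_le[of "snd v" "fst v"] by simp_all
        moreover have "\<bar>fst v\<bar> \<le> norm (fst v, snd v + d k)" "\<bar>snd v + d k\<bar> \<le> norm (fst v, snd v + d k)"
          using norm_fst_le[of "fst v" "snd v + d k"] norm_snd_le[of "snd v + d k" "fst v"] by simp_all
        moreover have "\<bar>d k\<bar> \<le> 1" using d1[of k] p1[of k] by simp
        ultimately show ?thesis by linarith
      qed
      then have "M < norm (2 powi (- int k) :: real, v)" "M < norm (2 powi (- int k) :: real, fst v, snd v + d k)"
        by (meson less_le_trans norm_snd_le)+
      then show ?thesis using M(3) by (simp add: g_def False)
    qed
    then show "AE v in lborel. norm (interface (- int k) v * g k v) \<le> 2 * B * indicator ?Q v" for k
      by (simp add: abs_mult)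
    show "AE v in lborel. (\<lambda>k. interface (- int k) v * g k v) \<longlonglongrightarrow> 0"
    proof (rule AE_I2)
      fix v :: "real \<times> real"
      have fl: "isCont f w" for w by (rule C1c_isCont[OF C])
      have "(\<lambda>k. f (2 powi (- int k), v)) \<longlonglongrightarrow> f (0, v)"
        by (rule isCont_tendsto_compose[OF fl]) (intro tendsto_intros p0)
      moreover have "(\<lambda>k. f (2 powi (- int k), fst v, snd v + d k)) \<longlonglongrightarrow> f (0, fst v, snd v + 0)"
        by (rule isCont_tendsto_compose[OF fl]) (intro tendsto_intros p0 d0)
      ultimately have "(\<lambda>k. g k v) \<longlonglongrightarrow> f (0, v) - f (0, fst v, snd v + 0)"
        unfolding g_def by (rule tendsto_diff)
      then have "(\<lambda>k. g k v) \<longlonglongrightarrow> 0" by simp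
      then have "(\<lambda>k. \<bar>g k v\<bar>) \<longlonglongrightarrow> 0" by (rule tendsto_rabs_zero)
      then have "(\<lambda>k. \<bar>interface (- int k) v * g k v\<bar>) \<longlonglongrightarrow> 0" by (simp add: abs_mult)
      then show "(\<lambda>k. interface (- int k) v * g k v) \<longlonglongrightarrow> 0" by (rule tendsto_rabs_zero_cancel)
    qed
  qed auto
  then have "(\<lambda>k. 2 * (LINT v|lborel. interface (- int k) v * f (2 powi (- int k), v))) \<longlonglongrightarrow> 0"
    unfolding twice by simp
  from tendsto_mult_left[OF this, of "1/2"] show ?thesis by simp
qed

lemma slice_tendsto:
  assumes C: "C1c f fs fy fz"
  shows "(\<lambda>k. LINT v|lborel. 1 * f (2 powi (- int k), v)) \<longlonglongrightarrow> (LINT v|lborel. f (0, v))"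
proof -
  note [measurable] = C1c_measurable[OF C]
  obtain M B where M: "0 \<le> M" "0 \<le> B" "\<And>w. M < norm w \<Longrightarrow> f w = 0" "\<And>w. \<bar>f w\<bar> \<le> B"
    using C1c_bounds[OF C] by metis
  have p0: "(\<lambda>k. (2::real) powi (- int k)) \<longlonglongrightarrow> 0"
    using LIMSEQ_realpow_zero[of "1/2::real"] by (simp add: power_int_minus power_one_over inverse_eq_divide)
  show ?thesis
  proof (rule integral_dominated_convergence[where w="\<lambda>v. B * indicator (cball (0::real \<times> real) M) v"])
    show "integrable lborel (\<lambda>v. B * indicator (cball (0::real \<times> real) M) v)"
      by (rule integrable_bounded_support[of _ "cball 0 M" B]) (use M(2) in \<open>auto simp: indicator_def\<close>)
    show "AE v in lborel. norm (1 * f (2 powi (- int k), v)) \<le> B * indicator (cball (0::real \<times> real) M) v" for k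
    proof (rule AE_I2)
      fix v :: "real \<times> real"
      show "norm (1 * f (2 powi (- int k), v)) \<le> B * indicator (cball (0::real \<times> real) M) v"
      proof (cases "norm v \<le> M")
        case False
        then have "M < norm (2 powi (- int k) :: real, v)" using norm_snd_le[of v "2 powi (- int k) :: real"] by simp
        then show ?thesis using M(3) False by simp
      qed (use M(4) in simp)
    qed
    show "AE v in lborel. (\<lambda>k. 1 * f (2 powi (- int k), v)) \<longlonglongrightarrow> f (0, v)"
    proof (rule AE_I2)
      fix v :: "real \<times> real"
      have fl: "isCont f w" for w by (rule C1c_isCont[OF C])
      have "(\<lambda>k. f (2 powi (- int k), v)) \<longlonglongrightarrow> f (0, v)"
        by (rule isCont_tendsto_compose[OF fl]) (intro tendsto_intros p0)
      then show "(\<lambda>k. 1 * f (2 powi (- int k), v)) \<longlonglongrightarrow> f (0, v)" by simp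
    qed
  qed auto
qed

text \<open>The interface values oscillate ever faster towards the boundary, so no boundary term
  survives although the pattern has modulus 1 everywhere.\<close>

lemma pattern_transport:
  assumes "C1c f fs fy fz"
  shows "(LINT w|lborel. indicator {0<..} (fst w) * (pattern w * (fs w + vely w * fy w + velz w * fz w))) = 0"
  using transport_balance[OF assms _ _ pattern_layer_balance[OF assms] interface_tendsto_0[OF assms]]
  by simp

lemma unit_transport:
  assumes "C1c f fs fy fz"
  shows "(LINT w|lborel. indicator {0<..} (fst w) * (1 * (fs w + vely w * fy w + velz w * fz w)))
    = - (LINT v|lborel. f (0, v))"
  by (rule transport_balance[OF assms _ _ unit_layer_balance[OF assms] slice_tendsto[OF assms]]) auto

subsection \<open>The vector field\<close>

definition coords :: "real^3 \<Rightarrow> real \<times> real \<times> real" where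
  "coords x = (x $ 1, x $ 2, x $ 3)"

lemma coords_v3 [simp]: "coords (v3 w) = w"
  by (simp add: coords_def)

lemma borel_measurable_coords [measurable]: "coords \<in> borel_measurable borel"
  unfolding coords_def by (intro borel_measurable_continuous_onI continuous_intros)

text \<open>The scalar factor is 1 on \<open>pattern = 1\<close> and \<open>- (1 + 2 * c)\<close> on
  \<open>pattern = -1\<close>, with mean \<open>- c\<close>. The field does not depend on
  time.\<close>

definition field :: "real \<Rightarrow> real^3 \<Rightarrow> real^3" where
  "field c x = ((1 + c) * pattern (coords x) - c) *\<^sub>R v3 (1, vely (coords x), velz (coords x))"

lemma borel_measurable_field [measurable]: "field c \<in> borel_measurable borel"
  unfolding field_def by measurable

lemma field_component_bound:
  assumes "0 < c" shows "\<bar>field c x $ i\<bar> \<le> 1 + 2 * c"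
proof -
  have "\<bar>(1 + c) * pattern (coords x) - c\<bar> \<le> 1 + 2 * c"
    using pattern_cases[of "coords x"] assms by auto
  moreover have "\<bar>v3 (1, vely (coords x), velz (coords x)) $ i\<bar> \<le> 1"
    using exhaust_3[of i] by auto
  ultimately have "\<bar>(1 + c) * pattern (coords x) - c\<bar> * \<bar>v3 (1, vely (coords x), velz (coords x)) $ i\<bar> \<le> (1 + 2 * c) * 1"
    by (intro mult_mono) auto
  then show ?thesis by (simp add: field_def abs_mult)
qed

section \<open>Constancy of the field on a dyadic grid\<close>

lemma floor_coarser:
  fixes v v' :: real
  assumes "r \<le> j" "\<lfloor>v / 2 powi r\<rfloor> = \<lfloor>v' / 2 powi r\<rfloor>"
  shows "\<lfloor>v / 2 powi j\<rfloor> = \<lfloor>v' / 2 powi j\<rfloor>"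
proof -
  \<comment> \<open>Floors at the mesh \<open>2 powi j\<close> are integer quotients of the floors
    at the finer mesh \<open>2 powi r\<close>.\<close>
  have "\<lfloor>u / 2 powi j\<rfloor> = \<lfloor>u / 2 powi r\<rfloor> div 2 ^ nat (j - r)" for u :: real
  proof -
    have "(2::real) powi j = 2 powi r * 2 powi (j - r)" by (subst power_int_add[symmetric]) auto
    also have "2 powi (j - r) = real_of_int (2 ^ nat (j - r))" using assms(1) by (simp add: power_int_nonneg_exp)
    finally have "u / 2 powi j = u / 2 powi r / real_of_int (2 ^ nat (j - r))" by simp
    then show ?thesis by (simp only: floor_divide_real_eq_div[of "2 ^ nat (j - r)"] zero_le_power zero_le_numeral)
  qed
  with assms(2) show ?thesis by simp
qed

lemma sqw_coarser:
  "r \<le> j \<Longrightarrow> \<lfloor>v / 2 powi r\<rfloor> = \<lfloor>v' / 2 powi r\<rfloor> \<Longrightarrow> sqw j v = sqw j v'"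
  using floor_coarser[of r j v v'] by (simp add: sqw_def)

text \<open>A positive \<open>s\<close> lies in layer \<open>n\<close> when the floor of
  \<open>s / 2 powi n\<close> is 1, and this floor is determined by the one at the finer
  mesh.\<close>

lemma lev_coarser:
  assumes "2 powi r \<le> s" "\<lfloor>s / 2 powi r\<rfloor> = \<lfloor>s' / 2 powi r\<rfloor>"
  shows "lev s' = lev s" "r \<le> lev s"
proof -
  have "0 < s" using assms(1) by (rule less_le_trans[rotated]) simp
  then have b: "2 powi lev s \<le> s" "s < 2 powi (lev s + 1)" using lev_unique by blast+
  show r: "r \<le> lev s"
  proof (rule ccontr)
    assume "\<not> ?thesis"
    then have "(2::real) powi (lev s + 1) \<le> 2 powi r" by (intro power_int_increasing) auto
    with b assms(1) show False by simp
  qed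
  have "\<lfloor>s / 2 powi lev s\<rfloor> = 1"
    using b by (intro floor_unique) (auto simp: field_simps power_int_add)
  then have "\<lfloor>s' / 2 powi lev s\<rfloor> = 1" using floor_coarser[OF r assms(2)] by simp
  then have "1 \<le> s' / 2 powi lev s" "s' / 2 powi lev s < 2" by (auto simp: floor_eq_iff)
  then show "lev s' = lev s" by (intro lev_eq) (auto simp: field_simps power_int_add)
qed

text \<open>Above height \<open>2 powi (r + 1)\<close> the layer index \<open>n\<close> is at least
  \<open>r + 1\<close>, so the finest wave in use, \<open>sqw (n - 1)\<close>, is still resolved by
  the mesh \<open>2 powi r\<close>. The inclined forms enter because the displacement is 0 or
  exactly \<open>x $ 1\<close>. The height bound is asked of \<open>x\<close> alone, since the first
  floor passes the layer on to \<open>x'\<close>; translated points may thus leave the region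
  considered.\<close>

lemma field_grid:
  assumes r: "2 powi (r + 1) \<le> x $ 1"
    and eq: "\<lfloor>x $ 1 / 2 powi r\<rfloor> = \<lfloor>x' $ 1 / 2 powi r\<rfloor>"
      "\<lfloor>x $ 2 / 2 powi r\<rfloor> = \<lfloor>x' $ 2 / 2 powi r\<rfloor>" "\<lfloor>x $ 3 / 2 powi r\<rfloor> = \<lfloor>x' $ 3 / 2 powi r\<rfloor>"
      "\<lfloor>(x $ 2 - x $ 1) / 2 powi r\<rfloor> = \<lfloor>(x' $ 2 - x' $ 1) / 2 powi r\<rfloor>"
      "\<lfloor>(x $ 3 - x $ 1) / 2 powi r\<rfloor> = \<lfloor>(x' $ 3 - x' $ 1) / 2 powi r\<rfloor>"
  shows "field c x = field c x'"
proof -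
  have l: "lev (x' $ 1) = lev (x $ 1)" "r + 1 \<le> lev (x $ 1)"
    using lev_coarser[OF r floor_coarser[OF _ eq(1)]] by auto
  define n where "n = lev (x $ 1)"
  have n: "lev (x $ 1) = n" "lev (x' $ 1) = n" "r + 1 \<le> n" using l by (auto simp: n_def)
  have r3: "r \<le> n - 1" "r \<le> n" "r \<le> n + 1" using n(3) by auto
  note sc = r3[THEN sqw_coarser, OF eq(2)] r3[THEN sqw_coarser, OF eq(3)]
    r3[THEN sqw_coarser, OF eq(4)] r3[THEN sqw_coarser, OF eq(5)]
  have s: "shift n (x $ 2) = shift n (x' $ 2)" "shift n (x $ 3) = shift n (x' $ 3)"
    unfolding shift_def by (simp_all add: sc)
  have sh: "shift n v = 0 \<or> shift n v = 1" for v by (simp add: shift_def)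
  have "pattern (coords x) = pattern (coords x')"
    using sh[of "x' $ 2"] sh[of "x' $ 3"] unfolding pattern_def coords_def
    by (auto simp: n(1,2) s sc)
  moreover have "vely (coords x) = vely (coords x')" "velz (coords x) = velz (coords x')"
    by (simp_all add: vely_def velz_def coords_def n s)
  ultimately show ?thesis by (simp add: field_def)
qed

subsection \<open>Local bounded variation\<close>

text \<open>For fixed \<open>s\<close> the slice is a rectangle with sides \<open>2 h\<close> and
  \<open>2 M\<close>. The slope \<open>\<kappa>\<close> is 0 for coordinate planes and 1 for the
  inclined ones.\<close>

lemma emeasure_slab_le:
  fixes \<kappa> a M h :: real
  assumes "0 \<le> M" "0 \<le> h"
  defines "A \<equiv> {w :: real \<times> real \<times> real. \<bar>fst w\<bar> \<le> M \<and> \<bar>snd (snd w)\<bar> \<le> M \<and> \<bar>fst (snd w) - \<kappa> * fst w - a\<bar> \<le> h}"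
  shows "A \<in> sets borel" "emeasure lborel A \<le> ennreal (8 * M\<^sup>2 * h)"
proof -
  show Am[measurable]: "A \<in> sets borel" unfolding A_def by measurable
  have A2: "A \<in> sets (lborel \<Otimes>\<^sub>M lborel)" unfolding lborel_prod using Am by simp
  have "emeasure lborel A = emeasure (lborel \<Otimes>\<^sub>M lborel) A" by (simp add: lborel_prod)
  also have "\<dots> = (\<integral>\<^sup>+s. emeasure lborel (Pair s -` A) \<partial>lborel)"
    by (rule lborel.emeasure_pair_measure_alt[OF A2])
  also have "\<dots> = (\<integral>\<^sup>+s. ennreal (4 * M * h) * indicator {-M..M} s \<partial>lborel)"
  proof (rule nn_integral_cong)
    fix s
    show "emeasure lborel (Pair s -` A) = ennreal (4 * M * h) * indicator {-M..M} s"
    proof (cases "\<bar>s\<bar> \<le> M")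
      case True
      then have "Pair s -` A = {\<kappa> * s + a - h..\<kappa> * s + a + h} \<times> {-M..M}"
        by (auto simp: A_def abs_le_iff)
      then have "emeasure lborel (Pair s -` A) = ennreal (2 * h) * ennreal (2 * M)"
        using assms by (simp add: emeasure_lborel_Times)
      then show ?thesis using True assms by (simp add: ennreal_mult'[symmetric] indicator_def abs_le_iff mult_ac)
    next
      case False
      then have "Pair s -` A = {}" by (auto simp: A_def)
      then show ?thesis using False by (auto simp: indicator_def abs_le_iff)
    qed
  qed
  also have "\<dots> = ennreal (4 * M * h) * ennreal (2 * M)"
    using assms by (subst nn_integral_cmult_indicator) auto
  also have "\<dots> = ennreal (8 * M\<^sup>2 * h)"
    using assms by (simp add: ennreal_mult'[symmetric] power2_eq_square mult_ac)
  finally show "emeasure lborel A \<le> ennreal (8 * M\<^sup>2 * h)" by simp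
qed

text \<open>The linear forms of \<open>field_grid\<close>: away from the boundary the field can jump
  only across planes on which one of them is a multiple of the mesh.\<close>

definition grid_forms :: "(real^3 \<Rightarrow> real) set" where
  "grid_forms = {\<lambda>x. x $ 1, \<lambda>x. x $ 2, \<lambda>x. x $ 3, \<lambda>x. x $ 2 - x $ 1, \<lambda>x. x $ 3 - x $ 1}"

lemma grid_form_measurable: "l \<in> grid_forms \<Longrightarrow> l \<in> borel_measurable borel"
  by (auto simp: grid_forms_def)

lemma emeasure_grid_slab_le:
  assumes l: "l \<in> grid_forms" and "0 \<le> M" "0 \<le> h"
  shows "emeasure lborel {x. (\<forall>i. \<bar>x $ i\<bar> \<le> M) \<and> \<bar>l x - a\<bar> \<le> h} \<le> ennreal (8 * M\<^sup>2 * h)"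
proof -
  note [measurable] = grid_form_measurable[OF l]
  let ?A = "\<lambda>\<kappa>. {w :: real \<times> real \<times> real. \<bar>fst w\<bar> \<le> M \<and> \<bar>snd (snd w)\<bar> \<le> M \<and> \<bar>fst (snd w) - \<kappa> * fst w - a\<bar> \<le> h}"
  have Am[measurable]: "?A \<kappa> \<in> sets borel" for \<kappa> by (rule emeasure_slab_le(1)[OF assms(2,3)])
  have meas: "{x. (\<forall>i. \<bar>x $ i\<bar> \<le> M) \<and> \<bar>l x - a\<bar> \<le> h} \<in> sets borel" (is "?X \<in> _") by measurable
  have eX: "emeasure lborel ?X = emeasure lborel (v3 -` ?X)"
    by (subst (1) distr_lborel_v3[symmetric], subst emeasure_distr) (use meas in auto)
  have y: "emeasure lborel (v3 -` ?X) \<le> ennreal (8 * M\<^sup>2 * h)" if "v3 -` ?X \<subseteq> ?A \<kappa>" for \<kappa>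
  proof -
    have "emeasure lborel (v3 -` ?X) \<le> emeasure lborel (?A \<kappa>)" using that by (intro emeasure_mono) auto
    also have "\<dots> \<le> ennreal (8 * M\<^sup>2 * h)" by (rule emeasure_slab_le(2)[OF assms(2,3)])
    finally show ?thesis .
  qed
  have z: "emeasure lborel (v3 -` ?X) \<le> ennreal (8 * M\<^sup>2 * h)" if "v3 -` ?X \<subseteq> swap3 -` ?A \<kappa>" for \<kappa>
  proof -
    have "emeasure lborel (v3 -` ?X) \<le> emeasure lborel (swap3 -` ?A \<kappa>)"
      using that measurable_sets[OF borel_measurable_swap3 Am] by (intro emeasure_mono) auto
    also have "\<dots> = emeasure lborel (?A \<kappa>)"
      by (subst (2) distr_lborel_swap3[symmetric], subst emeasure_distr) auto
    also have "\<dots> \<le> ennreal (8 * M\<^sup>2 * h)" by (rule emeasure_slab_le(2)[OF assms(2,3)])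
    finally show ?thesis .
  qed
  have s: "emeasure lborel (v3 -` ?X) \<le> ennreal (8 * M\<^sup>2 * h)" if "l = (\<lambda>x. x $ 1)"
  proof -
    have "v3 -` ?X \<subseteq> {a - h..a + h} \<times> {-M..M} \<times> {-M..M}"
      unfolding that by (auto simp: forall_3 abs_le_iff)
    then have "emeasure lborel (v3 -` ?X) \<le> emeasure lborel ({a - h..a + h} \<times> {-M..M} \<times> {-M..M})"
      by (intro emeasure_mono) (auto simp: borel_Times)
    also have "\<dots> = ennreal (2 * h) * (ennreal (2 * M) * ennreal (2 * M))"
      using assms by (simp add: emeasure_lborel_Times borel_Times)
    also have "\<dots> = ennreal (8 * M\<^sup>2 * h)"
      using assms by (simp add: ennreal_mult'[symmetric] power2_eq_square mult_ac)
    finally show ?thesis .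
  qed
  consider "l = (\<lambda>x. x $ 1)" | "l = (\<lambda>x. x $ 2)" | "l = (\<lambda>x. x $ 3)"
    | "l = (\<lambda>x. x $ 2 - x $ 1)" | "l = (\<lambda>x. x $ 3 - x $ 1)"
    using l unfolding grid_forms_def by blast
  then have "emeasure lborel (v3 -` ?X) \<le> ennreal (8 * M\<^sup>2 * h)" (is ?R)
  proof cases
    case 1 then show ?R by (rule s)
  next
    case 2 show ?R by (rule y[of 0]) (simp add: 2 forall_3 subset_iff)
  next
    case 3 show ?R by (rule z[of 0]) (simp add: 3 forall_3 subset_iff swap3_def)
  next
    case 4 show ?R by (rule y[of 1]) (simp add: 4 forall_3 subset_iff)
  next
    case 5 show ?R by (rule z[of 1]) (simp add: 5 forall_3 subset_iff swap3_def)
  qed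
  then show ?thesis unfolding eX .
qed

lemma floor_jump:
  fixes a b q :: real
  assumes "0 < q" "\<lfloor>a / q\<rfloor> \<noteq> \<lfloor>b / q\<rfloor>"
  shows "\<exists>k::int. \<bar>a - of_int k * q\<bar> \<le> \<bar>a - b\<bar>"
proof (cases "\<lfloor>a / q\<rfloor> < \<lfloor>b / q\<rfloor>")
  case True
  have "a / q < \<lfloor>b / q\<rfloor>" "\<lfloor>b / q\<rfloor> \<le> b / q" using True by (auto simp: floor_less_iff)
  then have "a < \<lfloor>b / q\<rfloor> * q" "\<lfloor>b / q\<rfloor> * q \<le> b" using assms(1) by (simp_all only: pos_divide_less_eq pos_le_divide_eq)
  then show ?thesis by (intro exI[of _ "\<lfloor>b / q\<rfloor>"]) auto
next
  case False
  then have "\<lfloor>b / q\<rfloor> < \<lfloor>a / q\<rfloor>" using assms(2) by simp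
  then have "b / q < \<lfloor>a / q\<rfloor>" "\<lfloor>a / q\<rfloor> \<le> a / q" by (auto simp: floor_less_iff)
  then have "b < \<lfloor>a / q\<rfloor> * q" "\<lfloor>a / q\<rfloor> * q \<le> a" using assms(1) by (simp_all only: pos_divide_less_eq pos_le_divide_eq)
  then show ?thesis by (intro exI[of _ "\<lfloor>a / q\<rfloor>"]) auto
qed

text \<open>If a translation by \<open>h\<close> along an axis changes the field, then by
  \<open>field_grid\<close> one of the forms has crossed a multiple of \<open>q\<close>, so the
  point lies within \<open>h\<close> of one of finitely many planes. Each such slab has measure of
  order \<open>h\<close>.\<close>

lemma field_jump_set:
  assumes U: "\<And>x. x \<in> U \<Longrightarrow> 2 powi (r + 1) \<le> x $ 1" "\<And>x i. x \<in> U \<Longrightarrow> \<bar>x $ i\<bar> \<le> M" and "0 \<le> M"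
    and [measurable]: "U \<in> sets borel"
  shows "\<exists>C\<ge>0. \<forall>h j. 0 < h \<longrightarrow> h \<le> 1 \<longrightarrow>
    emeasure lborel {x \<in> U. field c (x + h *\<^sub>R axis j 1) \<noteq> field c x} \<le> ennreal (C * h)"
proof -
  define q where "q = (2::real) powi r"
  have q: "0 < q" by (simp add: q_def)
  \<comment> \<open>The forms are bounded by \<open>2 * M\<close> on \<open>U\<close>, and the slabs
    have half-width \<open>h \<le> 1\<close>, so only multiples \<open>k * q\<close> of modulus at
    most \<open>2 * M + 1\<close> occur.\<close>
  define Z where "Z = \<lceil>(2 * M + 1) / q\<rceil>"
  define C where "C = real (card (grid_forms \<times> {-Z..Z})) * (8 * M\<^sup>2)"
  have fin: "finite (grid_forms \<times> {-Z..Z})" by (simp add: grid_forms_def)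
  have "emeasure lborel {x \<in> U. field c (x + h *\<^sub>R axis j 1) \<noteq> field c x} \<le> ennreal (C * h)"
    if h: "0 < h" "h \<le> 1" for h j
  proof -
    let ?S = "\<lambda>(l, k::int). {x. (\<forall>i. \<bar>x $ i\<bar> \<le> M) \<and> \<bar>l x - of_int k * q\<bar> \<le> h}"
    have Sm: "?S lk \<in> sets lborel" if "lk \<in> grid_forms \<times> {-Z..Z}" for lk
    proof -
      have [measurable]: "fst lk \<in> borel_measurable borel"
        using that by (auto intro: grid_form_measurable)
      show ?thesis unfolding case_prod_beta by measurable
    qed
    have "{x \<in> U. field c (x + h *\<^sub>R axis j 1) \<noteq> field c x} \<subseteq> (\<Union>lk\<in>grid_forms \<times> {-Z..Z}. ?S lk)"
    proof
      fix x assume "x \<in> {x \<in> U. field c (x + h *\<^sub>R axis j 1) \<noteq> field c x}"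
      then have x: "x \<in> U" "field c x \<noteq> field c (x + h *\<^sub>R axis j 1)" by auto
      let ?x' = "x + h *\<^sub>R axis j 1"
      have "\<exists>l\<in>grid_forms. \<lfloor>l x / q\<rfloor> \<noteq> \<lfloor>l ?x' / q\<rfloor>"
        using x(2) field_grid[OF U(1)[OF x(1)], of ?x' c] unfolding grid_forms_def q_def by auto
      then obtain l where l: "l \<in> grid_forms" "\<lfloor>l x / q\<rfloor> \<noteq> \<lfloor>l ?x' / q\<rfloor>" by auto
      then obtain k where k: "\<bar>l x - of_int k * q\<bar> \<le> \<bar>l x - l ?x'\<bar>" using floor_jump[OF q] by blast
      have "\<bar>l x - l ?x'\<bar> \<le> h"
        using l(1) h exhaust_3[of j] by (auto simp: grid_forms_def axis_def)
      then have k': "\<bar>l x - of_int k * q\<bar> \<le> h" using k by simp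
      have "\<bar>l x\<bar> \<le> 2 * M"
        using l(1) U(2)[OF x(1), of 1] U(2)[OF x(1), of 2] U(2)[OF x(1), of 3] by (auto simp: grid_forms_def)
      then have "\<bar>of_int k * q\<bar> \<le> 2 * M + 1" using k' h by linarith
      then have "\<bar>real_of_int k\<bar> \<le> (2 * M + 1) / q" using q by (simp add: abs_mult field_simps)
      then have "\<bar>k\<bar> \<le> Z" unfolding Z_def by (simp add: le_ceiling_iff)
      then show "x \<in> (\<Union>lk\<in>grid_forms \<times> {-Z..Z}. ?S lk)"
        using l(1) k' U(2)[OF x(1)] by (intro UN_I[of "(l, k)"]) auto
    qed
    then have "emeasure lborel {x \<in> U. field c (x + h *\<^sub>R axis j 1) \<noteq> field c x} \<le>
        emeasure lborel (\<Union>lk\<in>grid_forms \<times> {-Z..Z}. ?S lk)"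
      by (intro emeasure_mono sets.finite_UN fin Sm)
    also have "\<dots> \<le> (\<Sum>lk\<in>grid_forms \<times> {-Z..Z}. emeasure lborel (?S lk))"
      by (rule emeasure_subadditive_finite[OF fin]) (use Sm in auto)
    also have "\<dots> \<le> (\<Sum>lk\<in>grid_forms \<times> {-Z..Z}. ennreal (8 * M\<^sup>2 * h))"
      by (rule sum_mono) (use emeasure_grid_slab_le \<open>0 \<le> M\<close> h in auto)
    also have "\<dots> = ennreal (C * h)"
      using h by (simp add: C_def ennreal_of_nat_eq_real_of_nat ennreal_mult'[symmetric] mult_ac)
    finally show ?thesis .
  qed
  then show ?thesis by (intro exI[of _ C]) (auto simp: C_def)
qed

section \<open>Variation estimates through difference quotients\<close>

lemma dir_deriv_eqI: "(f has_derivative f') (at x) \<Longrightarrow> dir_deriv e f x = f' e"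
  unfolding dir_deriv_def by (simp add: frechet_derivative_at[symmetric])

lemma dir_deriv_outside_supp:
  assumes "x \<notin> supp f" shows "dir_deriv e f x = 0"
proof -
  have "(f has_derivative (\<lambda>_. 0)) (at x)"
  proof (rule has_derivative_transform_within_open[of "\<lambda>_. 0" _ _ _ "- supp f"])
    show "open (- supp f)" by (simp add: supp_def open_Compl)
    show "0 = f y" if "y \<in> - supp f" for y
      using that closure_subset[of "{x. f x \<noteq> 0}"] by (auto simp: supp_def)
  qed (use assms in auto)
  then show ?thesis by (rule dir_deriv_eqI)
qed

lemma supp_outside: "x \<notin> supp f \<Longrightarrow> f x = 0"
  using closure_subset[of "{x. f x \<noteq> 0}"] by (auto simp: supp_def)

lemma has_real_derivative_along:
  fixes \<phi> :: "'a::euclidean_space \<Rightarrow> real"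
  assumes "\<phi> differentiable (at (x + t *\<^sub>R e))"
  shows "((\<lambda>t. \<phi> (x + t *\<^sub>R e)) has_real_derivative dir_deriv e \<phi> (x + t *\<^sub>R e)) (at t)"
proof -
  have 1: "((\<lambda>t. x + t *\<^sub>R e) has_derivative (\<lambda>h. h *\<^sub>R e)) (at t)"
    by (auto intro!: derivative_eq_intros)
  have D: "(\<phi> has_derivative frechet_derivative \<phi> (at (x + t *\<^sub>R e))) (at (x + t *\<^sub>R e))"
    using assms by (rule frechet_derivative_works[THEN iffD1])
  have "frechet_derivative \<phi> (at (x + t *\<^sub>R e)) (h *\<^sub>R e) = dir_deriv e \<phi> (x + t *\<^sub>R e) * h" for h
    using linear_cmul[OF has_derivative_linear[OF D], of h e] by (simp add: dir_deriv_def)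
  with diff_chain_at[OF 1 D] show ?thesis
    unfolding has_field_derivative_def comp_def by (simp add: fun_eq_iff)
qed

lemma integral_translate:
  fixes f :: "'a::euclidean_space \<Rightarrow> real"
  assumes [measurable]: "f \<in> borel_measurable borel"
  shows "(LINT x|lborel. f (a + x)) = (LINT x|lborel. f x)"
  by (subst (2) lborel_distr_plus[of a, symmetric]) (simp add: integral_distr)

text \<open>The derivative is moved from \<open>\<phi>\<close> to \<open>f\<close> at the level of difference quotients.\<close>

lemma integral_dir_deriv_bound:
  fixes f \<phi> :: "'a::euclidean_space \<Rightarrow> real"
  assumes f[measurable]: "f \<in> borel_measurable borel" and fB: "\<And>x. \<bar>f x\<bar> \<le> B"
    and diff: "\<And>x. \<phi> differentiable (at x)" and cont: "continuous_on UNIV (dir_deriv e \<phi>)"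
    and sp: "compact (supp \<phi>)" "supp \<phi> \<subseteq> U" and \<phi>1: "\<And>x. \<bar>\<phi> x\<bar> \<le> 1"
    and U[measurable]: "U \<in> sets borel" "bounded U"
    and est: "\<And>h. 0 < h \<Longrightarrow> h \<le> 1 \<Longrightarrow> emeasure lborel {x \<in> U. f (x + h *\<^sub>R e) \<noteq> f x} \<le> ennreal (C * h)"
    and "0 \<le> C"
  shows "integrable lborel (\<lambda>x. f x * dir_deriv e \<phi> x)"
    "\<bar>LINT x|lborel. f x * dir_deriv e \<phi> x\<bar> \<le> 2 * B * C"
proof -
  let ?D = "dir_deriv e \<phi>"
  have B0: "0 \<le> B" using fB[of undefined] by simp
  have [measurable]: "?D \<in> borel_measurable borel" by (rule borel_measurable_continuous_onI[OF cont])
  have \<phi>c: "continuous_on UNIV \<phi>"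
    by (simp add: continuous_on_eq_continuous_at differentiable_imp_continuous_within diff)
  have [measurable]: "\<phi> \<in> borel_measurable borel" by (rule borel_measurable_continuous_onI[OF \<phi>c])
  obtain R where R: "supp \<phi> \<subseteq> cball 0 R"
    using compact_imp_bounded[OF sp(1)] by (auto simp: bounded_any_center[of _ 0] subset_iff)
  have D0: "?D x = 0" if "R < norm x" for x
    using R that by (intro dir_deriv_outside_supp) auto
  have \<phi>0: "\<phi> x = 0" if "R < norm x" for x
    using R that by (intro supp_outside) auto
  obtain K where K: "0 \<le> K" "\<And>x. \<bar>?D x\<bar> \<le> K"
    using continuous_bounded_of_support[OF cont D0] by blast
  show "integrable lborel (\<lambda>x. f x * ?D x)"
  proof (rule integrable_bounded_support)
    show "f x * ?D x = 0" if "x \<notin> cball 0 R" for x using D0 that by auto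
    show "\<bar>f x * ?D x\<bar> \<le> B * K" for x unfolding abs_mult using fB K by (intro mult_mono B0) auto
  qed auto
  define h where "h n = 1 / real (Suc n)" for n
  have h: "0 < h n" "h n \<le> 1" for n by (auto simp: h_def)
  have h0: "h \<longlonglongrightarrow> 0" unfolding h_def using LIMSEQ_inverse_real_of_nat by (simp add: inverse_eq_divide)
  \<comment> \<open>Backward quotients are taken for \<open>\<phi>\<close>, since the translation
    then produces the forward increment \<open>f (x + h n *\<^sub>R e) - f x\<close> controlled by
    \<open>est\<close>.\<close>
  define g where "g n x = f x * ((\<phi> x - \<phi> (x + (- h n) *\<^sub>R e)) / h n)" for n x
  have gm[measurable]: "g n \<in> borel_measurable borel" for n unfolding g_def by measurable
  have MV: "\<bar>\<phi> x - \<phi> (x + (- h n) *\<^sub>R e)\<bar> \<le> h n * K" for x n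
  proof -
    have "\<exists>z>- h n. z < 0 \<and> \<phi> (x + 0 *\<^sub>R e) - \<phi> (x + (- h n) *\<^sub>R e) = (0 - (- h n)) * ?D (x + z *\<^sub>R e)"
      by (rule MVT2) (use h has_real_derivative_along[OF diff] in auto)
    then obtain z where "\<phi> x - \<phi> (x + (- h n) *\<^sub>R e) = h n * ?D (x + z *\<^sub>R e)" by auto
    then show ?thesis using K(2)[of "x + z *\<^sub>R e"] h[of n] by (simp add: abs_mult)
  qed
  have lim: "(\<lambda>n. LINT x|lborel. g n x) \<longlonglongrightarrow> (LINT x|lborel. f x * ?D x)"
  proof (rule integral_dominated_convergence[where w="\<lambda>x. B * K * indicator (cball 0 (R + norm e)) x"])
    show "integrable lborel (\<lambda>x. B * K * indicator (cball 0 (R + norm e)) x :: real)"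
      by (rule integrable_bounded_support[of _ "cball 0 (R + norm e)" "B * K"])
        (use B0 K(1) in \<open>auto simp: indicator_def\<close>)
    show "AE x in lborel. norm (g n x) \<le> B * K * indicator (cball 0 (R + norm e)) x" for n
    proof (rule AE_I2)
      fix x
      show "norm (g n x) \<le> B * K * indicator (cball 0 (R + norm e)) x"
      proof (cases "norm x \<le> R + norm e")
        case True
        have "\<bar>(\<phi> x - \<phi> (x + (- h n) *\<^sub>R e)) / h n\<bar> \<le> K"
          using MV[of x n] h[of n] by (simp add: field_simps)
        then have "\<bar>f x\<bar> * \<bar>(\<phi> x - \<phi> (x + (- h n) *\<^sub>R e)) / h n\<bar> \<le> B * K"
          using fB by (intro mult_mono B0) auto
        then show ?thesis using True by (simp only: g_def real_norm_def abs_mult) simp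
      next
        case False
        have "norm ((- h n) *\<^sub>R e) \<le> norm e" using h[of n] by (simp add: mult_left_le_one_le)
        moreover have "norm x \<le> norm (x + (- h n) *\<^sub>R e) + norm ((- h n) *\<^sub>R e)"
          using norm_triangle_ineq4[of "x + (- h n) *\<^sub>R e" "(- h n) *\<^sub>R e"] by simp
        ultimately have "R < norm (x + (- h n) *\<^sub>R e)" using False by linarith
        moreover have "R < norm x" using False norm_ge_zero[of e] by linarith
        ultimately have "g n x = 0" using \<phi>0 by (simp only: g_def) simp
        then show ?thesis using B0 K(1) by simp
      qed
    qed
    show "AE x in lborel. (\<lambda>n. g n x) \<longlonglongrightarrow> f x * ?D x"
    proof (rule AE_I2)
      fix x
      have "((\<lambda>t. \<phi> (x + t *\<^sub>R e)) has_real_derivative ?D x) (at 0)"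
        using has_real_derivative_along[of \<phi> x 0 e] diff by simp
      then have D: "((\<lambda>t. (\<phi> (x + t *\<^sub>R e) - \<phi> x) / t) \<longlongrightarrow> ?D x) (at 0)"
        by (simp add: has_field_derivative_iff)
      have "filterlim (\<lambda>n. - h n) (at 0) sequentially"
        unfolding filterlim_at using tendsto_minus[OF h0] h by (auto simp: less_imp_neq[OF h(1), symmetric])
      from filterlim_compose[OF D this]
      have "(\<lambda>n. (\<phi> x - \<phi> (x + (- h n) *\<^sub>R e)) / h n) \<longlonglongrightarrow> ?D x"
        by (rule filterlim_mono_eventually[OF _ order_refl order_refl]) (auto simp: field_simps less_imp_neq[OF h(1), symmetric])
      then show "(\<lambda>n. g n x) \<longlonglongrightarrow> f x * ?D x" unfolding g_def by (intro tendsto_mult_left)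
    qed
  qed auto
  have bound: "\<bar>LINT x|lborel. g n x\<bar> \<le> 2 * B * C" for n
  proof -
    let ?A = "{x \<in> U. f (x + h n *\<^sub>R e) \<noteq> f x}"
    have A[measurable]: "?A \<in> sets borel" by measurable
    have i: "integrable lborel (\<lambda>x. f (x + a) * \<phi> x)" for a
    proof (rule integrable_bounded_support)
      show "f (x + a) * \<phi> x = 0" if "x \<notin> cball 0 R" for x using \<phi>0 that by auto
      show "\<bar>f (x + a) * \<phi> x\<bar> \<le> B * 1" for x unfolding abs_mult using fB \<phi>1 by (intro mult_mono B0) auto
    qed auto
    have i2: "integrable lborel (\<lambda>x. f x * \<phi> (x + a))" for a
    proof (rule integrable_bounded_support)
      show "bounded (cball (-a) R)" by simp
      show "f x * \<phi> (x + a) = 0" if "x \<notin> cball (-a) R" for x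
      proof -
        have "dist (-a) x = norm (x + a)" by (metis add.commute diff_minus_eq_add dist_commute dist_norm)
        then show ?thesis using \<phi>0 that by auto
      qed
      show "\<bar>f x * \<phi> (x + a)\<bar> \<le> B * 1" for x unfolding abs_mult using fB \<phi>1 by (intro mult_mono B0) auto
    qed measurable
    have "h n * (LINT x|lborel. g n x) = (LINT x|lborel. f x * \<phi> x - f x * \<phi> (x + (- h n) *\<^sub>R e))"
      using h(1)[of n] by (subst integral_mult_right_zero[symmetric], intro Bochner_Integration.integral_cong)
        (auto simp: g_def field_simps)
    also have "\<dots> = (LINT x|lborel. f x * \<phi> x) - (LINT x|lborel. f x * \<phi> (x + (- h n) *\<^sub>R e))"
      using i[of 0] i2[of "(- h n) *\<^sub>R e"] by (intro Bochner_Integration.integral_diff) auto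
    \<comment> \<open>Translation invariance acts as a discrete integration by parts. The increment
      of \<open>f\<close> is at most \<open>2 * B\<close> and is supported, together with
      \<open>\<phi>\<close>, on a set of measure at most \<open>C * h n\<close>, so the division by
      \<open>h n\<close> is harmless.\<close>
    also have "(LINT x|lborel. f x * \<phi> (x + (- h n) *\<^sub>R e)) = (LINT x|lborel. f (x + h n *\<^sub>R e) * \<phi> x)"
      by (subst integral_translate[where a="h n *\<^sub>R e", symmetric]) (auto simp: add.commute)
    also have "(LINT x|lborel. f x * \<phi> x) - (LINT x|lborel. f (x + h n *\<^sub>R e) * \<phi> x) =
        (LINT x|lborel. f x * \<phi> x - f (x + h n *\<^sub>R e) * \<phi> x)"
      using i[of 0] i by (intro Bochner_Integration.integral_diff[symmetric]) auto
    finally have eq: "h n * (LINT x|lborel. g n x) = (LINT x|lborel. f x * \<phi> x - f (x + h n *\<^sub>R e) * \<phi> x)" .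
    have fin: "emeasure lborel ?A < \<infinity>"
      by (rule order_le_less_trans[OF est[OF h[of n]]]) simp
    have "\<bar>LINT x|lborel. f x * \<phi> x - f (x + h n *\<^sub>R e) * \<phi> x\<bar> \<le> (LINT x|lborel. 2 * B * indicator ?A x)"
    proof (rule integral_abs_bound_integral)
      show "integrable lborel (\<lambda>x. f x * \<phi> x - f (x + h n *\<^sub>R e) * \<phi> x)"
        using i[of 0] i by (intro Bochner_Integration.integrable_diff) auto
      show "integrable lborel (\<lambda>x. 2 * B * indicator ?A x :: real)" using fin by simp
      fix x
      show "\<bar>f x * \<phi> x - f (x + h n *\<^sub>R e) * \<phi> x\<bar> \<le> 2 * B * indicator ?A x"
      proof (cases "x \<in> ?A")
        case True
        have "\<bar>f x - f (x + h n *\<^sub>R e)\<bar> \<le> 2 * B" using fB[of x] fB[of "x + h n *\<^sub>R e"] by linarith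
        then have "\<bar>f x - f (x + h n *\<^sub>R e)\<bar> * \<bar>\<phi> x\<bar> \<le> 2 * B * 1" using \<phi>1 B0 by (intro mult_mono) auto
        then show ?thesis using True by (simp add: abs_mult left_diff_distrib[symmetric])
      next
        case False
        then have "\<phi> x = 0 \<or> f x = f (x + h n *\<^sub>R e)" using sp(2) supp_outside[of x \<phi>] by auto
        then show ?thesis using B0 by auto
      qed
    qed
    also have "\<dots> = 2 * B * measure lborel ?A" by simp
    also have "\<dots> \<le> 2 * B * (C * h n)"
    proof (intro mult_left_mono)
      show "measure lborel ?A \<le> C * h n"
        unfolding measure_def using est[OF h[of n]] \<open>0 \<le> C\<close> h[of n] by (intro enn2real_leI) auto
    qed (use B0 in auto)
    finally have "\<bar>h n * (LINT x|lborel. g n x)\<bar> \<le> 2 * B * (C * h n)" unfolding eq .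
    then have "h n * \<bar>LINT x|lborel. g n x\<bar> \<le> h n * (2 * B * C)" using h(1)[of n] by (simp add: abs_mult mult_ac)
    then show ?thesis using h(1)[of n] by simp
  qed
  show "\<bar>LINT x|lborel. f x * ?D x\<bar> \<le> 2 * B * C"
    by (rule LIMSEQ_le_const2[OF tendsto_rabs[OF lim]]) (use bound in auto)
qed

lemma Ck1_component:
  fixes \<Phi> :: "real^'n \<Rightarrow> real^'n^'m"
  assumes "\<Phi> \<in> Ck_c 1 U"
  shows "(\<lambda>y. \<Phi> y $ i $ j) differentiable (at x)"
    "e \<in> Basis \<Longrightarrow> continuous_on UNIV (dir_deriv e (\<lambda>y. \<Phi> y $ i $ j))"
    "compact (supp (\<lambda>y. \<Phi> y $ i $ j))" "supp (\<lambda>y. \<Phi> y $ i $ j) \<subseteq> U"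
proof -
  have diff: "\<Phi> differentiable (at x)" for x using assms by (auto simp: Ck_c_def)
  have bl: "bounded_linear (\<lambda>M::real^'n^'m. M $ i $ j)"
    using bounded_linear_compose[OF bounded_linear_vec_nth bounded_linear_vec_nth] by blast
  have D: "((\<lambda>y. \<Phi> y $ i $ j) has_derivative (\<lambda>h. frechet_derivative \<Phi> (at x) h $ i $ j)) (at x)" for x
    by (rule bounded_linear.has_derivative[OF bl]) (use diff frechet_derivative_works in blast)
  then show "(\<lambda>y. \<Phi> y $ i $ j) differentiable (at x)" by (auto simp: differentiable_def)
  have "dir_deriv e (\<lambda>y. \<Phi> y $ i $ j) = (\<lambda>x. dir_deriv e \<Phi> x $ i $ j)" for e
    using dir_deriv_eqI[OF D] by (auto simp: dir_deriv_def)
  moreover have "continuous_on UNIV (dir_deriv e \<Phi>)" if "e \<in> Basis"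
    using assms that by (auto simp: Ck_c_def)
  ultimately show "continuous_on UNIV (dir_deriv e (\<lambda>y. \<Phi> y $ i $ j))" if "e \<in> Basis"
    using that by (auto intro!: continuous_intros)
  have sub: "supp (\<lambda>y. \<Phi> y $ i $ j) \<subseteq> supp \<Phi>"
    unfolding supp_def by (intro closure_mono) auto
  have \<Phi>: "compact (supp \<Phi>)" "supp \<Phi> \<subseteq> U" using assms by (auto simp: Ck_c_def)
  have "bounded (supp (\<lambda>y. \<Phi> y $ i $ j))"
    using sub by (rule bounded_subset[OF compact_imp_bounded[OF \<Phi>(1)]])
  then show "compact (supp (\<lambda>y. \<Phi> y $ i $ j))" by (simp add: compact_eq_bounded_closed supp_def)
  show "supp (\<lambda>y. \<Phi> y $ i $ j) \<subseteq> U" using sub \<Phi>(2) by blast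
qed

text \<open>For a bounded \<open>f\<close> that changes under a translation by \<open>h\<close> only
  on a set of measure of order \<open>h\<close>, each of the \<open>CARD('m) * CARD('n)\<close>
  terms \<open>f x $ i\<close> times a partial derivative of a test entry integrates to at most
  \<open>2 * B * C\<close>, whatever the test matrix field.\<close>

lemma BV_of_jump_sets:
  fixes f :: "real^'n \<Rightarrow> real^'m"
  assumes f[measurable]: "f \<in> borel_measurable borel" and fB: "\<And>x i. \<bar>f x $ i\<bar> \<le> B"
    and U: "open U" "bounded U" and "0 \<le> C"
    and est: "\<And>h j. 0 < h \<Longrightarrow> h \<le> 1 \<Longrightarrow>
      emeasure lborel {x \<in> U. f (x + h *\<^sub>R axis j 1) \<noteq> f x} \<le> ennreal (C * h)"
  shows "f \<in> BV U"
proof -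
  have [measurable]: "U \<in> sets borel" using U by simp
  have fin: "emeasure lborel U < \<infinity>" using emeasure_bounded_finite[OF U(2)] by simp
  have int: "integrable (lborel_on U) f"
  proof -
    have "integrable lborel (\<lambda>x. indicator U x *\<^sub>R f x)"
    proof (rule integrableI_bounded_set[where A=U and B="real CARD('m) * B"])
      have "norm (f x) \<le> real CARD('m) * B" for x
      proof -
        have "norm (f x) \<le> (\<Sum>i\<in>UNIV. \<bar>f x $ i\<bar>)" by (rule norm_le_l1_cart)
        also have "\<dots> \<le> (\<Sum>i\<in>(UNIV::'m set). B)" by (rule sum_mono) (rule fB)
        finally show ?thesis by simp
      qed
      then show "AE x in lborel. x \<in> U \<longrightarrow> norm (indicator U x *\<^sub>R f x) \<le> real CARD('m) * B" by auto
    qed (use fin in auto)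
    then show ?thesis by (subst integrable_restrict_space) auto
  qed
  have "variation U f \<le> ennreal (real (CARD('m) * CARD('n)) * (2 * B * C))"
    unfolding variation_def
  proof (rule SUP_least, rule ennreal_leI)
    fix \<Phi> :: "real^'n \<Rightarrow> real^'n^'m" assume "\<Phi> \<in> {\<Phi>. \<Phi> \<in> Ck_c 1 U \<and> (\<forall>x. norm (\<Phi> x) \<le> 1)}"
    then have \<Phi>: "\<Phi> \<in> Ck_c 1 U" "\<And>x. norm (\<Phi> x) \<le> 1" by auto
    let ?D = "\<lambda>i j x. dir_deriv (axis j 1) (\<lambda>y. \<Phi> y $ i $ j) x"
    have ab: "integrable lborel (\<lambda>x. f x $ i * ?D i j x) \<and> \<bar>LINT x|lborel. f x $ i * ?D i j x\<bar> \<le> 2 * B * C" for i j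
    proof -
      have e: "emeasure lborel {x \<in> U. f (x + h *\<^sub>R axis j 1) $ i \<noteq> f x $ i} \<le> ennreal (C * h)" if "0 < h" "h \<le> 1" for h
      proof -
        have "emeasure lborel {x \<in> U. f (x + h *\<^sub>R axis j 1) $ i \<noteq> f x $ i} \<le>
            emeasure lborel {x \<in> U. f (x + h *\<^sub>R axis j 1) \<noteq> f x}"
          by (rule emeasure_mono) auto
        also note est[OF that]
        finally show ?thesis .
      qed
      have n1: "\<bar>\<Phi> x $ i $ j\<bar> \<le> 1" for x
        using component_le_norm_cart[of "\<Phi> x $ i" j] Finite_Cartesian_Product.norm_nth_le[of "\<Phi> x" i] \<Phi>(2)[of x] by linarith
      have fi: "(\<lambda>x. f x $ i) \<in> borel_measurable borel"
        by (rule measurable_compose[OF f borel_measurable_continuous_onI]) (intro continuous_intros)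
      note * = integral_dir_deriv_bound[of "\<lambda>x. f x $ i" B "\<lambda>y. \<Phi> y $ i $ j" "axis j 1" U C, OF fi fB
          Ck1_component(1)[OF \<Phi>(1)] Ck1_component(2)[OF \<Phi>(1)] Ck1_component(3,4)[OF \<Phi>(1)] n1 _ U(2) e \<open>0 \<le> C\<close>]
      show ?thesis using * by auto
    qed
    have out: "?D i j x = 0" if "x \<notin> U" for i j x
      using that Ck1_component(4)[OF \<Phi>(1), of i j] by (intro dir_deriv_outside_supp) auto
    have "(LINT x|lborel_on U. (\<Sum>i\<in>UNIV. f x $ i * (\<Sum>j\<in>UNIV. ?D i j x))) =
        (LINT x|lborel. indicator U x *\<^sub>R (\<Sum>i\<in>UNIV. f x $ i * (\<Sum>j\<in>UNIV. ?D i j x)))"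
      by (subst integral_restrict_space) auto
    also have "\<dots> = (LINT x|lborel. (\<Sum>i\<in>UNIV. \<Sum>j\<in>UNIV. f x $ i * ?D i j x))"
      by (intro Bochner_Integration.integral_cong refl) (auto simp: indicator_def out sum_distrib_left)
    also have "\<dots> = (\<Sum>i\<in>UNIV. \<Sum>j\<in>UNIV. LINT x|lborel. f x $ i * ?D i j x)"
      using ab by (subst Bochner_Integration.integral_sum, auto intro!: sum.cong Bochner_Integration.integral_sum)
    also have "\<dots> \<le> (\<Sum>i\<in>(UNIV::'m set). \<Sum>j\<in>(UNIV::'n set). 2 * B * C)"
      by (intro sum_mono) (use ab in \<open>auto simp: abs_le_iff\<close>)
    also have "\<dots> = real (CARD('m) * CARD('n)) * (2 * B * C)" by simp
    finally show "(LINT x|lborel_on U. (\<Sum>i\<in>UNIV. f x $ i * (\<Sum>j\<in>UNIV. ?D i j x))) \<le> real (CARD('m) * CARD('n)) * (2 * B * C)" .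
  qed
  then have "variation U f < \<infinity>" by (rule order_le_less_trans) simp
  with int show ?thesis by (simp add: BV_def)
qed

text \<open>The closure of \<open>U\<close> is compact in the open half-space, so
  \<open>x $ 1\<close> has a positive minimum on it and a mesh size can be chosen that resolves the
  field on all of \<open>U\<close>.\<close>

lemma field_BV:
  assumes "0 < c" "open U" "bounded U" "closure U \<subseteq> Omega"
  shows "field c \<in> BV U"
proof -
  obtain \<epsilon> where \<epsilon>: "0 < \<epsilon>" "\<And>x. x \<in> U \<Longrightarrow> \<epsilon> \<le> x $ 1"
  proof (cases "U = {}")
    case False
    have "compact (closure U)" using assms(3) by simp
    moreover have "continuous_on (closure U) (\<lambda>x. x $ 1)" by (intro continuous_intros)
    ultimately obtain x where x: "x \<in> closure U" "\<And>y. y \<in> closure U \<Longrightarrow> x $ 1 \<le> y $ 1"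
      using continuous_attains_inf[of "closure U" "\<lambda>x. x $ 1"] False by auto
    show ?thesis by (rule that[of "x $ 1"]) (use x assms(4) closure_subset in \<open>auto simp: Omega_def\<close>)
  qed (use that[of 1] in auto)
  \<comment> \<open>The mesh exponent will be \<open>r = - int k - 1\<close>, so that
    \<open>2 powi (r + 1)\<close> lies below the minimal height \<open>\<epsilon>\<close>.\<close>
  obtain k where k: "(1/2) ^ k < \<epsilon>" using real_arch_pow_inv[OF \<epsilon>(1), of "1/2"] by auto
  have r: "2 powi (- int k - 1 + 1) \<le> x $ 1" if "x \<in> U" for x
    using k \<epsilon>(2)[OF that] by (simp add: power_int_minus power_one_over inverse_eq_divide)
  obtain M where M: "0 < M" "\<And>x. x \<in> U \<Longrightarrow> norm x \<le> M" using assms(3) bounded_pos by blast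
  have "\<bar>x $ i\<bar> \<le> M" if "x \<in> U" for x i using M(2)[OF that] component_le_norm_cart order_trans by blast
  then obtain C where "C \<ge> 0" "\<And>h j. 0 < h \<Longrightarrow> h \<le> 1 \<Longrightarrow>
    emeasure lborel {x \<in> U. field c (x + h *\<^sub>R axis j 1) \<noteq> field c x} \<le> ennreal (C * h)"
    using field_jump_set[of U "- int k - 1" M c] r M(1) assms(2) by auto
  then show ?thesis
    by (intro BV_of_jump_sets[where B="1 + 2 * c" and C=C]) (use field_component_bound assms in auto)
qed

subsection \<open>Test functions\<close>

lemma norm_v3 [simp]: "norm (v3 w) = norm w"
  by (simp add: norm_vec_def L2_set_def sum_3 norm_prod_def add.assoc)

lemma trace_test_differentiable:
  assumes "\<phi> \<in> trace_test"
  shows "\<phi> differentiable (at z)"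
proof -
  have "\<phi> \<in> Ck_c (Suc 0) ({..<1} \<times> UNIV)"
    using assms unfolding trace_test_def Cinf_c_def by blast
  then show ?thesis unfolding Ck_c_def Ck.simps by blast
qed

lemma trace_test_continuous:
  assumes "\<phi> \<in> trace_test"
  shows "continuous_on UNIV \<phi>" "continuous_on UNIV (dt \<phi>)" "continuous_on UNIV (\<lambda>z. grad_x \<phi> z $ j)"
proof -
  show "continuous_on UNIV \<phi>"
    by (simp add: continuous_on_eq_continuous_at differentiable_imp_continuous_within trace_test_differentiable[OF assms])
  have "\<phi> \<in> Ck_c (Suc 0) ({..<1} \<times> UNIV)"
    using assms unfolding trace_test_def Cinf_c_def by blast
  then have *: "continuous_on UNIV (dir_deriv e \<phi>)" if "e \<in> Basis" for e
    using that by (simp add: Ck_c_def)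
  show "continuous_on UNIV (dt \<phi>)" unfolding dt_def by (rule *) (simp add: Basis_prod_def)
  show "continuous_on UNIV (\<lambda>z. grad_x \<phi> z $ j)"
    unfolding grad_x_def using *[of "(0, axis j 1)"] by (simp add: Basis_prod_def)
qed

lemma trace_test_measurable:
  assumes "\<phi> \<in> trace_test"
  shows "\<phi> \<in> borel_measurable borel" "dt \<phi> \<in> borel_measurable borel"
    "(\<lambda>z. grad_x \<phi> z $ j) \<in> borel_measurable borel"
  using trace_test_continuous[OF assms] by (auto intro: borel_measurable_continuous_onI)

lemma trace_test_bounds:
  assumes "\<phi> \<in> trace_test"
  obtains M B where "0 \<le> M" "0 \<le> B"
    "\<And>z. M < norm z \<or> 1 \<le> fst z \<Longrightarrow> \<phi> z = 0 \<and> dt \<phi> z = 0 \<and> (\<forall>j. grad_x \<phi> z $ j = 0)"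
    "\<And>z j. \<bar>\<phi> z\<bar> \<le> B \<and> \<bar>dt \<phi> z\<bar> \<le> B \<and> \<bar>grad_x \<phi> z $ j\<bar> \<le> B"
proof -
  have s: "compact (supp \<phi>)" "supp \<phi> \<subseteq> {..<1} \<times> UNIV"
    using assms by (auto simp: trace_test_def Cinf_c_def Ck_c_def)
  obtain M where M: "\<And>z. z \<in> supp \<phi> \<Longrightarrow> norm z \<le> M"
    using compact_imp_bounded[OF s(1)] by (auto simp: bounded_iff)
  have out: "\<phi> z = 0 \<and> dt \<phi> z = 0 \<and> (\<forall>j. grad_x \<phi> z $ j = 0)" if "M < norm z \<or> 1 \<le> fst z" for z
  proof -
    have "z \<notin> supp \<phi>" using that M[of z] s(2) by (cases z) force
    then show ?thesis by (simp add: supp_outside dt_def grad_x_def dir_deriv_outside_supp)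
  qed
  obtain B1 where B1: "0 \<le> B1" "\<And>z. \<bar>\<phi> z\<bar> \<le> B1"
    using continuous_bounded_of_support[OF trace_test_continuous(1)[OF assms]] out by metis
  obtain B2 where B2: "0 \<le> B2" "\<And>z. \<bar>dt \<phi> z\<bar> \<le> B2"
    using continuous_bounded_of_support[OF trace_test_continuous(2)[OF assms]] out by metis
  have "\<exists>B\<ge>0. \<forall>z. \<bar>grad_x \<phi> z $ j\<bar> \<le> B" for j
    using continuous_bounded_of_support[OF trace_test_continuous(3)[OF assms, of j]] out by metis
  then obtain B3 where B3: "\<And>j. 0 \<le> B3 j" "\<And>z j. \<bar>grad_x \<phi> z $ j\<bar> \<le> B3 j" by metis
  have B3': "\<bar>grad_x \<phi> z $ j\<bar> \<le> B3 1 + B3 2 + B3 3" for z j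
    using B3(2)[of z j] B3(1)[of 1] B3(1)[of 2] B3(1)[of 3] exhaust_3[of j] by auto
  show ?thesis
  proof (rule that[of "max 0 M" "B1 + B2 + (B3 1 + B3 2 + B3 3)"])
    show "\<bar>\<phi> z\<bar> \<le> B1 + B2 + (B3 1 + B3 2 + B3 3) \<and> \<bar>dt \<phi> z\<bar> \<le> B1 + B2 + (B3 1 + B3 2 + B3 3) \<and>
      \<bar>grad_x \<phi> z $ j\<bar> \<le> B1 + B2 + (B3 1 + B3 2 + B3 3)" for z j
      using B1(1) B1(2)[of z] B2(1) B2(2)[of z] B3'[of z j] B3(1)[of 1] B3(1)[of 2] B3(1)[of 3] by linarith
  qed (use B1(1) B2(1) B3(1) out in auto)
qed

text \<open>The slope \<open>\<kappa>\<close> is 0 when time is frozen, as for the flux of the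
  field, and 1 along world lines of unit normal speed, as for the solutions. In the latter case the
  s-derivative gains the term \<open>dt \<phi>\<close>, which is the time part of the transport
  operator.\<close>

lemma trace_test_slice:
  assumes \<phi>: "\<phi> \<in> trace_test"
  shows "C1c (\<lambda>w. \<phi> (a + \<kappa> * fst w, v3 w))
     (\<lambda>w. \<kappa> * dt \<phi> (a + \<kappa> * fst w, v3 w) + grad_x \<phi> (a + \<kappa> * fst w, v3 w) $ 1)
     (\<lambda>w. grad_x \<phi> (a + \<kappa> * fst w, v3 w) $ 2) (\<lambda>w. grad_x \<phi> (a + \<kappa> * fst w, v3 w) $ 3)"
proof -
  let ?T = "\<lambda>w. (a + \<kappa> * fst w, v3 w)"
  obtain M B where M: "\<And>z. M < norm z \<or> 1 \<le> fst z \<Longrightarrow> \<phi> z = 0 \<and> dt \<phi> z = 0 \<and> (\<forall>j. grad_x \<phi> z $ j = 0)"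
    using trace_test_bounds[OF \<phi>] by metis
  have T: "continuous_on UNIV ?T" by (intro continuous_intros)
  have cc: "continuous_on UNIV (\<lambda>w. g (?T w))" if "continuous_on UNIV g" for g :: "_ \<Rightarrow> real"
    by (rule continuous_on_compose2[OF that T]) auto
  note cs = cc[OF trace_test_continuous(1)[OF \<phi>]] cc[OF trace_test_continuous(2)[OF \<phi>]] cc[OF trace_test_continuous(3)[OF \<phi>]]
  show ?thesis
    unfolding C1c_def
  proof (intro conjI allI)
    fix w
    have 1: "(?T has_derivative (\<lambda>h. (\<kappa> * fst h, v3 h))) (at w)"
      by (auto intro!: derivative_eq_intros)
    let ?D = "frechet_derivative \<phi> (at (?T w))"
    have D: "(\<phi> has_derivative ?D) (at (?T w))"
      using trace_test_differentiable[OF \<phi>] frechet_derivative_works by blast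
    have L: "linear ?D" by (rule has_derivative_linear[OF D])
    have "?D (\<kappa> * fst h, v3 h) = fst h * (\<kappa> * dt \<phi> (?T w) + grad_x \<phi> (?T w) $ 1) +
        fst (snd h) * grad_x \<phi> (?T w) $ 2 + snd (snd h) * grad_x \<phi> (?T w) $ 3" for h
    proof -
      have "(\<kappa> * fst h, v3 h) = (\<kappa> * fst h) *\<^sub>R (1, 0) + fst h *\<^sub>R (0, axis 1 1) +
          fst (snd h) *\<^sub>R (0, axis 2 1) + snd (snd h) *\<^sub>R (0, axis 3 1)"
        by (simp add: v3_conv_axis)
      then show ?thesis
        by (simp only: linear_add[OF L] linear_cmul[OF L]) (simp add: dt_def grad_x_def dir_deriv_def algebra_simps)
    qed
    then have e: "(\<lambda>h. ?D (\<kappa> * fst h, v3 h)) = (\<lambda>h. fst h * (\<kappa> * dt \<phi> (?T w) + grad_x \<phi> (?T w) $ 1) +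
        fst (snd h) * grad_x \<phi> (?T w) $ 2 + snd (snd h) * grad_x \<phi> (?T w) $ 3)" by (rule ext)
    show "((\<lambda>w. \<phi> (?T w)) has_derivative (\<lambda>h. fst h * (\<kappa> * dt \<phi> (?T w) + grad_x \<phi> (?T w) $ 1) +
        fst (snd h) * grad_x \<phi> (?T w) $ 2 + snd (snd h) * grad_x \<phi> (?T w) $ 3)) (at w)"
      using diff_chain_at[OF 1 D] unfolding comp_def e .
  next
    have "M < norm (?T w)" if "M < norm w" for w
      using that norm_snd_le[of "v3 w" "a + \<kappa> * fst w"] by simp
    then show "\<exists>M. \<forall>w. M < norm w \<longrightarrow> \<phi> (?T w) = 0 \<and> \<kappa> * dt \<phi> (?T w) + grad_x \<phi> (?T w) $ 1 = 0 \<and>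
        grad_x \<phi> (?T w) $ 2 = 0 \<and> grad_x \<phi> (?T w) $ 3 = 0"
      using M by (intro exI[of _ M]) auto
  qed (intro continuous_intros cs)+
qed

subsection \<open>Integrals over the cylinder\<close>

lemma interior_integral:
  fixes F :: "spacetime \<Rightarrow> real"
  assumes F[measurable]: "F \<in> borel_measurable borel" and S: "bounded S" "\<And>z. z \<notin> S \<Longrightarrow> F z = 0"
    and B: "\<And>z. \<bar>F z\<bar> \<le> B"
  shows "integrable (interior_measure Omega) F"
    "(LINT z|interior_measure Omega. F z) =
       (LINT t|lborel. indicator {0<..<1} t * (LINT w|lborel. indicator {0<..} (fst w) * F (t, v3 w)))"
proof -
  have Om[measurable]: "Omega \<in> sets borel"
    unfolding Omega_def by (intro borel_open open_Collect_less continuous_intros)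
  have [measurable]: "{0<..<1::real} \<times> Omega \<in> sets borel" by (intro borel_Times Om) auto
  have B0: "0 \<le> B" using B[of undefined] by simp
  let ?F = "\<lambda>z. indicator ({0<..<1} \<times> Omega) z * F z"
  have i: "integrable lborel ?F"
    by (rule integrable_bounded_support[OF _ S(1), where B=B]) (use S B B0 in \<open>auto simp: indicator_def\<close>)
  then show "integrable (interior_measure Omega) F"
    unfolding interior_measure_def by (subst integrable_restrict_space) auto
  have "(LINT z|interior_measure Omega. F z) = (LINT z|lborel. ?F z)"
    unfolding interior_measure_def by (subst integral_restrict_space) auto
  also have "\<dots> = (LINT t|lborel. LINT x|lborel. ?F (t, x))"
    using lborel_pair.integral_fst'[of ?F] i by (simp add: lborel_prod)
  also have "\<dots> = (LINT t|lborel. indicator {0<..<1} t * (LINT w|lborel. indicator {0<..} (fst w) * F (t, v3 w)))"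
  proof (intro Bochner_Integration.integral_cong refl)
    fix t :: real
    have "(LINT x|lborel. ?F (t, x)) = (LINT w|lborel. ?F (t, v3 w))"
      by (rule integral_lborel_v3) measurable
    also have "\<dots> = (LINT w|lborel. indicator {0<..<1} t * (indicator {0<..} (fst w) * F (t, v3 w)))"
      by (intro Bochner_Integration.integral_cong refl) (auto simp: indicator_def Omega_def)
    finally show "(LINT x|lborel. ?F (t, x)) = indicator {0<..<1} t * (LINT w|lborel. indicator {0<..} (fst w) * F (t, v3 w))"
      by simp
  qed
  finally show "(LINT z|interior_measure Omega. F z) =
       (LINT t|lborel. indicator {0<..<1} t * (LINT w|lborel. indicator {0<..} (fst w) * F (t, v3 w)))" .
qed

lemma inner_v3: "v3 (a, b, c) \<bullet> x = a * x $ 1 + b * x $ 2 + c * x $ 3"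
  by (simp add: inner_vec_def sum_3)

lemma C1c_transport_integrable:
  assumes C: "C1c f fs fy fz" and [measurable]: "X \<in> borel_measurable borel" and X: "\<And>w. \<bar>X w\<bar> \<le> 1"
  shows "integrable lborel (\<lambda>w. indicator {0<..} (fst w) * (X w * (fs w + vely w * fy w + velz w * fz w)))"
proof -
  note [measurable] = C1c_measurable[OF C]
  obtain M B where M: "0 \<le> M" "0 \<le> B"
    "\<And>w. M < norm w \<Longrightarrow> f w = 0 \<and> fs w = 0 \<and> fy w = 0 \<and> fz w = 0"
    "\<And>w. \<bar>f w\<bar> \<le> B \<and> \<bar>fs w\<bar> \<le> B \<and> \<bar>fy w\<bar> \<le> B \<and> \<bar>fz w\<bar> \<le> B"
    using C1c_bounds[OF C] by blast
  show ?thesis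
  proof (rule integrable_bounded_support)
    show "bounded (cball 0 M :: (real \<times> real \<times> real) set)" by simp
    show "indicator {0<..} (fst w) * (X w * (fs w + vely w * fy w + velz w * fz w)) = 0" if "w \<notin> cball 0 M" for w
      using that M(3)[of w] by auto
    show "\<bar>indicator {0<..} (fst w) * (X w * (fs w + vely w * fy w + velz w * fz w))\<bar> \<le> 1 * (1 * (3 * B))" for w
    proof -
      have "\<bar>vely w * fy w\<bar> \<le> 1 * B" "\<bar>velz w * fz w\<bar> \<le> 1 * B"
        unfolding abs_mult using M(2) M(4)[of w] by (intro mult_mono; simp)+
      then have "\<bar>fs w + vely w * fy w + velz w * fz w\<bar> \<le> 3 * B" using M(4)[of w] by linarith
      then show ?thesis unfolding abs_mult using X M(2) by (intro mult_mono) (auto simp: indicator_def)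
    qed
  qed measurable
qed

text \<open>Only the mean part \<open>\<beta>\<close> reaches the boundary. The field uses
  \<open>\<alpha> = 1 + c\<close>, \<open>\<beta> = - c\<close>; the solutions use
  \<open>\<alpha> = \<beta> = a / 2\<close>.\<close>

lemma combined_transport:
  assumes C: "C1c f fs fy fz"
  shows "(LINT w|lborel. indicator {0<..} (fst w) * ((\<alpha> * pattern w + \<beta>) * (fs w + vely w * fy w + velz w * fz w)))
    = - \<beta> * (LINT v|lborel. f (0, v))"
proof -
  let ?L = "\<lambda>w. fs w + vely w * fy w + velz w * fz w"
  have "(LINT w|lborel. indicator {0<..} (fst w) * ((\<alpha> * pattern w + \<beta>) * ?L w)) =
    (LINT w|lborel. \<alpha> * (indicator {0<..} (fst w) * (pattern w * ?L w)) + \<beta> * (indicator {0<..} (fst w) * (1 * ?L w)))"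
    by (intro Bochner_Integration.integral_cong refl) (simp add: algebra_simps)
  also have "\<dots> = (LINT w|lborel. \<alpha> * (indicator {0<..} (fst w) * (pattern w * ?L w))) +
      (LINT w|lborel. \<beta> * (indicator {0<..} (fst w) * (1 * ?L w)))"
    using C1c_transport_integrable[OF C, of pattern] C1c_transport_integrable[OF C, of "\<lambda>_. 1"]
    by (intro Bochner_Integration.integral_add Bochner_Integration.integrable_mult_right) auto
  also have "\<dots> = \<alpha> * (LINT w|lborel. indicator {0<..} (fst w) * (pattern w * ?L w)) +
      \<beta> * (LINT w|lborel. indicator {0<..} (fst w) * (1 * ?L w))"
    by (simp only: integral_mult_right_zero)
  also have "\<dots> = - \<beta> * (LINT v|lborel. f (0, v))"
    unfolding pattern_transport[OF C] unit_transport[OF C] by simp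
  finally show ?thesis .
qed

text \<open>Time is a parameter here. For test functions vanishing on the boundary this is the
  absence of divergence, and for the others it gives the outward flux \<open>c\<close> per unit
  Lebesgue area.\<close>

lemma field_flux:
  assumes \<phi>: "\<phi> \<in> trace_test"
  shows "(LINT w|lborel. indicator {0<..} (fst w) * (field c (v3 w) \<bullet> grad_x \<phi> (t, v3 w))) =
     c * (LINT v|lborel. \<phi> (t, v3 (0, v)))"
proof -
  have "(LINT w|lborel. indicator {0<..} (fst w) * (field c (v3 w) \<bullet> grad_x \<phi> (t, v3 w))) =
    (LINT w|lborel. indicator {0<..} (fst w) * (((1 + c) * pattern w + - c) *
      (grad_x \<phi> (t, v3 w) $ 1 + vely w * grad_x \<phi> (t, v3 w) $ 2 + velz w * grad_x \<phi> (t, v3 w) $ 3)))"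
    by (intro Bochner_Integration.integral_cong refl) (simp add: field_def inner_v3)
  also have "\<dots> = c * (LINT v|lborel. \<phi> (t, v3 (0, v)))"
    using combined_transport[OF trace_test_slice[OF \<phi>, of t 0], of "1 + c" "- c"] by simp
  finally show ?thesis .
qed

lemma grad_pairing_bounds:
  assumes \<phi>: "\<phi> \<in> trace_test" and "0 < c"
  shows "(\<lambda>z. field c (snd z) \<bullet> grad_x \<phi> z) \<in> borel_measurable borel"
    "\<exists>M. \<forall>z. M < norm z \<longrightarrow> field c (snd z) \<bullet> grad_x \<phi> z = 0"
    "\<exists>B. \<forall>z. \<bar>field c (snd z) \<bullet> grad_x \<phi> z\<bar> \<le> B"
proof -
  have e: "field c x \<bullet> g = field c x $ 1 * g $ 1 + field c x $ 2 * g $ 2 + field c x $ 3 * g $ 3" for x g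
    by (simp add: inner_vec_def sum_3)
  note [measurable] = trace_test_measurable(3)[OF \<phi>]
  show "(\<lambda>z. field c (snd z) \<bullet> grad_x \<phi> z) \<in> borel_measurable borel" unfolding e by measurable
  obtain M B where M: "0 \<le> B" "\<And>z. M < norm z \<or> 1 \<le> fst z \<Longrightarrow> (\<forall>j. grad_x \<phi> z $ j = 0)"
    "\<And>z j. \<bar>grad_x \<phi> z $ j\<bar> \<le> B"
    using trace_test_bounds[OF \<phi>] by metis
  show "\<exists>M. \<forall>z. M < norm z \<longrightarrow> field c (snd z) \<bullet> grad_x \<phi> z = 0"
    using M(2) by (intro exI[of _ M]) (auto simp: e)
  have "\<bar>field c (snd z) $ j * grad_x \<phi> z $ j\<bar> \<le> (1 + 2 * c) * B" for z j
    unfolding abs_mult using M field_component_bound[OF \<open>0 < c\<close>] \<open>0 < c\<close> by (intro mult_mono) auto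
  then have "\<bar>field c (snd z) \<bullet> grad_x \<phi> z\<bar> \<le> (1 + 2 * c) * B + (1 + 2 * c) * B + (1 + 2 * c) * B" for z
    unfolding e by (meson abs_triangle_ineq add_mono order_trans)
  then show "\<exists>B. \<forall>z. \<bar>field c (snd z) \<bullet> grad_x \<phi> z\<bar> \<le> B" by blast
qed

lemma interior_field_flux:
  assumes \<phi>: "\<phi> \<in> trace_test" and "0 < c"
  shows "integrable (interior_measure Omega) (\<lambda>z. field c (snd z) \<bullet> grad_x \<phi> z)"
    "(LINT z|interior_measure Omega. field c (snd z) \<bullet> grad_x \<phi> z) =
      c * (LINT t|lborel. indicator {0<..<1} t * (LINT v|lborel. \<phi> (t, v3 (0, v))))"
proof -
  obtain M B where M: "\<And>z. M < norm z \<Longrightarrow> field c (snd z) \<bullet> grad_x \<phi> z = 0" "\<And>z. \<bar>field c (snd z) \<bullet> grad_x \<phi> z\<bar> \<le> B"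
    using grad_pairing_bounds[OF assms] by blast
  have out: "field c (snd z) \<bullet> grad_x \<phi> z = 0" if "z \<notin> cball 0 M" for z using M(1) that by auto
  note I = interior_integral[OF grad_pairing_bounds(1)[OF assms] bounded_cball[of 0 M] out M(2)]
  show "integrable (interior_measure Omega) (\<lambda>z. field c (snd z) \<bullet> grad_x \<phi> z)" by (rule I(1))
  show "(LINT z|interior_measure Omega. field c (snd z) \<bullet> grad_x \<phi> z) =
      c * (LINT t|lborel. indicator {0<..<1} t * (LINT v|lborel. \<phi> (t, v3 (0, v))))"
    using I(2) by (simp add: field_flux[OF \<phi>] mult.left_commute)
qed

subsection \<open>Solutions emanating from the boundary\<close>

text \<open>On \<open>pattern = 1\<close> the field is \<open>(1, vely, velz)\<close>, so particles leave the boundary with unit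
  normal speed and occupy at time \<open>t\<close> the part of \<open>{pattern = 1}\<close> below height \<open>t\<close>.\<close>

definition inflow :: "real \<Rightarrow> spacetime \<Rightarrow> real" where
  "inflow a z = (if snd z $ 1 < fst z then a * ((1 + pattern (coords (snd z))) / 2) else 0)"

lemma borel_measurable_inflow [measurable]: "inflow a \<in> borel_measurable borel"
  unfolding inflow_def by measurable

lemma abs_inflow_le: "\<bar>inflow a z\<bar> \<le> \<bar>a\<bar>"
  using pattern_cases[of "coords (snd z)"] by (auto simp: inflow_def)

text \<open>Where \<open>inflow\<close> is nonzero the field is \<open>(1, vely, velz)\<close>, so
  the integrand is transport along world lines of unit normal speed. Replacing \<open>t\<close> by
  the entry time \<open>t - s\<close> turns the region \<open>0 < s < t\<close> into a product. For
  each entry time \<open>combined_transport\<close> on a slice of slope 1 then leaves a boundary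
  term only. No initial term arises since the region is empty at time 0.\<close>

lemma inflow_balance:
  assumes \<phi>: "\<phi> \<in> trace_test" and c: "0 < c"
  shows "(LINT z|interior_measure Omega. inflow a z * (dt \<phi> z + field c (snd z) \<bullet> grad_x \<phi> z)) =
     - (a / 2) * (LINT t|lborel. indicator {0<..<1} t * (LINT v|lborel. \<phi> (t, v3 (0, v))))"
proof -
  note [measurable] = trace_test_measurable[OF \<phi>]
  obtain M B where M: "0 \<le> M" "0 \<le> B"
    "\<And>z. M < norm z \<or> 1 \<le> fst z \<Longrightarrow> \<phi> z = 0 \<and> dt \<phi> z = 0 \<and> (\<forall>j. grad_x \<phi> z $ j = 0)"
    "\<And>z j. \<bar>\<phi> z\<bar> \<le> B \<and> \<bar>dt \<phi> z\<bar> \<le> B \<and> \<bar>grad_x \<phi> z $ j\<bar> \<le> B"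
    using trace_test_bounds[OF \<phi>] by metis
  define L where "L t w = (a / 2 * pattern w + a / 2) * (dt \<phi> (t, v3 w) + grad_x \<phi> (t, v3 w) $ 1 +
      vely w * grad_x \<phi> (t, v3 w) $ 2 + velz w * grad_x \<phi> (t, v3 w) $ 3)" for t w
  have Lm[measurable]: "(\<lambda>p. L (fst p) (snd p)) \<in> borel_measurable borel"
    unfolding L_def by measurable
  have L0: "L t w = 0" if "M < norm w \<or> M < \<bar>t\<bar> \<or> 1 \<le> t" for t w
  proof -
    have "M < norm (t, v3 w) \<or> 1 \<le> fst (t, v3 w)"
      using that norm_fst_le[of t "v3 w"] norm_snd_le[of "v3 w" t] by auto
    then show ?thesis using M(3) by (simp add: L_def)
  qed
  have LB: "\<bar>L t w\<bar> \<le> \<bar>a\<bar> * (4 * B)" for t w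
  proof -
    have "\<bar>vely w * grad_x \<phi> (t, v3 w) $ 2\<bar> \<le> 1 * B" "\<bar>velz w * grad_x \<phi> (t, v3 w) $ 3\<bar> \<le> 1 * B"
      unfolding abs_mult using M(2,4) by (intro mult_mono; simp)+
    moreover have "\<bar>dt \<phi> (t, v3 w)\<bar> \<le> B" "\<bar>grad_x \<phi> (t, v3 w) $ 1\<bar> \<le> B" using M(4) by auto
    ultimately have "\<bar>dt \<phi> (t, v3 w) + grad_x \<phi> (t, v3 w) $ 1 +
      vely w * grad_x \<phi> (t, v3 w) $ 2 + velz w * grad_x \<phi> (t, v3 w) $ 3\<bar> \<le> 4 * B" by linarith
    moreover have "\<bar>a / 2 * pattern w + a / 2\<bar> \<le> \<bar>a\<bar>" using pattern_cases[of w] by auto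
    ultimately show ?thesis unfolding L_def abs_mult using M(2) by (intro mult_mono) auto
  qed
  let ?F = "\<lambda>z. inflow a z * (dt \<phi> z + field c (snd z) \<bullet> grad_x \<phi> z)"
  have FL: "?F (t, v3 w) = (if fst w < t then L t w else 0)" for t w
    using pattern_cases[of w] by (auto simp: inflow_def field_def inner_v3 L_def algebra_simps)
  have FLz: "?F z = (if snd z $ 1 < fst z then L (fst z) (coords (snd z)) else 0)" for z
    using FL[of "fst z" "coords (snd z)"] by (simp add: coords_def)
  have Fm: "?F \<in> borel_measurable borel"
    using grad_pairing_bounds(1)[OF \<phi> c] by measurable
  have F0: "?F z = 0" if "z \<notin> cball 0 M \<times> cball 0 M" for z
  proof -
    have "norm (coords (snd z)) = norm (snd z)" using norm_v3[of "coords (snd z)"] by (simp add: coords_def)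
    then show ?thesis using that by (auto simp: FLz mem_Times_iff intro: L0)
  qed
  have FB: "\<bar>?F z\<bar> \<le> \<bar>a\<bar> * (4 * B)" for z
    unfolding FLz using LB M(2) by auto
  have bS: "bounded (cball (0::real) M \<times> cball (0::real^3) M)" by (intro bounded_Times) auto
  have "(LINT z|interior_measure Omega. ?F z) =
      (LINT t|lborel. indicator {0<..<1} t * (LINT w|lborel. indicator {0<..} (fst w) * ?F (t, v3 w)))"
    by (rule interior_integral(2)[OF Fm bS F0 FB])
  also have "\<dots> = (LINT t|lborel. LINT w|lborel. (if 0 < fst w \<and> fst w < t then L t w else 0))"
  proof (intro Bochner_Integration.integral_cong refl)
    fix t :: real
    have "indicator {0<..<1} t * (LINT w|lborel. indicator {0<..} (fst w) * ?F (t, v3 w)) =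
        (LINT w|lborel. indicator {0<..<1} t * (indicator {0<..} (fst w) * ?F (t, v3 w)))" by simp
    also have "\<dots> = (LINT w|lborel. (if 0 < fst w \<and> fst w < t then L t w else 0))"
      unfolding FL by (intro Bochner_Integration.integral_cong refl) (auto simp: indicator_def L0)
    finally show "indicator {0<..<1} t * (LINT w|lborel. indicator {0<..} (fst w) * ?F (t, v3 w)) =
      (LINT w|lborel. (if 0 < fst w \<and> fst w < t then L t w else 0))" by simp
  qed
  also have "\<dots> = (LINT w|lborel. LINT t|lborel. (if 0 < fst w \<and> fst w < t then L t w else 0))"
  proof (rule lborel_pair.Fubini_integral[symmetric])
    have "integrable lborel (\<lambda>p. if 0 < fst (snd p) \<and> fst (snd p) < fst p then L (fst p) (snd p) else 0)"
      by (rule integrable_bounded_support[of _ "cball (0::real) M \<times> cball (0::real \<times> real \<times> real) M" "\<bar>a\<bar> * (4 * B)"])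
        (use L0 LB M(2) in \<open>auto simp: mem_Times_iff intro: bounded_Times\<close>)
    then show "integrable (lborel \<Otimes>\<^sub>M lborel) (\<lambda>(t, w). if 0 < fst w \<and> fst w < t then L t w else 0)"
      by (simp add: lborel_prod case_prod_beta')
  qed
  \<comment> \<open>From here on \<open>t\<close> is the time at which the particle now at height
    \<open>fst w\<close> left the boundary.\<close>
  also have "\<dots> = (LINT w|lborel. LINT t|lborel. (if 0 < fst w \<and> 0 < t then L (fst w + t) w else 0))"
  proof (rule Bochner_Integration.integral_cong[OF refl])
    fix w :: "real \<times> real \<times> real"
    have [measurable]: "(\<lambda>t. L t w) \<in> borel_measurable borel"
      using measurable_compose[OF _ Lm, of "\<lambda>t. (t, w)" borel] by simp
    show "(LINT t|lborel. (if 0 < fst w \<and> fst w < t then L t w else 0)) =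
        (LINT t|lborel. (if 0 < fst w \<and> 0 < t then L (fst w + t) w else 0))"
      using integral_translate[of "\<lambda>t. if 0 < fst w \<and> fst w < t then L t w else 0" "fst w"] by simp
  qed
  also have "\<dots> = (LINT t|lborel. LINT w|lborel. (if 0 < fst w \<and> 0 < t then L (fst w + t) w else 0))"
  proof (rule lborel_pair.Fubini_integral)
    have [measurable]: "(\<lambda>p. L (fst (snd p) + fst p) (snd p)) \<in> borel_measurable borel"
      using measurable_compose[OF _ Lm, of "\<lambda>p. (fst (snd p) + fst p, snd p)" borel] by simp
    have "integrable lborel (\<lambda>p. if 0 < fst (snd p) \<and> 0 < fst p then L (fst (snd p) + fst p) (snd p) else 0)"
    proof (rule integrable_bounded_support[of _ "cball (0::real) M \<times> cball (0::real \<times> real \<times> real) M" "\<bar>a\<bar> * (4 * B)"])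
      show "bounded (cball (0::real) M \<times> cball (0::real \<times> real \<times> real) M)" by (intro bounded_Times) auto
    qed (use L0 LB M(2) in \<open>auto simp: mem_Times_iff\<close>)
    then show "integrable (lborel \<Otimes>\<^sub>M lborel) (\<lambda>(t, w). if 0 < fst w \<and> 0 < t then L (fst w + t) w else 0)"
      by (simp add: lborel_prod case_prod_beta')
  qed
  also have "\<dots> = (LINT t|lborel. indicator {0<..} t * (- (a / 2) * (LINT v|lborel. \<phi> (t, v3 (0, v)))))"
  proof (intro Bochner_Integration.integral_cong refl)
    fix t :: real
    have "(LINT w|lborel. (if 0 < fst w \<and> 0 < t then L (fst w + t) w else 0)) =
        (LINT w|lborel. indicator {0<..} t * (indicator {0<..} (fst w) * L (t + 1 * fst w) w))"
      by (intro Bochner_Integration.integral_cong refl) (auto simp: indicator_def add.commute)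
    also have "\<dots> = indicator {0<..} t * (LINT w|lborel. (indicator {0<..} (fst w) * L (t + 1 * fst w) w))"
      by (rule integral_mult_right_zero)
    also have "(LINT w|lborel. (indicator {0<..} (fst w) * L (t + 1 * fst w) w)) =
        - (a / 2) * (LINT v|lborel. \<phi> (t, v3 (0, v)))"
      using combined_transport[OF trace_test_slice[OF \<phi>, of t 1], of "a / 2" "a / 2"]
      by (simp add: L_def)
    finally show "(LINT w|lborel. (if 0 < fst w \<and> 0 < t then L (fst w + t) w else 0)) =
        indicator {0<..} t * (- (a / 2) * (LINT v|lborel. \<phi> (t, v3 (0, v))))" .
  qed
  \<comment> \<open>Entry times from 1 on contribute nothing because \<open>\<phi>\<close> vanishes
    there.\<close>
  also have "\<dots> = (LINT t|lborel. - (a / 2) * (indicator {0<..<1} t * (LINT v|lborel. \<phi> (t, v3 (0, v)))))"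
    by (intro Bochner_Integration.integral_cong refl) (auto simp: indicator_def M(3))
  also have "\<dots> = - (a / 2) * (LINT t|lborel. (indicator {0<..<1} t * (LINT v|lborel. \<phi> (t, v3 (0, v)))))"
    by (rule integral_mult_right_zero)
  finally show ?thesis .
qed

text \<open>The fundamental theorem in \<open>t\<close>; the value at the final time 1 is zero
  because the support lies in \<open>t < 1\<close>, so only the initial slice remains.\<close>

lemma interior_dt:
  assumes \<phi>: "\<phi> \<in> trace_test"
  shows "integrable (interior_measure Omega) (dt \<phi>)"
    "(LINT z|interior_measure Omega. dt \<phi> z) = - (LINT x|lborel_on Omega. \<phi> (0, x))"
proof -
  note [measurable] = trace_test_measurable[OF \<phi>]
  obtain M B where M: "0 \<le> M" "0 \<le> B"
    "\<And>z. M < norm z \<or> 1 \<le> fst z \<Longrightarrow> \<phi> z = 0 \<and> dt \<phi> z = 0 \<and> (\<forall>j. grad_x \<phi> z $ j = 0)"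
    "\<And>z j. \<bar>\<phi> z\<bar> \<le> B \<and> \<bar>dt \<phi> z\<bar> \<le> B \<and> \<bar>grad_x \<phi> z $ j\<bar> \<le> B"
    using trace_test_bounds[OF \<phi>] by metis
  have Om[measurable]: "Omega \<in> sets borel"
    unfolding Omega_def by (intro borel_open open_Collect_less continuous_intros)
  have d0: "dt \<phi> z = 0" if "z \<notin> cball 0 M" for z using M(3)[of z] that by auto
  have dB: "\<bar>dt \<phi> z\<bar> \<le> B" for z using M(4) by auto
  note I = interior_integral[OF trace_test_measurable(2)[OF \<phi>] bounded_cball[of 0 M] d0 dB]
  show "integrable (interior_measure Omega) (dt \<phi>)" by (rule I(1))
  let ?G = "\<lambda>t w. indicator {0<..<1} t * (indicator {0<..} (fst w) * dt \<phi> (t, v3 w))"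
  have "(LINT z|interior_measure Omega. dt \<phi> z) = (LINT t|lborel. LINT w|lborel. ?G t w)"
    using I(2) by simp
  also have "\<dots> = (LINT w|lborel. LINT t|lborel. ?G t w)"
  proof (rule lborel_pair.Fubini_integral[symmetric])
    have "integrable lborel (\<lambda>p. ?G (fst p) (snd p))"
    proof (rule integrable_bounded_support[of _ "cball (0::real) M \<times> cball (0::real \<times> real \<times> real) M" B])
      show "bounded (cball (0::real) M \<times> cball (0::real \<times> real \<times> real) M)" by (intro bounded_Times) auto
      show "?G (fst p) (snd p) = 0" if "p \<notin> cball (0::real) M \<times> cball (0::real \<times> real \<times> real) M" for p
      proof -
        have "M < norm (fst p, v3 (snd p))"
          using that norm_fst_le[of "fst p" "v3 (snd p)"] norm_snd_le[of "v3 (snd p)" "fst p"]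
          by (auto simp: mem_Times_iff)
        then show ?thesis using M(3) by simp
      qed
      show "\<bar>?G (fst p) (snd p)\<bar> \<le> B" for p using dB M(2) by (auto simp: indicator_def)
    qed measurable
    then show "integrable (lborel \<Otimes>\<^sub>M lborel) (\<lambda>(t, w). ?G t w)"
      by (simp add: lborel_prod case_prod_beta')
  qed
  also have "\<dots> = (LINT w|lborel. - (indicator {0<..} (fst w) * \<phi> (0, v3 w)))"
  proof (intro Bochner_Integration.integral_cong refl)
    fix w
    have "(LINT t|lborel. ?G t w) = (LINT t|lborel. indicator {0<..} (fst w) * (dt \<phi> (t, v3 w) * indicator {0..1} t))"
    proof (rule integral_cong_AE)
      show "AE t in lborel. ?G t w = indicator {0<..} (fst w) * (dt \<phi> (t, v3 w) * indicator {0..1} t)"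
        using AE_lborel_singleton[of 0] AE_lborel_singleton[of 1]
        by eventually_elim (auto simp: indicator_def)
    qed measurable
    also have "\<dots> = indicator {0<..} (fst w) * (LINT t|lborel. dt \<phi> (t, v3 w) * indicator {0..1} t)" by simp
    also have "(LINT t|lborel. dt \<phi> (t, v3 w) * indicator {0..1} t) = \<phi> (1, v3 w) - \<phi> (0, v3 w)"
    proof (rule integral_FTC_Icc_real)
      show "((\<lambda>t. \<phi> (t, v3 w)) has_real_derivative dt \<phi> (t, v3 w)) (at t)" for t
        using has_real_derivative_along[of \<phi> "(0, v3 w)" t "(1, 0)"] trace_test_differentiable[OF \<phi>]
        by (simp add: dt_def)
      have "continuous_on UNIV (\<lambda>t. dt \<phi> (t, v3 w))"
        by (rule continuous_on_compose2[OF trace_test_continuous(2)[OF \<phi>]]) (auto intro!: continuous_intros)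
      then show "isCont (\<lambda>t. dt \<phi> (t, v3 w)) t" for t by (simp add: continuous_on_eq_continuous_at)
    qed auto
    finally show "(LINT t|lborel. ?G t w) = - (indicator {0<..} (fst w) * \<phi> (0, v3 w))"
      using M(3)[of "(1, v3 w)"] by simp
  qed
  also have "\<dots> = - (LINT w|lborel. indicator {0<..} (fst w) * \<phi> (0, v3 w))" by simp
  also have "(LINT w|lborel. indicator {0<..} (fst w) * \<phi> (0, v3 w)) = (LINT x|lborel. indicator Omega x * \<phi> (0, x))"
    by (subst integral_lborel_v3) (auto simp: Omega_def indicator_def intro!: Bochner_Integration.integral_cong)
  also have "\<dots> = (LINT x|lborel_on Omega. \<phi> (0, x))"
    by (subst integral_restrict_space) auto
  finally show "(LINT z|interior_measure Omega. dt \<phi> z) = - (LINT x|lborel_on Omega. \<phi> (0, x))" .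
qed

subsection \<open>The main result\<close>

text \<open>Interior test functions are trace test functions without initial and boundary values.
  The interior equations therefore follow from the trace identities.\<close>

lemma Cinf_c_imp_trace_test:
  assumes "\<eta> \<in> Cinf_c ({0<..<1} \<times> Omega)"
  shows "\<eta> \<in> trace_test" "\<eta> (0, x) = 0" "\<eta> (t, v3 (0, v)) = 0"
proof -
  have s: "supp \<eta> \<subseteq> {0<..<1} \<times> Omega" using assms by (auto simp: Cinf_c_def Ck_c_def)
  then show "\<eta> \<in> trace_test"
    using assms unfolding trace_test_def Cinf_c_def Ck_c_def by fastforce
  show "\<eta> (0, x) = 0" by (rule supp_outside[of "(0, x)" \<eta>]) (use s in auto)
  show "\<eta> (t, v3 (0, v)) = 0"
    by (rule supp_outside[of "(t, v3 (0, v))" \<eta>]) (use s in \<open>auto simp: Omega_def\<close>)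
qed

lemma trace_test_boundary_integral:
  obtains c :: real where "0 < c"
    "\<And>\<phi>. \<phi> \<in> trace_test \<Longrightarrow> (LINT z|boundary_measure Omega. \<phi> z) =
       c * (LINT t|lborel. indicator {0<..<1} t * (LINT w|lborel. \<phi> (t, v3 (0, w))))"
proof (rule boundary_integral)
  fix c :: real assume c: "0 < c" and bi: "\<And>f B S. f \<in> borel_measurable borel \<Longrightarrow> bounded S \<Longrightarrow>
       (\<And>z. z \<notin> S \<Longrightarrow> f z = 0) \<Longrightarrow> (\<And>z. \<bar>f z :: real\<bar> \<le> B) \<Longrightarrow> (LINT z|boundary_measure Omega. f z) =
       c * (LINT t|lborel. indicator {0<..<1} t * (LINT w|lborel. f (t, v3 (0, w))))"
  show thesis
  proof (rule that[OF c])
    fix \<phi> assume \<phi>: "\<phi> \<in> trace_test"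
    obtain M B where M: "\<And>z. M < norm z \<or> 1 \<le> fst z \<Longrightarrow> \<phi> z = 0 \<and> dt \<phi> z = 0 \<and> (\<forall>j. grad_x \<phi> z $ j = 0)"
      "\<And>z j. \<bar>\<phi> z\<bar> \<le> B \<and> \<bar>dt \<phi> z\<bar> \<le> B \<and> \<bar>grad_x \<phi> z $ j\<bar> \<le> B"
      using trace_test_bounds[OF \<phi>] by metis
    have "\<phi> z = 0" if "z \<notin> cball 0 M" for z using M(1)[of z] that by auto
    moreover have "\<bar>\<phi> z\<bar> \<le> B" for z using M(2) by blast
    ultimately show "(LINT z|boundary_measure Omega. \<phi> z) =
       c * (LINT t|lborel. indicator {0<..<1} t * (LINT w|lborel. \<phi> (t, v3 (0, w))))"
      by (rule bi[OF trace_test_measurable(1)[OF \<phi>] bounded_cball[of 0 M]])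
  qed
qed

lemma measurable_interior:
  "f \<in> borel_measurable borel \<Longrightarrow> f \<in> borel_measurable (interior_measure Omega)"
  unfolding interior_measure_def by (rule measurable_restrict_space1) simp

lemma inflow_solution:
  assumes c: "0 < c"
    and bi: "\<And>\<phi>. \<phi> \<in> trace_test \<Longrightarrow> (LINT z|boundary_measure Omega. \<phi> z) =
       c * (LINT t|lborel. indicator {0<..<1} t * (LINT w|lborel. \<phi> (t, v3 (0, w))))"
  shows "inflow a \<in> zero_datum_solutions Omega (\<lambda>z. field c (snd z))"
  unfolding zero_datum_solutions_def
proof (intro CollectI conjI exI)
  show "inflow a \<in> Linfty (interior_measure Omega)"
    unfolding Linfty_def using abs_inflow_le[of a] by (auto intro!: measurable_interior exI[of _ "\<bar>a\<bar>"])
  show "solves_interior Omega (\<lambda>z. field c (snd z)) (inflow a)"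
    unfolding solves_interior_def by (auto simp: inflow_balance[OF Cinf_c_imp_trace_test(1) c] Cinf_c_imp_trace_test(3))
  \<comment> \<open>Mass enters at rate \<open>a / 2\<close> per unit Lebesgue area, since half of
    the boundary carries \<open>pattern = 1\<close> in the weak limit; division by \<open>c\<close>
    converts this to Hausdorff area. For \<open>a > 0\<close> the trace of \<open>b u\<close> is
    negative although that of \<open>b\<close> is 1.\<close>
  show "are_traces Omega (\<lambda>z. field c (snd z)) (inflow a) (\<lambda>_. - (a / (2 * c))) (\<lambda>_. 0)"
    unfolding are_traces_def
  proof (intro conjI ballI)
    fix \<phi> assume \<phi>: "\<phi> \<in> trace_test"
    have "(LINT z|boundary_measure Omega. - (a / (2 * c)) * \<phi> z) = - (a / (2 * c)) * (LINT z|boundary_measure Omega. \<phi> z)"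
      by (rule integral_mult_right_zero)
    then show "(LINT z|boundary_measure Omega. - (a / (2 * c)) * \<phi> z) - (LINT x|lborel_on Omega. \<phi> (0, x) * 0) =
        (LINT z|interior_measure Omega. inflow a z * (dt \<phi> z + field c (snd z) \<bullet> grad_x \<phi> z))"
      using c by (simp add: inflow_balance[OF \<phi> c] bi[OF \<phi>])
  qed (auto simp: Linfty_def)
  show "AE x in lborel_on Omega. (0::real) = 0" by simp
qed

lemma inflow_distinct:
  assumes "AE z in interior_measure Omega. inflow a z = inflow a' z"
  shows "a = a'"
proof (rule ccontr)
  assume ne: "a \<noteq> a'"
  \<comment> \<open>A box in layer -1 on which the relevant square waves are all 1, so that the
    speed is 0 and the pattern is 1. Its heights stay below 3/4, hence below every time in the
    interval \<open>{3/4<..<1}\<close>.\<close>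
  define Y where "Y = {x::real^3. coords x \<in> {1/2<..<3/4::real} \<times> {0<..<1/4::real} \<times> {0<..<1/4::real}}"
  have box: "{1/2<..<3/4::real} \<times> {0<..<1/4::real} \<times> {0<..<1/4::real} \<in> sets borel" by (simp add: borel_Times)
  have Ym[measurable]: "Y \<in> sets borel"
    using measurable_sets[OF borel_measurable_coords box] by (simp add: Y_def vimage_def)
  have ne_on: "inflow a z \<noteq> inflow a' z" if "z \<in> {3/4<..<1::real} \<times> Y" for z
  proof -
    obtain t x where z: "z = (t, x)" by (cases z)
    have x: "1/2 < x $ 1" "x $ 1 < 3/4" "0 < x $ 2" "x $ 2 < 1/4" "0 < x $ 3" "x $ 3 < 1/4" and t: "3/4 < t"
      using that by (auto simp: z Y_def coords_def)
    have l: "lev (x $ 1) = -1" using x by (intro lev_eq) auto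
    have s: "sqw 0 (x $ 3) = 1" "sqw (-2) (x $ 3) = 1" "sqw (-1) (x $ 2) = 1"
    proof -
      have "\<lfloor>x $ 3\<rfloor> = 0" "\<lfloor>x $ 3 * 4\<rfloor> = 0" "\<lfloor>x $ 2 * 2\<rfloor> = 0" using x by (auto simp: floor_eq_iff)
      then show "sqw 0 (x $ 3) = 1" "sqw (-2) (x $ 3) = 1" "sqw (-1) (x $ 2) = 1"
        by (simp_all add: sqw_def power_int_minus)
    qed
    then have "shift (-1) (x $ 3) = 0" by (simp add: shift_def)
    then have "pattern (coords x) = 1" using s l by (simp add: pattern_def coords_def)
    then show ?thesis using ne x t by (simp add: z inflow_def)
  qed
  have Om[measurable]: "Omega \<in> sets borel"
    unfolding Omega_def by (intro borel_open open_Collect_less continuous_intros)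
  have "{0<..<1::real} \<times> Omega \<in> sets borel" by (intro borel_Times Om) auto
  then have "AE z in lborel. z \<in> {0<..<1} \<times> Omega \<longrightarrow> inflow a z = inflow a' z"
    using assms unfolding interior_measure_def by (subst (asm) AE_restrict_space_iff) auto
  then have "AE z in lborel. z \<notin> {3/4<..<1::real} \<times> Y"
  proof eventually_elim
    case (elim z)
    have "z \<in> {0<..<1} \<times> Omega" if "z \<in> {3/4<..<1} \<times> Y"
      using that by (auto simp: Y_def Omega_def coords_def)
    with elim ne_on show ?case by blast
  qed
  moreover have XY: "{3/4<..<1::real} \<times> Y \<in> sets lborel" using borel_Times[OF _ Ym, of "{3/4<..<1::real}"] by simp
  ultimately have "emeasure lborel ({3/4<..<1::real} \<times> Y) = 0"
    by (subst (asm) AE_iff_measurable[OF XY]) auto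
  moreover have "emeasure lborel Y = emeasure lborel ({1/2<..<3/4::real} \<times> {0<..<1/4::real} \<times> {0<..<1/4::real})"
  proof -
    have v: "v3 -` Y = {1/2<..<3/4::real} \<times> {0<..<1/4::real} \<times> {0<..<1/4::real}" by (auto simp: Y_def)
    have "emeasure lborel Y = emeasure (distr lborel borel v3) Y" by (simp add: distr_lborel_v3)
    also have "\<dots> = emeasure lborel (v3 -` Y)" by (simp add: emeasure_distr)
    finally show ?thesis unfolding v .
  qed
  ultimately show False
    using Ym by (simp add: emeasure_lborel_Times borel_Times ennreal_mult[symmetric])
qed

text \<open>The field is independent of time, so its norm is a finite constant on a time interval of
  length 1.\<close>

lemma field_L1_BV:
  assumes "0 < c" "open U" "bounded U" "closure U \<subseteq> Omega"
  shows "(\<lambda>z. field c (snd z)) \<in> L1_BV U"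
proof -
  have bv: "field c \<in> BV U" by (rule field_BV[OF assms])
  have "BV_norm U (field c) < \<infinity>"
    using bv unfolding BV_def BV_norm_def integrable_iff_bounded by (auto simp: less_top)
  moreover have "emeasure (lebesgue_on {0<..<1::real}) {0<..<1} = 1"
    by (subst emeasure_restrict_space) auto
  ultimately show ?thesis
    using bv unfolding L1_BV_def
    by (simp add: nn_integral_const space_restrict_space)
qed

theorem theorem1p3:
  fixes \<Omega> :: "(real^3) set"
  assumes "\<Omega> = {x. 0 < x $ 1}"
  shows "\<exists>b :: real \<times> (real^3) \<Rightarrow> real^3.
           b \<in> Linfty (interior_measure \<Omega>) \<and>
           div_free \<Omega> b \<and>
           (\<forall>\<Omega>' :: (real^3) set. open \<Omega>' \<and> bounded \<Omega>' \<and> closure \<Omega>' \<subseteq> \<Omega> \<longrightarrow> b \<in> L1_BV \<Omega>') \<and>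
           is_normal_trace \<Omega> b (\<lambda>_. 1) \<and>
           infinite (zero_datum_solutions \<Omega> b // ae_eq (interior_measure \<Omega>))"
proof -
  have \<Omega>: "\<Omega> = Omega" by (simp add: assms Omega_def)
  obtain c :: real where c: "0 < c" and bi: "\<And>\<phi>. \<phi> \<in> trace_test \<Longrightarrow> (LINT z|boundary_measure Omega. \<phi> z) =
       c * (LINT t|lborel. indicator {0<..<1} t * (LINT w|lborel. \<phi> (t, v3 (0, w))))"
    by (rule trace_test_boundary_integral) blast
  let ?b = "\<lambda>z. field c (snd z)"
  have "?b \<in> Linfty (interior_measure Omega)"
  proof -
    have "norm (field c x) \<le> 3 * (1 + 2 * c)" for x
    proof -
      have "norm (field c x) \<le> (\<Sum>i\<in>UNIV. \<bar>field c x $ i\<bar>)" by (rule norm_le_l1_cart)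
      also have "\<dots> \<le> (\<Sum>i\<in>(UNIV::3 set). 1 + 2 * c)" by (intro sum_mono field_component_bound c)
      finally show ?thesis by simp
    qed
    then show ?thesis unfolding Linfty_def by (auto intro!: measurable_interior)
  qed
  moreover have "div_free Omega ?b"
    unfolding div_free_def by (auto simp: interior_field_flux(2)[OF Cinf_c_imp_trace_test(1) c] Cinf_c_imp_trace_test(3))
  moreover have "\<forall>U. open U \<and> bounded U \<and> closure U \<subseteq> Omega \<longrightarrow> ?b \<in> L1_BV U"
    using field_L1_BV[OF c] by blast
  moreover have "is_normal_trace Omega ?b (\<lambda>_. 1)"
    unfolding is_normal_trace_def
  proof (intro conjI ballI)
    fix \<phi> assume \<phi>: "\<phi> \<in> trace_test"
    have "(LINT z|interior_measure Omega. dt \<phi> z + ?b z \<bullet> grad_x \<phi> z) =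
        (LINT z|interior_measure Omega. dt \<phi> z) + (LINT z|interior_measure Omega. ?b z \<bullet> grad_x \<phi> z)"
      by (rule Bochner_Integration.integral_add[OF interior_dt(1)[OF \<phi>] interior_field_flux(1)[OF \<phi> c]])
    then show "(LINT z|boundary_measure Omega. 1 * \<phi> z) - (LINT x|lborel_on Omega. \<phi> (0, x)) =
        (LINT z|interior_measure Omega. dt \<phi> z + ?b z \<bullet> grad_x \<phi> z)"
      by (simp add: interior_dt(2)[OF \<phi>] interior_field_flux(2)[OF \<phi> c] bi[OF \<phi>])
  qed (auto simp: Linfty_def)
  moreover have "infinite (zero_datum_solutions Omega ?b // ae_eq (interior_measure Omega))"
  proof -
    \<comment> \<open>One class for each natural amplitude; the class for \<open>n = 0\<close> is
      that of the zero solution.\<close>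
    let ?cls = "\<lambda>n::nat. ae_eq (interior_measure Omega) `` {inflow (real n)}"
    have "inj ?cls"
    proof (rule injI)
      fix n m assume "?cls n = ?cls m"
      moreover have "inflow (real m) \<in> ?cls m" by (simp add: ae_eq_def)
      ultimately have "inflow (real m) \<in> ?cls n" by (simp only:)
      then have "AE z in interior_measure Omega. inflow (real n) z = inflow (real m) z"
        unfolding ae_eq_def by simp
      then show "n = m" using inflow_distinct of_nat_eq_iff by blast
    qed
    then have "infinite (range ?cls)" by (rule range_inj_infinite)
    moreover have "range ?cls \<subseteq> zero_datum_solutions Omega ?b // ae_eq (interior_measure Omega)"
      using inflow_solution[OF c bi] by (auto intro: quotientI)
    ultimately show ?thesis using finite_subset by blast
  qed
  ultimately show ?thesis unfolding \<Omega> by blast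
qed

end
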